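(* Let $(\mathcal{H},T,L,\{w_i\}_{i\in I})$ be a tuple, i.e. $\mathcal{H}$ is a separable complex Hilbert space, $T,L\in\mathcal{B}(\mathcal{H})$, $T$ is invertible, $TL=LT$, and $\{w_i\}_{i\in I}\subset\mathcal{H}$ is an at most countable family. Then $(\mathcal{H},T,L,\{w_i\}_{i\in I})$ is a unilateral frame-tuple if and only if it is similar to a unilateral basic tuple (with index set $I$). Moreover, this basic tuple is unique.
   Context: All Hilbert spaces are complex and separable; $\mathcal{B}(\mathcal{H})$ denotes the bounded linear operators on $\mathcal{H}$, $\mathbb{N}_0=\{0,1,2,\dots\}$, $\mathbb{T}$ is the unit circle with normalized Lebesgue measure, and $P_{\mathcal N}$ is the orthogonal projection onto a closed subspace $\mathcal N$. Tuples. A tuple $(\mathcal{H},T,L,\{w_i\}_{i\in I})$ consists of a separable Hilbert space $\mathcal{H}$, commuting operators $T,L\in\mathcal{B}(\mathcal{H})$ with $T$ invertible, and a family $\{w_i\}_{i\in I}$ in $\mathcal{H}$ with $I$ at most countable. It is a unilateral frame-tuple if $\{T^kL^jw_i: k\in\mathbb{Z}, j\in\mathbb{N}_0, i\in I\}$ is a frame of $\mathcal{H}$. Similarity. $(\mathcal{H}_1,T_1,L_1,\{v_i\}_{i\in I})$ and $(\mathcal{H}_2,T_2,L_2,\{w_i\}_{i\in I})$ (same index set) are similar if there is a bounded isomorphism (bounded linear bijection) $C:\mathcal{H}_1\to\mathcal{H}_2$ with $Cv_i=w_i$ for all $i\in I$, $T_2C=CT_1$ and $L_2C=CL_1$. Spaces.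 For a Hilbert space $\mathcal K$, $L^2(\mathbb{T},\mathcal{K})$ is the Hilbert space of (weakly) measurable square-integrable $\mathcal{K}$-valued functions, and $H^2_{\mathcal K}\subseteq L^2(\mathbb{T},\mathcal K)$ is the closed subspace of those $f$ with $\langle f(\cdot),u\rangle_{\mathcal K}\in H^2$ for all $u\in\mathcal K$, where $H^2\subset L^2(\mathbb T)$ is the scalar Hardy space (negative Fourier coefficients vanish). On $L^2(\mathbb{T},H^2_{\ell^2(I)})$ define $(Uf)(\lambda)=\lambda f(\lambda)$ and $(\widehat{S}f)(\lambda)(z)=z\,f(\lambda)(z)$ for a.e. $\lambda,z\in\mathbb{T}$. A vector of $\ell^2(I)$ is identified with the corresponding constant function in $L^2(\mathbb{T},H^2_{\ell^2(I)})$. A closed subspace is $A$-invariant if $A$ maps it into itself, and $A$-reducing if it is invariant under both $A$ and $A^*$. Unilateral basic tuple. A tuple $(\mathcal N,U|_{\mathcal N},A,\{\varphi_i\}_{i\in I})$ where $\mathcal N$ is a closed subspace of $L^2(\mathbb{T},H^2_{\ell^2(I)})$ that is $U$-reducing and $\widehat{S}^*$-invariant, $A=P_{\mathcal N}\widehat S|_{\mathcal N}:\mathcal N\to\mathcal N$, and $\varphi_i=P_{\mathcal N}\varepsilon_i$, with $\{\varepsilon_i\}_{i\in I}$ the canonical orthonormal basis of $\ell^2(I)$. *)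

theory Defs
  imports "HOL-Analysis.Analysis"
begin

section \<open>Complex inner product spaces\<close>

text \<open>The distribution has no complex inner product spaces.  We put the complex structure on top of
  \<open>real_inner\<close>, whose real inner product is the real part of the complex one, so that the norm,
  the topology, closedness and completeness are the ones of the library.  The complex inner product
  is linear in its first argument.\<close>

class complex_inner = real_inner +
  fixes scaleC :: "complex \<Rightarrow> 'a \<Rightarrow> 'a" (infixr "*\<^sub>C" 75)
    and cinner :: "'a \<Rightarrow> 'a \<Rightarrow> complex"
  assumes scaleC_add_right: "a *\<^sub>C (x + y) = a *\<^sub>C x + a *\<^sub>C y"
    and scaleC_add_left: "(a + b) *\<^sub>C x = a *\<^sub>C x + b *\<^sub>C x"
    and scaleC_scaleC: "a *\<^sub>C b *\<^sub>C x = (a * b) *\<^sub>C x"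
    and scaleC_of_real: "complex_of_real r *\<^sub>C x = r *\<^sub>R x"
    and cinner_commute: "cinner x y = cnj (cinner y x)"
    and cinner_add_left: "cinner (x + y) z = cinner x z + cinner y z"
    and cinner_scaleC_left: "cinner (a *\<^sub>C x) y = a * cinner x y"
    and Re_cinner: "Re (cinner x y) = inner x y"

lemma scaleC_one: "1 *\<^sub>C x = (x :: 'a::complex_inner)"
  using scaleC_of_real[of 1 x] by simp

global_interpretation complex_vector: vector_space "scaleC :: complex \<Rightarrow> 'a \<Rightarrow> 'a::complex_inner"
  by unfold_locales (simp_all add: scaleC_add_right scaleC_add_left scaleC_scaleC scaleC_one)

lemma cinner_add_right: "cinner x (y + z) = cinner x y + cinner x (z :: 'a::complex_inner)"
  by (metis cinner_add_left cinner_commute complex_cnj_add)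

lemma cinner_scaleC_right: "cinner x (a *\<^sub>C y) = cnj a * cinner x (y :: 'a::complex_inner)"
  by (metis cinner_commute cinner_scaleC_left complex_cnj_mult)

lemma cinner_zero_left [simp]: "cinner 0 (x :: 'a::complex_inner) = 0"
  using cinner_add_left[of 0 0 x] by simp

lemma cinner_minus_left: "cinner (- x) (y :: 'a::complex_inner) = - cinner x y"
  using cinner_add_left[of x "- x" y] by (simp add: eq_neg_iff_add_eq_0 add.commute)

lemma cinner_diff_left: "cinner (x - y) (z :: 'a::complex_inner) = cinner x z - cinner y z"
  using cinner_add_left[of x "- y" z] by (simp add: cinner_minus_left)

lemma cinner_self: "cinner x (x :: 'a::complex_inner) = complex_of_real ((norm x)\<^sup>2)"
proof -
  have "Im (cinner x x) = 0"
    using cinner_commute[of x x] by (simp add: complex_eq_iff)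
  then show ?thesis
    by (simp add: complex_eq_iff Re_cinner power2_norm_eq_inner)
qed

lemma norm_scaleC: "norm (a *\<^sub>C (x :: 'a::complex_inner)) = cmod a * norm x"
proof -
  have "cinner (a *\<^sub>C x) (a *\<^sub>C x) = (a * cnj a) * cinner x x"
    by (simp add: cinner_scaleC_left cinner_scaleC_right mult.assoc mult.left_commute)
  then have "complex_of_real ((norm (a *\<^sub>C x))\<^sup>2) =
      complex_of_real ((cmod a)\<^sup>2) * complex_of_real ((norm x)\<^sup>2)"
    by (simp only: cinner_self complex_norm_square)
  then have "(norm (a *\<^sub>C x))\<^sup>2 = (cmod a * norm x)\<^sup>2"
    by (simp only: power_mult_distrib of_real_mult[symmetric] of_real_eq_iff)
  then show ?thesis
    by (simp add: power2_eq_iff_nonneg)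
qed

lemma norm_cinner_le: "cmod (cinner x y) \<le> norm x * norm (y :: 'a::complex_inner)"
proof (cases "cinner x y = 0")
  case False
  define w where "w = cinner x y"
  define c where "c = cnj w / complex_of_real (cmod w)"
  have "cmod w \<noteq> 0"
    using False by (simp add: w_def)
  then have c1: "cmod c = 1"
    by (simp add: c_def norm_divide)
  have "c * w = complex_of_real ((cmod w)\<^sup>2) / complex_of_real (cmod w)"
    by (simp only: c_def complex_norm_square times_divide_eq_left times_divide_eq_right mult.commute)
  also have "\<dots> = complex_of_real (cmod w)"
    using \<open>cmod w \<noteq> 0\<close> by (simp add: power2_eq_square)
  finally have c2: "c * cinner x y = complex_of_real (cmod (cinner x y))"
    by (simp add: w_def)
  have "cmod (cinner x y) = Re (cinner (c *\<^sub>C x) y)"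
    by (simp add: cinner_scaleC_left c2)
  then have "cmod (cinner x y) = inner (c *\<^sub>C x) y"
    by (simp add: Re_cinner)
  also have "\<dots> \<le> norm (c *\<^sub>C x) * norm y"
    by (rule norm_cauchy_schwarz)
  finally show ?thesis
    by (simp add: norm_scaleC c1)
qed simp

instantiation complex :: complex_inner
begin

definition "scaleC_complex (a :: complex) (x :: complex) = a * x"

definition "cinner_complex (x :: complex) (y :: complex) = x * cnj y"

instance
  by standard
    (simp_all add: scaleC_complex_def cinner_complex_def algebra_simps scaleR_conv_of_real inner_complex_def)

end


section \<open>Operators and subspaces\<close>

text \<open>All Hilbert spaces below are complete subspaces of a type of class \<open>complex_inner\<close>.  Operators
  are functions on that type of which only the values on the subspace matter.\<close>

definition separable_hilbert_space :: "'a::complex_inner set \<Rightarrow> bool" where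
  "separable_hilbert_space H \<longleftrightarrow>
     complex_vector.subspace H \<and> complete H \<and> separable_space (top_of_set H)"

definition bounded_operator ::
  "'a::complex_inner set \<Rightarrow> 'b::complex_inner set \<Rightarrow> ('a \<Rightarrow> 'b) \<Rightarrow> bool" where
  "bounded_operator H K A \<longleftrightarrow>
     A ` H \<subseteq> K \<and>
     (\<forall>x\<in>H. \<forall>y\<in>H. A (x + y) = A x + A y) \<and>
     (\<forall>c. \<forall>x\<in>H. A (c *\<^sub>C x) = c *\<^sub>C A x) \<and>
     (\<exists>M. \<forall>x\<in>H. norm (A x) \<le> M * norm x)"

definition invertible_operator :: "'a::complex_inner set \<Rightarrow> ('a \<Rightarrow> 'a) \<Rightarrow> bool" where
  "invertible_operator H A \<longleftrightarrow>
     bounded_operator H H A \<and>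
     (\<exists>B. bounded_operator H H B \<and> (\<forall>x\<in>H. B (A x) = x \<and> A (B x) = x))"

definition op_power_int :: "'a set \<Rightarrow> ('a \<Rightarrow> 'a) \<Rightarrow> int \<Rightarrow> 'a \<Rightarrow> 'a" where
  "op_power_int H A k = (if 0 \<le> k then A ^^ nat k else inv_into H A ^^ nat (- k))"

definition adjoint_on :: "'a::complex_inner set \<Rightarrow> ('a \<Rightarrow> 'a) \<Rightarrow> 'a \<Rightarrow> 'a" where
  "adjoint_on H A y = (THE z. z \<in> H \<and> (\<forall>x\<in>H. cinner (A x) y = cinner x z))"

definition orth_proj :: "'a::complex_inner set \<Rightarrow> 'a \<Rightarrow> 'a" where
  "orth_proj N x = (THE p. p \<in> N \<and> (\<forall>y\<in>N. cinner (x - p) y = 0))"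

definition invariant_under :: "('a \<Rightarrow> 'a) \<Rightarrow> 'a set \<Rightarrow> bool" where
  "invariant_under A N \<longleftrightarrow> A ` N \<subseteq> N"

definition reducing_on :: "'a::complex_inner set \<Rightarrow> ('a \<Rightarrow> 'a) \<Rightarrow> 'a set \<Rightarrow> bool" where
  "reducing_on H A N \<longleftrightarrow> invariant_under A N \<and> invariant_under (adjoint_on H A) N"

text \<open>A frame is an indexed family: repeated vectors are counted with multiplicity.\<close>

definition is_frame :: "'a::complex_inner set \<Rightarrow> 'j set \<Rightarrow> ('j \<Rightarrow> 'a) \<Rightarrow> bool" where
  "is_frame H J x \<longleftrightarrow>
     (\<forall>j\<in>J. x j \<in> H) \<and>
     (\<exists>A>0. \<exists>B>0. \<forall>f\<in>H.
        (\<lambda>j. (cmod (cinner f (x j)))\<^sup>2) summable_on J \<and>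
        A * (norm f)\<^sup>2 \<le> (\<Sum>\<^sub>\<infinity>j\<in>J. (cmod (cinner f (x j)))\<^sup>2) \<and>
        (\<Sum>\<^sub>\<infinity>j\<in>J. (cmod (cinner f (x j)))\<^sup>2) \<le> B * (norm f)\<^sup>2)"


section \<open>The space $\ell^2$\<close>

typedef 'i ell2 = "{x :: 'i \<Rightarrow> complex. (\<lambda>i. (cmod (x i))\<^sup>2) summable_on UNIV}"
  by (intro exI[of _ "\<lambda>_. 0"]) simp

setup_lifting type_definition_ell2

lemma mult_le_sum_squares:
  fixes a b :: real
  assumes "0 \<le> a" "0 \<le> b"
  shows "a * b \<le> a\<^sup>2 + b\<^sup>2"
proof -
  have "2 * a * b \<le> a\<^sup>2 + b\<^sup>2" "0 \<le> a * b"
    using sum_squares_bound[of a b] assms by auto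
  then show ?thesis
    by linarith
qed

lemma square_summable_mult:
  assumes "(\<lambda>i. (cmod (x i))\<^sup>2) summable_on A" "(\<lambda>i. (cmod (y i))\<^sup>2) summable_on A"
  shows "(\<lambda>i. x i * cnj (y i)) summable_on A"
proof -
  have "(\<lambda>i. norm (x i * cnj (y i))) summable_on A"
  proof (rule Infinite_Sum.abs_summable_on_comparison_test')
    show "(\<lambda>i. (cmod (x i))\<^sup>2 + (cmod (y i))\<^sup>2) summable_on A"
      using assms by (rule summable_on_add)
    show "norm (x i * cnj (y i)) \<le> (cmod (x i))\<^sup>2 + (cmod (y i))\<^sup>2" for i
      using mult_le_sum_squares[of "cmod (x i)" "cmod (y i)"] by (simp add: norm_mult)
  qed
  then show ?thesis
    by (rule abs_summable_summable)
qed

lemma square_summable_add: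
  assumes "(\<lambda>i. (cmod (x i))\<^sup>2) summable_on A" "(\<lambda>i. (cmod (y i))\<^sup>2) summable_on A"
  shows "(\<lambda>i. (cmod (x i + y i))\<^sup>2) summable_on A"
proof (rule summable_on_comparison_test)
  show "(\<lambda>i. 2 * (cmod (x i))\<^sup>2 + 2 * (cmod (y i))\<^sup>2) summable_on A"
    using assms by (intro summable_on_add summable_on_cmult_right)
  show "(cmod (x i + y i))\<^sup>2 \<le> 2 * (cmod (x i))\<^sup>2 + 2 * (cmod (y i))\<^sup>2" for i
  proof -
    have "(cmod (x i + y i))\<^sup>2 \<le> (cmod (x i) + cmod (y i))\<^sup>2"
      by (simp add: norm_triangle_ineq power_mono)
    also have "\<dots> \<le> 2 * (cmod (x i))\<^sup>2 + 2 * (cmod (y i))\<^sup>2"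
      using sum_squares_bound[of "cmod (x i)" "cmod (y i)"] by (simp add: power2_sum)
    finally show ?thesis .
  qed
qed simp

lemma square_summable_mult_left:
  assumes "(\<lambda>i. (cmod (x i))\<^sup>2) summable_on A"
  shows "(\<lambda>i. (cmod (c * x i))\<^sup>2) summable_on A"
  using summable_on_cmult_right[OF assms, of "(cmod c)\<^sup>2"]
  by (simp add: norm_mult power_mult_distrib)

instantiation ell2 :: (type) complex_inner
begin

lift_definition zero_ell2 :: "'a ell2" is "\<lambda>_. 0" by simp

lift_definition plus_ell2 :: "'a ell2 \<Rightarrow> 'a ell2 \<Rightarrow> 'a ell2" is "\<lambda>x y i. x i + y i"
  by (rule square_summable_add)

lift_definition uminus_ell2 :: "'a ell2 \<Rightarrow> 'a ell2" is "\<lambda>x i. - x i" by simp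

lift_definition minus_ell2 :: "'a ell2 \<Rightarrow> 'a ell2 \<Rightarrow> 'a ell2" is "\<lambda>x y i. x i - y i"
  subgoal for x y using square_summable_add[of x UNIV "\<lambda>i. - y i"] by simp
  done

lift_definition scaleC_ell2 :: "complex \<Rightarrow> 'a ell2 \<Rightarrow> 'a ell2" is "\<lambda>c x i. c * x i"
  by (rule square_summable_mult_left)

lift_definition cinner_ell2 :: "'a ell2 \<Rightarrow> 'a ell2 \<Rightarrow> complex" is
  "\<lambda>x y. \<Sum>\<^sub>\<infinity>i. x i * cnj (y i)" .

definition "scaleR_ell2 r (x :: 'a ell2) = complex_of_real r *\<^sub>C x"
definition "inner_ell2 (x :: 'a ell2) y = Re (cinner x y)"
definition "norm_ell2 (x :: 'a ell2) = sqrt (inner x x)"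
definition "dist_ell2 (x :: 'a ell2) y = norm (x - y)"
definition "sgn_ell2 (x :: 'a ell2) = inverse (norm x) *\<^sub>R x"
definition [code del]:
  "(uniformity :: ('a ell2 \<times> 'a ell2) filter) = (INF e\<in>{0<..}. principal {(x, y). dist x y < e})"
definition [code del]:
  "open (U :: 'a ell2 set) \<longleftrightarrow> (\<forall>x\<in>U. eventually (\<lambda>(x', y). x' = x \<longrightarrow> y \<in> U) uniformity)"

instance
proof
  fix x y z :: "'a ell2" and a b :: complex and r s :: real
  show "x + y + z = x + (y + z)" "x + y = y + x" "0 + x = x" "- x + x = 0" "x - y = x + - y"
    by (transfer; simp add: algebra_simps fun_eq_iff)+
  show "a *\<^sub>C (x + y) = a *\<^sub>C x + a *\<^sub>C y" "(a + b) *\<^sub>C x = a *\<^sub>C x + b *\<^sub>C x"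
    "a *\<^sub>C b *\<^sub>C x = (a * b) *\<^sub>C x"
    by (transfer; simp add: algebra_simps fun_eq_iff)+
  show "r *\<^sub>R (x + y) = r *\<^sub>R x + r *\<^sub>R y" "(r + s) *\<^sub>R x = r *\<^sub>R x + s *\<^sub>R x"
    "r *\<^sub>R s *\<^sub>R x = (r * s) *\<^sub>R x" "1 *\<^sub>R x = x"
    unfolding scaleR_ell2_def by (transfer; simp add: algebra_simps fun_eq_iff)+
  show "complex_of_real r *\<^sub>C x = r *\<^sub>R x"
    by (simp add: scaleR_ell2_def)
  show comm: "cinner x y = cnj (cinner y x)" for x y :: "'a ell2"
    by transfer (simp flip: infsum_cnj add: mult.commute)
  show add: "cinner (x + y) z = cinner x z + cinner y z"
    by transfer (simp add: distrib_right infsum_add square_summable_mult)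
  show scal: "cinner (a *\<^sub>C x) y = a * cinner x y" for a
    by transfer (simp add: mult.assoc infsum_cmult_right square_summable_mult)
  show "Re (cinner x y) = inner x y"
    by (simp add: inner_ell2_def)
  show "inner x y = inner y x"
    unfolding inner_ell2_def by (subst comm) simp
  show "inner (x + y) z = inner x z + inner y z" "inner (r *\<^sub>R x) y = r * inner x y"
    by (simp_all add: inner_ell2_def add scaleR_ell2_def scal)
  have "cinner x x = (\<Sum>\<^sub>\<infinity>i. complex_of_real ((cmod (Rep_ell2 x i))\<^sup>2))"
    by (simp only: cinner_ell2.rep_eq complex_norm_square)
  also have "\<dots> = complex_of_real (\<Sum>\<^sub>\<infinity>i. (cmod (Rep_ell2 x i))\<^sup>2)"
    using Rep_ell2[of x] by (intro infsumI has_sum_of_real has_sum_infsum) simp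
  finally have self: "cinner x x = complex_of_real (\<Sum>\<^sub>\<infinity>i. (cmod (Rep_ell2 x i))\<^sup>2)" .
  show "0 \<le> inner x x"
    by (simp add: inner_ell2_def self infsum_nonneg)
  show "inner x x = 0 \<longleftrightarrow> x = 0"
  proof
    assume "inner x x = 0"
    then have 0: "(\<Sum>\<^sub>\<infinity>i. (cmod (Rep_ell2 x i))\<^sup>2) = 0"
      by (simp add: inner_ell2_def self)
    have "(cmod (Rep_ell2 x i))\<^sup>2 = 0" for i
      by (rule nonneg_infsum_le_0D[where A = UNIV]) (use 0 Rep_ell2[of x] in auto)
    then show "x = 0"
      by transfer auto
  qed (simp add: inner_ell2_def, transfer, simp)
  show "norm x = sqrt (inner x x)"
    by (rule norm_ell2_def)
qed (fact dist_ell2_def sgn_ell2_def uniformity_ell2_def open_ell2_def)+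

end

lift_definition ell2_unit :: "'i \<Rightarrow> 'i ell2" is "\<lambda>i j. if j = i then 1 else 0"
proof -
  fix i :: 'i
  show "(\<lambda>j. (cmod (if j = i then 1 else 0))\<^sup>2) summable_on UNIV"
    by (rule finite_nonzero_values_imp_summable_on) (auto intro: finite_subset[of _ "{i}"])
qed

text \<open>$\ell^2(I)$ for a subset \<open>I\<close> of the index type.\<close>


definition ell2_on :: "'i set \<Rightarrow> 'i ell2 set" where
  "ell2_on I = {x. \<forall>i. i \<notin> I \<longrightarrow> Rep_ell2 x i = 0}"



section \<open>The space $L^2(\mathbb{T},K)$\<close>

text \<open>Normalized Lebesgue measure on the unit circle, as a measure on the Borel sets of the
  complex plane.\<close>

definition circle :: "complex measure" where
  "circle = distr (uniform_measure lborel {0..1::real}) borel (\<lambda>t. cis (2 * pi * t))"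

lemma sets_circle [simp, measurable_cong]: "sets circle = sets borel"
  by (simp add: circle_def)

lemma space_circle [simp]: "space circle = UNIV"
  by (simp add: circle_def)

lemma measurable_circle_cis: "(\<lambda>t. cis (2 * pi * t)) \<in> borel_measurable (uniform_measure lborel {0..1::real})"
proof -
  have "continuous_on UNIV (\<lambda>t. cis (2 * pi * t))"
    by (intro continuous_intros)
  then have "(\<lambda>t. cis (2 * pi * t)) \<in> borel_measurable borel"
    by (rule borel_measurable_continuous_onI)
  then show ?thesis
    by simp
qed

lemma emeasure_circle: "emeasure circle UNIV = 1"
  unfolding circle_def by (subst emeasure_distr[OF measurable_circle_cis]) simp_all

interpretation circle: finite_measure circle
  by standard (simp add: emeasure_circle)

lemma AE_circle: "AE z in circle. cmod z = 1"
  unfolding circle_def by (subst AE_distr_iff[OF measurable_circle_cis]) simp_all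

text \<open>Weak measurability together with a separable range.  For functions with values in a separable
  Hilbert space the second condition is void; it is only there because the type \<open>'k\<close> need not be
  separable.\<close>

definition circle_measurable :: "(complex \<Rightarrow> 'k::complex_inner) \<Rightarrow> bool" where
  "circle_measurable f \<longleftrightarrow>
     (\<forall>u. (\<lambda>z. cinner (f z) u) \<in> borel_measurable circle) \<and>
     (\<exists>D. countable D \<and> range f \<subseteq> closure D)"

definition square_integrable :: "(complex \<Rightarrow> 'k::complex_inner) \<Rightarrow> bool" where
  "square_integrable f \<longleftrightarrow> circle_measurable f \<and> integrable circle (\<lambda>z. (norm (f z))\<^sup>2)"

lemma norm_gr_iff_closure:
  fixes x :: "'k::complex_inner"
  assumes "x \<in> closure D" "0 \<le> a"
  shows "a < norm x \<longleftrightarrow> (\<exists>d\<in>D. a * norm d < Re (cinner x d))"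
proof
  assume a: "a < norm x"
  have "open {d. a * norm d < inner x d}"
    by (intro open_Collect_less continuous_intros)
  moreover have "a * norm x < inner x x"
    using mult_strict_right_mono[OF a, of "norm x"] le_less_trans[OF assms(2) a]
    by (simp add: power2_eq_square flip: power2_norm_eq_inner)
  ultimately have "{d. a * norm d < inner x d} \<inter> D \<noteq> {}"
    using assms(1) open_Int_closure_eq_empty[of "{d. a * norm d < inner x d}" D] by blast
  then show "\<exists>d\<in>D. a * norm d < Re (cinner x d)"
    by (auto simp: Re_cinner)
next
  assume "\<exists>d\<in>D. a * norm d < Re (cinner x d)"
  then obtain d where "a * norm d < inner x d"
    by (auto simp: Re_cinner)
  also have "\<dots> \<le> norm x * norm d"
    by (rule norm_cauchy_schwarz)
  finally show "a < norm x"
    by (simp add: mult_less_cancel_right)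
qed

lemma circle_measurable_norm:
  assumes "circle_measurable f"
  shows "(\<lambda>z. norm (f z)) \<in> borel_measurable circle"
  unfolding borel_measurable_iff_greater
proof
  fix a
  obtain D where D: "countable D" "range f \<subseteq> closure D"
    using assms by (auto simp: circle_measurable_def)
  have [measurable]: "(\<lambda>z. cinner (f z) u) \<in> borel_measurable circle" for u
    using assms by (auto simp: circle_measurable_def)
  show "{w \<in> space circle. a < norm (f w)} \<in> sets circle"
  proof (cases "0 \<le> a")
    case True
    have "{w \<in> space circle. a < norm (f w)} =
        (\<Union>d\<in>D. {w \<in> space circle. a * norm d < Re (cinner (f w) d)})"
    proof -
      have "f w \<in> closure D" for w
        using D(2) by blast
      then show ?thesis
        by (simp add: norm_gr_iff_closure[OF _ True] set_eq_iff)
    qed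
    also have "\<dots> \<in> sets circle"
      using D(1) by (intro sets.countable_UN') auto
    finally show ?thesis .
  next
    case False
    then have "{w \<in> space circle. a < norm (f w)} = space circle"
      by (auto intro: less_le_trans[OF _ norm_ge_zero])
    then show ?thesis
      by (metis sets.top)
  qed
qed

lemma separable_range_image2:
  assumes "continuous_on UNIV (\<lambda>p. h (fst p) (snd p))"
    and "countable D" "range f \<subseteq> closure D" "countable E" "range g \<subseteq> closure E"
  shows "\<exists>C. countable C \<and> range (\<lambda>z. h (f z) (g z)) \<subseteq> closure C"
proof (intro exI conjI)
  let ?C = "(\<lambda>p. h (fst p) (snd p)) ` (D \<times> E)"
  show "countable ?C"
    using assms by auto
  have "(\<lambda>p. h (fst p) (snd p)) ` closure (D \<times> E) \<subseteq> closure ?C"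
    by (rule image_closure_subset[OF continuous_on_subset[OF assms(1)] closed_closure closure_subset]) simp
  then show "range (\<lambda>z. h (f z) (g z)) \<subseteq> closure ?C"
    using assms(3,5) unfolding closure_Times by (fastforce simp: image_subset_iff)
qed

lemma circle_measurable_add:
  assumes "circle_measurable f" "circle_measurable g"
  shows "circle_measurable (\<lambda>z. f z + g z)"
proof -
  have "continuous_on UNIV (\<lambda>p :: 'a \<times> 'a. fst p + snd p)"
    by (intro continuous_intros)
  from separable_range_image2[OF this] assms show ?thesis
    unfolding circle_measurable_def by (auto simp: cinner_add_left intro!: borel_measurable_add)
qed

lemma bounded_bilinear_scaleC: "bounded_bilinear (scaleC :: complex \<Rightarrow> 'a \<Rightarrow> 'a::complex_inner)"
proof
  show "\<exists>K. \<forall>a (b::'a). norm (a *\<^sub>C b) \<le> norm a * norm b * K"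
    by (intro exI[of _ 1]) (simp add: norm_scaleC)
qed (simp_all add: scaleC_add_left scaleC_add_right scaleC_scaleC mult.commute scaleR_conv_of_real
    flip: scaleC_of_real)

lemma separable_complex: "\<exists>C. countable C \<and> (UNIV :: complex set) \<subseteq> closure C"
  using separable[of "UNIV :: complex set"] by metis

lemma circle_measurable_scaleC:
  assumes "circle_measurable f" "c \<in> borel_measurable circle"
  shows "circle_measurable (\<lambda>z. c z *\<^sub>C f z)"
proof -
  obtain C :: "complex set" where "countable C" "range c \<subseteq> closure C"
    using separable_complex by auto
  moreover have "continuous_on UNIV (\<lambda>p :: complex \<times> 'a. fst p *\<^sub>C snd p)"
    by (intro bounded_bilinear.continuous_on[OF bounded_bilinear_scaleC] continuous_intros)
  ultimately show ?thesis
    using separable_range_image2[of scaleC C c _ f] assms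
    unfolding circle_measurable_def by (auto simp: cinner_scaleC_left intro!: borel_measurable_times)
qed

lemma circle_measurable_const [simp]: "circle_measurable (\<lambda>_. v)"
  unfolding circle_measurable_def by (auto intro!: exI[of _ "{v}"])

lemma circle_measurable_diff:
  assumes "circle_measurable f" "circle_measurable g"
  shows "circle_measurable (\<lambda>z. f z - g z)"
  using circle_measurable_add[OF assms(1) circle_measurable_scaleC[OF assms(2), of "\<lambda>_. -1"]]
  by (simp add: scaleC_one complex_vector.scale_minus_left)

lemma circle_measurable_borel:
  assumes "circle_measurable f"
  shows "f \<in> borel_measurable circle"
proof (rule borel_measurableI)
  fix S :: "'a set"
  assume S: "open S"
  obtain D where D: "countable D" "range f \<subseteq> closure D"
    using assms by (auto simp: circle_measurable_def)
  let ?r = "\<lambda>n::nat. 1 / real (Suc n)"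
  let ?P = "{p \<in> D \<times> UNIV. ball (fst p) (?r (snd p)) \<subseteq> S}"
  have eq: "f z \<in> S \<longleftrightarrow> (\<exists>p\<in>?P. norm (f z - fst p) < ?r (snd p))" for z
  proof
    assume "f z \<in> S"
    then obtain e where e: "0 < e" "ball (f z) e \<subseteq> S"
      using S open_contains_ball by blast
    obtain n where n: "?r n < e / 2"
      using e(1) nat_approx_posE[of "e / 2"] by auto
    obtain d where d: "d \<in> D" "dist d (f z) < ?r n"
      using D(2) closure_approachable[of "f z" D] by (metis divide_pos_pos of_nat_0_less_iff
          range_subsetD zero_less_Suc zero_less_one)
    have "ball d (?r n) \<subseteq> ball (f z) e"
    proof
      fix y
      assume "y \<in> ball d (?r n)"
      then show "y \<in> ball (f z) e"
        using n d(2) dist_triangle[of "f z" y d] by (simp add: dist_commute)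
    qed
    with e d show "\<exists>p\<in>?P. norm (f z - fst p) < ?r (snd p)"
      by (intro bexI[of _ "(d, n)"]) (auto simp: dist_norm norm_minus_commute)
  next
    assume "\<exists>p\<in>?P. norm (f z - fst p) < ?r (snd p)"
    then obtain p where p: "p \<in> ?P" "norm (f z - fst p) < ?r (snd p)"
      by blast
    then have "f z \<in> ball (fst p) (?r (snd p))"
      by (simp add: dist_norm norm_minus_commute)
    with p(1) show "f z \<in> S"
      by blast
  qed
  have "f -` S \<inter> space circle =
      (\<Union>p\<in>?P. {z \<in> space circle. norm (f z - fst p) < ?r (snd p)})"
    unfolding vimage_def eq by blast
  also have "\<dots> \<in> sets circle"
  proof -
    have "countable ?P"
      by (rule countable_subset[of _ "D \<times> UNIV"]) (use D(1) in auto)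
    moreover have "{z \<in> space circle. norm (f z - fst p) < ?r (snd p)} \<in> sets circle" for p
    proof -
      have [measurable]: "(\<lambda>z. norm (f z - fst p)) \<in> borel_measurable circle"
        by (intro circle_measurable_norm circle_measurable_diff assms circle_measurable_const)
      show ?thesis
        by measurable
    qed
    ultimately show ?thesis
      by (intro sets.countable_UN') auto
  qed
  finally show "f -` S \<inter> space circle \<in> sets circle" .
qed

lemma continuous_on_cinner_left: "continuous_on UNIV (\<lambda>x. cinner x (u :: 'a::complex_inner))"
proof -
  have "bounded_linear (\<lambda>x. cinner x u)"
  proof
    show "\<exists>K. \<forall>x. norm (cinner x u) \<le> norm x * K"
      using norm_cinner_le by blast
  qed (simp_all add: cinner_add_left cinner_scaleC_left scaleR_conv_of_real flip: scaleC_of_real)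
  then show ?thesis
    by (rule linear_continuous_on)
qed

lemma circle_measurable_continuous:
  assumes "circle_measurable f" "continuous_on UNIV h"
  shows "circle_measurable (\<lambda>z. h (f z))"
  unfolding circle_measurable_def
proof
  obtain D where D: "countable D" "range f \<subseteq> closure D"
    using assms by (auto simp: circle_measurable_def)
  show "\<exists>D. countable D \<and> range (\<lambda>z. h (f z)) \<subseteq> closure D"
    using separable_range_image2[of "\<lambda>x _. h x", OF _ D D]
      continuous_on_compose2[OF assms(2) continuous_on_fst[OF continuous_on_id]] by auto
  show "\<forall>u. (\<lambda>z. cinner (h (f z)) u) \<in> borel_measurable circle"
  proof
    fix u
    have "continuous_on UNIV (\<lambda>x. cinner (h x) u)"
      by (rule continuous_on_compose2[OF continuous_on_cinner_left assms(2)]) auto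
    from borel_measurable_continuous_onI[OF this] circle_measurable_borel[OF assms(1)]
    show "(\<lambda>z. cinner (h (f z)) u) \<in> borel_measurable circle"
      by (rule measurable_compose[rotated])
  qed
qed

lemma circle_measurable_inner:
  assumes "circle_measurable f" "circle_measurable g"
  shows "(\<lambda>z. inner (f z) (g z)) \<in> borel_measurable circle"
proof -
  have [measurable]: "(\<lambda>z. norm (f z + g z)) \<in> borel_measurable circle"
    "(\<lambda>z. norm (f z)) \<in> borel_measurable circle" "(\<lambda>z. norm (g z)) \<in> borel_measurable circle"
    by (intro circle_measurable_norm circle_measurable_add assms)+
  have eq: "inner (f z) (g z) = ((norm (f z + g z))\<^sup>2 - (norm (f z))\<^sup>2 - (norm (g z))\<^sup>2) / 2" for z
    by (simp add: power2_norm_eq_inner inner_add_left inner_add_right inner_commute)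
  show ?thesis
    unfolding eq by measurable
qed

lemma circle_measurable_cinner:
  assumes "circle_measurable f" "circle_measurable g"
  shows "(\<lambda>z. cinner (f z) (g z)) \<in> borel_measurable circle"
proof -
  have Im: "Im (cinner x y) = inner ((- \<i>) *\<^sub>C x) y" for x y :: 'a
    by (simp add: cinner_scaleC_left cinner_minus_left flip: Re_cinner)
  show ?thesis
    unfolding borel_measurable_complex_iff Re_cinner Im
    by (intro conjI circle_measurable_inner circle_measurable_scaleC assms) simp
qed

lemma square_integrable_cinner:
  assumes "square_integrable f" "square_integrable g"
  shows "integrable circle (\<lambda>z. cinner (f z) (g z))"
proof (rule Bochner_Integration.integrable_bound)
  show "integrable circle (\<lambda>z. (norm (f z))\<^sup>2 + (norm (g z))\<^sup>2)"
    using assms by (simp add: square_integrable_def)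
  show "(\<lambda>z. cinner (f z) (g z)) \<in> borel_measurable circle"
    using assms by (simp add: square_integrable_def circle_measurable_cinner)
  have "norm (cinner (f z) (g z)) \<le> norm ((norm (f z))\<^sup>2 + (norm (g z))\<^sup>2)" for z
  proof -
    have "cmod (cinner (f z) (g z)) \<le> norm (f z) * norm (g z)"
      by (rule norm_cinner_le)
    also have "\<dots> \<le> (norm (f z))\<^sup>2 + (norm (g z))\<^sup>2"
      by (simp add: mult_le_sum_squares)
    finally show ?thesis
      by simp
  qed
  then show "AE z in circle. norm (cinner (f z) (g z)) \<le> norm ((norm (f z))\<^sup>2 + (norm (g z))\<^sup>2)"
    by simp
qed

lemma square_integrable_add:
  assumes "square_integrable f" "square_integrable g"
  shows "square_integrable (\<lambda>z. f z + g z)"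
  unfolding square_integrable_def
proof
  show *: "circle_measurable (\<lambda>z. f z + g z)"
    using assms by (simp add: square_integrable_def circle_measurable_add)
  show "integrable circle (\<lambda>z. (norm (f z + g z))\<^sup>2)"
  proof (rule Bochner_Integration.integrable_bound)
    show "integrable circle (\<lambda>z. 2 * (norm (f z))\<^sup>2 + 2 * (norm (g z))\<^sup>2)"
      using assms by (simp add: square_integrable_def)
    show "(\<lambda>z. (norm (f z + g z))\<^sup>2) \<in> borel_measurable circle"
      using circle_measurable_norm[OF *] by simp
    have "(norm (f z + g z))\<^sup>2 \<le> 2 * (norm (f z))\<^sup>2 + 2 * (norm (g z))\<^sup>2" for z
    proof -
      have "(norm (f z + g z))\<^sup>2 \<le> (norm (f z) + norm (g z))\<^sup>2"
        by (simp add: norm_triangle_ineq power_mono)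
      also have "\<dots> \<le> 2 * (norm (f z))\<^sup>2 + 2 * (norm (g z))\<^sup>2"
        using sum_squares_bound[of "norm (f z)" "norm (g z)"] by (simp add: power2_sum)
      finally show ?thesis .
    qed
    then show "AE z in circle. norm ((norm (f z + g z))\<^sup>2) \<le>
        norm (2 * (norm (f z))\<^sup>2 + 2 * (norm (g z))\<^sup>2)"
      by simp
  qed
qed

lemma square_integrable_scaleC:
  assumes "square_integrable f"
  shows "square_integrable (\<lambda>z. c *\<^sub>C f z)"
  using assms unfolding square_integrable_def
  by (auto intro: circle_measurable_scaleC simp: norm_scaleC power_mult_distrib)

lemma square_integrable_diff:
  assumes "square_integrable f" "square_integrable g"
  shows "square_integrable (\<lambda>z. f z - g z)"
  using square_integrable_add[OF assms(1) square_integrable_scaleC[OF assms(2), of "-1"]]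
  by (simp add: scaleC_one complex_vector.scale_minus_left)

lemma square_integrable_const: "square_integrable (\<lambda>_. v)"
  unfolding square_integrable_def by simp

lemma square_integrable_mult_id:
  assumes "square_integrable f"
  shows "square_integrable (\<lambda>z. z *\<^sub>C f z)"
  unfolding square_integrable_def
proof
  show *: "circle_measurable (\<lambda>z. z *\<^sub>C f z)"
    using assms by (auto simp: square_integrable_def intro: circle_measurable_scaleC)
  have [measurable]: "(\<lambda>z. norm (z *\<^sub>C f z)) \<in> borel_measurable circle"
    "(\<lambda>z. norm (f z)) \<in> borel_measurable circle"
    using assms * by (auto simp: square_integrable_def intro: circle_measurable_norm)
  have "AE z in circle. (norm (f z))\<^sup>2 = (norm (z *\<^sub>C f z))\<^sup>2"
    using AE_circle by eventually_elim (simp add: norm_scaleC)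
  then have "integrable circle (\<lambda>z. (norm (f z))\<^sup>2) \<longleftrightarrow> integrable circle (\<lambda>z. (norm (z *\<^sub>C f z))\<^sup>2)"
    by (rule Bochner_Integration.integrable_cong_AE[rotated 2]) measurable
  then show "integrable circle (\<lambda>z. (norm (z *\<^sub>C f z))\<^sup>2)"
    using assms by (simp add: square_integrable_def)
qed

lemma square_integrable_cinner_const:
  assumes "square_integrable f"
  shows "square_integrable (\<lambda>z. cinner (f z) u)"
  unfolding square_integrable_def
proof
  show *: "circle_measurable (\<lambda>z. cinner (f z) u)"
    using assms
    by (auto simp: square_integrable_def
        intro: circle_measurable_continuous[OF _ continuous_on_cinner_left])
  show "integrable circle (\<lambda>z. (norm (cinner (f z) u))\<^sup>2)"
  proof (rule Bochner_Integration.integrable_bound)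
    show "integrable circle (\<lambda>z. (norm (f z))\<^sup>2 * (norm u)\<^sup>2)"
      using assms by (simp add: square_integrable_def)
    show "(\<lambda>z. (norm (cinner (f z) u))\<^sup>2) \<in> borel_measurable circle"
      using circle_measurable_norm[OF *] by simp
    show "AE z in circle. norm ((norm (cinner (f z) u))\<^sup>2) \<le> norm ((norm (f z))\<^sup>2 * (norm u)\<^sup>2)"
      by (simp add: norm_cinner_le power_mono flip: power_mult_distrib)
  qed
qed

definition L2_rel :: "(complex \<Rightarrow> 'k::complex_inner) \<Rightarrow> (complex \<Rightarrow> 'k) \<Rightarrow> bool" where
  "L2_rel f g \<longleftrightarrow> square_integrable f \<and> square_integrable g \<and> (AE z in circle. f z = g z)"

quotient_type (overloaded) 'k L2 = "complex \<Rightarrow> 'k::complex_inner" / partial: L2_rel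
proof (rule part_equivpI)
  show "\<exists>f :: complex \<Rightarrow> 'k. L2_rel f f"
    by (intro exI[of _ "\<lambda>_. 0"]) (simp add: L2_rel_def square_integrable_const)
  show "symp (L2_rel :: (complex \<Rightarrow> 'k) \<Rightarrow> _)"
    by (auto simp: symp_def L2_rel_def elim: eventually_mono)
  show "transp (L2_rel :: (complex \<Rightarrow> 'k) \<Rightarrow> _)"
    by (auto simp: transp_def L2_rel_def elim: eventually_elim2)
qed

instantiation L2 :: (complex_inner) complex_inner
begin

lift_definition zero_L2 :: "'a L2" is "\<lambda>_. 0"
  by (simp add: L2_rel_def square_integrable_const)

lift_definition plus_L2 :: "'a L2 \<Rightarrow> 'a L2 \<Rightarrow> 'a L2" is "\<lambda>f g z. f z + g z"
  unfolding L2_rel_def by (auto intro: square_integrable_add elim: eventually_elim2)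

lift_definition uminus_L2 :: "'a L2 \<Rightarrow> 'a L2" is "\<lambda>f z. - f z"
  unfolding L2_rel_def
  using square_integrable_diff[OF square_integrable_const[of 0]]
  by (auto elim: eventually_mono)

lift_definition minus_L2 :: "'a L2 \<Rightarrow> 'a L2 \<Rightarrow> 'a L2" is "\<lambda>f g z. f z - g z"
  unfolding L2_rel_def by (auto intro: square_integrable_diff elim: eventually_elim2)

lift_definition scaleC_L2 :: "complex \<Rightarrow> 'a L2 \<Rightarrow> 'a L2" is "\<lambda>c f z. c *\<^sub>C f z"
  unfolding L2_rel_def by (auto intro: square_integrable_scaleC elim: eventually_mono)

lift_definition cinner_L2 :: "'a L2 \<Rightarrow> 'a L2 \<Rightarrow> complex" is
  "\<lambda>f g. LINT z|circle. cinner (f z) (g z)"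
  unfolding L2_rel_def
  by (intro integral_cong_AE)
    (auto simp: square_integrable_def intro: circle_measurable_cinner elim: eventually_elim2)

definition "scaleR_L2 r (x :: 'a L2) = complex_of_real r *\<^sub>C x"
definition "inner_L2 (x :: 'a L2) y = Re (cinner x y)"
definition "norm_L2 (x :: 'a L2) = sqrt (inner x x)"
definition "dist_L2 (x :: 'a L2) y = norm (x - y)"
definition "sgn_L2 (x :: 'a L2) = inverse (norm x) *\<^sub>R x"
definition [code del]:
  "(uniformity :: ('a L2 \<times> 'a L2) filter) = (INF e\<in>{0<..}. principal {(x, y). dist x y < e})"
definition [code del]:
  "open (U :: 'a L2 set) \<longleftrightarrow> (\<forall>x\<in>U. eventually (\<lambda>(x', y). x' = x \<longrightarrow> y \<in> U) uniformity)"

lemma cinner_L2_self: "cinner (x :: 'a L2) x = complex_of_real (LINT z|circle. (norm (rep_L2 x z))\<^sup>2)"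
  unfolding cinner_L2.rep_eq by (simp add: cinner_self flip: of_real_power)

instance
proof
  fix x y z :: "'a L2" and a b :: complex and r s :: real
  show "x + y + z = x + (y + z)" "x + y = y + x" "0 + x = x" "- x + x = 0" "x - y = x + - y"
    by (transfer; simp add: algebra_simps L2_rel_def square_integrable_add square_integrable_const
        square_integrable_diff; fail)+
  show scal: "a *\<^sub>C (x + y) = a *\<^sub>C x + a *\<^sub>C y" "(a + b) *\<^sub>C x = a *\<^sub>C x + b *\<^sub>C x"
    "a *\<^sub>C b *\<^sub>C x = (a * b) *\<^sub>C x" for a b and x y :: "'a L2"
    by (transfer; simp add: algebra_simps L2_rel_def square_integrable_add square_integrable_scaleC
        scaleC_add_left scaleC_add_right scaleC_scaleC; fail)+
  have one: "1 *\<^sub>C x = x"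
    by transfer (simp add: scaleC_one)
  show "r *\<^sub>R (x + y) = r *\<^sub>R x + r *\<^sub>R y" "(r + s) *\<^sub>R x = r *\<^sub>R x + s *\<^sub>R x"
    "r *\<^sub>R s *\<^sub>R x = (r * s) *\<^sub>R x" "1 *\<^sub>R x = x"
    by (simp_all add: scaleR_L2_def scal one)
  show "complex_of_real r *\<^sub>C x = r *\<^sub>R x"
    by (simp add: scaleR_L2_def)
  show comm: "cinner x y = cnj (cinner y x)" for x y :: "'a L2"
    by transfer (subst cinner_commute, simp flip: integral_cnj)
  show add: "cinner (x + y) z = cinner x z + cinner y z"
    by transfer (simp add: cinner_add_left L2_rel_def square_integrable_cinner)
  show sc: "cinner (a *\<^sub>C x) y = a * cinner x y" for a
    by transfer (simp add: cinner_scaleC_left)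
  show "Re (cinner x y) = inner x y"
    by (simp add: inner_L2_def)
  show "inner x y = inner y x"
    unfolding inner_L2_def by (subst comm) simp
  show "inner (x + y) z = inner x z + inner y z" "inner (r *\<^sub>R x) y = r * inner x y"
    by (simp_all add: inner_L2_def add scaleR_L2_def sc)
  show "0 \<le> inner x x"
    by (simp add: inner_L2_def cinner_L2_self)
  show "inner x x = 0 \<longleftrightarrow> x = 0"
    unfolding inner_L2_def
  proof transfer
    fix f :: "complex \<Rightarrow> 'a"
    assume "L2_rel f f"
    then have f: "square_integrable f"
      by (simp add: L2_rel_def)
    have "(LINT z|circle. (norm (f z))\<^sup>2) = 0 \<longleftrightarrow> (AE z in circle. (norm (f z))\<^sup>2 = 0)"
      using f by (intro integral_nonneg_eq_0_iff_AE) (auto simp: square_integrable_def)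
    then show "Re (LINT z|circle. cinner (f z) (f z)) = 0 \<longleftrightarrow> L2_rel f (\<lambda>_. 0)"
      using f by (simp add: cinner_self L2_rel_def square_integrable_const flip: of_real_power)
  qed
  show "norm x = sqrt (inner x x)"
    by (rule norm_L2_def)
qed (fact dist_L2_def sgn_L2_def uniformity_L2_def open_L2_def)+

end

lift_definition const_L2 :: "'k::complex_inner \<Rightarrow> 'k L2" is "\<lambda>v _. v"
  by (simp add: L2_rel_def square_integrable_const)

lift_definition values_in :: "'k::complex_inner L2 \<Rightarrow> 'k set \<Rightarrow> bool" is
  "\<lambda>f K. AE z in circle. f z \<in> K"
  unfolding L2_rel_def by (auto simp: fun_eq_iff elim: eventually_elim2)

definition L2_on :: "'k::complex_inner set \<Rightarrow> 'k L2 set" where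
  "L2_on K = {f. values_in f K}"

lift_definition mult_id :: "'k::complex_inner L2 \<Rightarrow> 'k L2" is "\<lambda>f z. z *\<^sub>C f z"
  unfolding L2_rel_def by (auto intro: square_integrable_mult_id elim: eventually_mono)

lemma norm_mult_id: "norm (mult_id f) = norm f"
proof -
  have "cinner (mult_id f) (mult_id f) = cinner f f"
  proof transfer
    fix f :: "complex \<Rightarrow> 'a"
    assume "L2_rel f f"
    then have f: "square_integrable f"
      by (simp add: L2_rel_def)
    show "(LINT z|circle. cinner (z *\<^sub>C f z) (z *\<^sub>C f z)) = (LINT z|circle. cinner (f z) (f z))"
    proof (rule integral_cong_AE)
      show "AE z in circle. cinner (z *\<^sub>C f z) (z *\<^sub>C f z) = cinner (f z) (f z)"
        using AE_circle by eventually_elim (simp add: cinner_self norm_scaleC)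
    qed (use f square_integrable_mult_id[OF f] in
        \<open>auto simp: square_integrable_def intro: circle_measurable_cinner\<close>)
  qed
  then show ?thesis
    by (simp add: norm_eq_sqrt_inner flip: Re_cinner)
qed

lemma continuous_on_mult_id: "continuous_on UNIV (mult_id :: 'k::complex_inner L2 \<Rightarrow> 'k L2)"
proof -
  have add: "mult_id (f + g) = mult_id f + mult_id g" for f g :: "'k L2"
    by transfer (simp add: scaleC_add_right L2_rel_def square_integrable_add square_integrable_mult_id)
  have scal: "mult_id (c *\<^sub>C f) = c *\<^sub>C mult_id f" for c and f :: "'k L2"
  proof transfer
    fix c and f :: "complex \<Rightarrow> 'k"
    assume "L2_rel f f"
    then have "square_integrable (\<lambda>z. c *\<^sub>C z *\<^sub>C f z)"
      by (intro square_integrable_scaleC square_integrable_mult_id) (simp add: L2_rel_def)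
    moreover have eq: "(\<lambda>z. z *\<^sub>C c *\<^sub>C f z) = (\<lambda>z. c *\<^sub>C z *\<^sub>C f z)"
      by (simp add: scaleC_scaleC mult.commute)
    ultimately show "L2_rel (\<lambda>z. z *\<^sub>C c *\<^sub>C f z) (\<lambda>z. c *\<^sub>C z *\<^sub>C f z)"
      unfolding eq by (simp only: L2_rel_def) simp
  qed
  have "bounded_linear (mult_id :: 'k L2 \<Rightarrow> 'k L2)"
  proof
    show "\<exists>K. \<forall>f :: 'k L2. norm (mult_id f) \<le> norm f * K"
      by (intro exI[of _ 1]) (simp add: norm_mult_id)
  qed (simp_all add: add scal flip: scaleC_of_real)
  then show ?thesis
    by (rule linear_continuous_on)
qed

lift_definition pointwise_mult_id :: "'k::complex_inner L2 L2 \<Rightarrow> 'k L2 L2" is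
  "\<lambda>f z. mult_id (f z)"
  unfolding L2_rel_def square_integrable_def
  by (auto simp: norm_mult_id intro: circle_measurable_continuous[OF _ continuous_on_mult_id]
      elim: eventually_mono)


section \<open>Hardy spaces\<close>

lift_definition fourier_coeff :: "complex L2 \<Rightarrow> int \<Rightarrow> complex" is
  "\<lambda>f n. LINT z|circle. f z * cnj (z powi n)"
proof -
  fix f g :: "complex \<Rightarrow> complex"
  assume "L2_rel f g"
  then have [measurable]: "f \<in> borel_measurable circle" "g \<in> borel_measurable circle"
    and ae: "AE z in circle. f z = g z"
    by (auto simp: L2_rel_def square_integrable_def intro: circle_measurable_borel)
  have [measurable]: "cnj \<in> borel_measurable borel"
    by (intro borel_measurable_continuous_onI continuous_intros)
  have [measurable]: "(\<lambda>z. z powi n) \<in> borel_measurable circle" for n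
    by (cases "0 \<le> n") (simp_all add: power_int_def)
  have [measurable]: "(\<lambda>z. cnj (z powi n)) \<in> borel_measurable circle" for n
    by (rule measurable_compose[where g = cnj and N = borel]) measurable
  show "(\<lambda>n. LINT z|circle. f z * cnj (z powi n)) = (\<lambda>n. LINT z|circle. g z * cnj (z powi n))"
    by (intro ext integral_cong_AE) (use ae in \<open>auto elim: eventually_mono\<close>)
qed

definition scalar_hardy :: "complex L2 set" where
  "scalar_hardy = {f. \<forall>n<0. fourier_coeff f n = 0}"

lift_definition cinner_fun :: "'k::complex_inner L2 \<Rightarrow> 'k \<Rightarrow> complex L2" is
  "\<lambda>f u z. cinner (f z) u"
  unfolding L2_rel_def by (auto intro: square_integrable_cinner_const elim: eventually_mono)

definition hardy :: "'k::complex_inner set \<Rightarrow> 'k L2 set" where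
  "hardy K = {f \<in> L2_on K. \<forall>u\<in>K. cinner_fun f u \<in> scalar_hardy}"

text \<open>The space $L^2(\mathbb{T}, H^2_{\ell^2(I)})$: an element \<open>f\<close> of the nested type is a function of
  $\lambda$ whose values are functions of $z$.\<close>

definition L2_hardy :: "'i set \<Rightarrow> 'i ell2 L2 L2 set" where
  "L2_hardy I = L2_on (hardy (ell2_on I))"

abbreviation opU :: "'i ell2 L2 L2 \<Rightarrow> 'i ell2 L2 L2" where
  "opU \<equiv> mult_id"

abbreviation opS :: "'i ell2 L2 L2 \<Rightarrow> 'i ell2 L2 L2" where
  "opS \<equiv> pointwise_mult_id"


section \<open>Tuples\<close>

type_synonym ('a, 'i) op_tuple = "'a set \<times> ('a \<Rightarrow> 'a) \<times> ('a \<Rightarrow> 'a) \<times> ('i \<Rightarrow> 'a)"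

fun is_op_tuple :: "'i set \<Rightarrow> ('a::complex_inner, 'i) op_tuple \<Rightarrow> bool" where
  "is_op_tuple I (H, T, L, w) \<longleftrightarrow>
     countable I \<and> separable_hilbert_space H \<and>
     invertible_operator H T \<and> bounded_operator H H L \<and>
     (\<forall>x\<in>H. T (L x) = L (T x)) \<and> (\<forall>i\<in>I. w i \<in> H)"

fun unilateral_frame_tuple :: "'i set \<Rightarrow> ('a::complex_inner, 'i) op_tuple \<Rightarrow> bool" where
  "unilateral_frame_tuple I (H, T, L, w) \<longleftrightarrow>
     is_op_tuple I (H, T, L, w) \<and>
     is_frame H (UNIV \<times> UNIV \<times> I) (\<lambda>(k :: int, j :: nat, i). op_power_int H T k ((L ^^ j) (w i)))"

fun similar_tuples ::
  "'i set \<Rightarrow> ('a::complex_inner, 'i) op_tuple \<Rightarrow> ('b::complex_inner, 'i) op_tuple \<Rightarrow> bool" where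
  "similar_tuples I (H1, T1, L1, v) (H2, T2, L2, w) \<longleftrightarrow>
     (\<exists>C. bounded_operator H1 H2 C \<and> bij_betw C H1 H2 \<and>
        (\<forall>i\<in>I. C (v i) = w i) \<and>
        (\<forall>x\<in>H1. T2 (C x) = C (T1 x)) \<and> (\<forall>x\<in>H1. L2 (C x) = C (L1 x)))"

text \<open>The operators and the family of a basic tuple are cut off outside their domains, so that
  equality of two basic tuples means that they agree on the relevant arguments.  The adjoints are
  those of the operators on \<open>L2_hardy I\<close>, not on the ambient type.\<close>

fun unilateral_basic_tuple :: "'i set \<Rightarrow> ('i ell2 L2 L2, 'i) op_tuple \<Rightarrow> bool" where
  "unilateral_basic_tuple I (N, T, A, \<phi>) \<longleftrightarrow>
     is_op_tuple I (N, T, A, \<phi>) \<and>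
     complex_vector.subspace N \<and> closed N \<and> N \<subseteq> L2_hardy I \<and>
     reducing_on (L2_hardy I) opU N \<and>
     invariant_under (adjoint_on (L2_hardy I) opS) N \<and>
     T = restrict opU N \<and>
     A = restrict (\<lambda>f. orth_proj N (opS f)) N \<and>
     \<phi> = restrict (\<lambda>i. orth_proj N (const_L2 (const_L2 (ell2_unit i)))) I"

end

theory Submission
  imports Defs
begin

text \<open>Let \<open>X\<close> be the space \<open>L\<^sup>2(T, H\<^sup>2)\<close> with values in \<open>\<ell>\<^sup>2(I)\<close>.  The functions
  \<open>e(k, j, i) = \<lambda>\<^sup>k z\<^sup>j \<epsilon>\<^sub>i\<close> with \<open>k \<in> \<int>\<close>, \<open>j \<ge> 0\<close> and \<open>i \<in> I\<close> form an orthonormal basis of \<open>X\<close>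
  (lemma \<open>orthonormal_basis_trig_vector\<close>) on which \<open>U\<close> and \<open>S\<close> act as shifts of \<open>k\<close> and \<open>j\<close>.  The
  orbit \<open>v(k, j, i) = T\<^sup>k L\<^sup>j w\<^sub>i\<close> is shifted in the same way by \<open>T\<close> and \<open>L\<close>.  The theorem compares
  these two families.

  A frame has a bounded synthesis operator \<open>V\<close> from \<open>X\<close> onto \<open>H\<close> with \<open>V e = v\<close>, the adjoint of the
  analysis operator \<open>\<Theta>\<close>.  It intertwines \<open>U\<close> with \<open>T\<close> and \<open>S\<close> with \<open>L\<close>, because it does so on the
  basis.  Hence its kernel is invariant under \<open>U\<close>, the inverse of \<open>U\<close> and \<open>S\<close>, and the orthogonal
  complement \<open>N\<close> of the kernel, which is the range of \<open>\<Theta>\<close>, is \<open>U\<close>-reducing and invariant under the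
  adjoint of \<open>S\<close>.  The restriction of \<open>V\<close> to \<open>N\<close> is an isomorphism onto \<open>H\<close>, and its inverse is a
  similarity of the given tuple with the basic tuple on \<open>N\<close> (lemma \<open>frame_imp_similar_basic\<close>).

  Conversely, let \<open>C\<close> be a similarity with a basic tuple on \<open>N\<close>, and let \<open>P\<close> be the projection onto
  \<open>N\<close>.  Since \<open>P\<close> intertwines \<open>U\<close> and \<open>S\<close> with the operators of the basic tuple, \<open>C v = P e\<close> (lemma
  \<open>similar_basic_orbit\<close>).  With \<open>D\<close> the inverse of \<open>C\<close>, Parseval's identity in \<open>X\<close> says that the
  squared moduli of the numbers \<open>\<langle>f, v\<rangle> = \<langle>D\<^sup>* f, e\<rangle>\<close> add up to \<open>\<parallel>D\<^sup>* f\<parallel>\<^sup>2\<close>, which is comparable to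
  \<open>\<parallel>f\<parallel>\<^sup>2\<close> (lemma \<open>similar_basic_imp_frame\<close>).  Boundedness of \<open>D\<close> is Banach's theorem, which is
  obtained here from a gliding hump argument (lemmas \<open>uniform_boundedness\<close> and \<open>bounded_inverse\<close>).

  The same identity \<open>D P e = v\<close> determines \<open>D P\<close> on the basis, hence on \<open>X\<close>.  So \<open>D P\<close> depends only on
  the given tuple, and with it its kernel, the orthogonal complement of \<open>N\<close>.  This gives uniqueness
  (lemma \<open>similar_basic_unique\<close>).

  Two facts from analysis enter: \<open>L\<^sup>2\<close> over a complete space is complete, and an integrable function
  on the circle with vanishing Fourier coefficients is zero (lemma \<open>fourier_uniqueness\<close>), which makes
  the trigonometric system total.\<close>

section \<open>Geometry of complete complex subspaces\<close>

lemma cinner_zero_right [simp]: "cinner (x :: 'a::complex_inner) 0 = 0"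
  by (metis cinner_commute cinner_zero_left complex_cnj_zero)

lemma cinner_diff_right: "cinner x (y - z) = cinner x y - cinner x (z :: 'a::complex_inner)"
  by (metis cinner_commute cinner_diff_left complex_cnj_diff)

lemma cinner_self_eq_0 [simp]: "cinner x x = 0 \<longleftrightarrow> (x :: 'a::complex_inner) = 0"
  by (simp add: cinner_self)

lemma scaleC_minus_one: "(-1) *\<^sub>C x = - (x :: 'a::complex_inner)"
  by (simp add: complex_vector.scale_minus_left scaleC_one)

definition hilbert_subspace :: "'a::complex_inner set \<Rightarrow> bool" where
  "hilbert_subspace H \<longleftrightarrow> complex_vector.subspace H \<and> complete H"

lemma hilbert_subspaceD:
  assumes "hilbert_subspace H"
  shows "complex_vector.subspace H" "complete H" "closed H" "0 \<in> H"
    "\<And>x y. x \<in> H \<Longrightarrow> y \<in> H \<Longrightarrow> x + y \<in> H" "\<And>x y. x \<in> H \<Longrightarrow> y \<in> H \<Longrightarrow> x - y \<in> H"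
    "\<And>c x. x \<in> H \<Longrightarrow> c *\<^sub>C x \<in> H"
  using assms unfolding hilbert_subspace_def
  by (auto simp: complete_imp_closed complex_vector.subspace_0 complex_vector.subspace_add
      complex_vector.subspace_diff complex_vector.subspace_scale)

lemma hilbert_subspace_closed_subset:
  assumes "hilbert_subspace H" "complex_vector.subspace N" "closed N" "N \<subseteq> H"
  shows "hilbert_subspace N"
  using assms complete_closed_subset unfolding hilbert_subspace_def by blast

lemma bounded_operatorD:
  assumes "bounded_operator H K A"
  shows "\<And>x. x \<in> H \<Longrightarrow> A x \<in> K" "\<And>x y. x \<in> H \<Longrightarrow> y \<in> H \<Longrightarrow> A (x + y) = A x + A y"
    "\<And>c x. x \<in> H \<Longrightarrow> A (c *\<^sub>C x) = c *\<^sub>C A x"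
  using assms unfolding bounded_operator_def by auto

lemma bounded_operator_bound:
  assumes "bounded_operator H K A"
  obtains M where "0 < M" "\<And>x. x \<in> H \<Longrightarrow> norm (A x) \<le> M * norm x"
proof -
  obtain M where "\<forall>x\<in>H. norm (A x) \<le> M * norm x"
    using assms unfolding bounded_operator_def by auto
  then have "norm (A x) \<le> (\<bar>M\<bar> + 1) * norm x" if "x \<in> H" for x
    using that mult_right_mono[of M "\<bar>M\<bar> + 1" "norm x"] by force
  then show ?thesis
    using that[of "\<bar>M\<bar> + 1"] by auto
qed

lemma bounded_operatorI:
  assumes "\<And>x. x \<in> H \<Longrightarrow> A x \<in> K" "\<And>x y. x \<in> H \<Longrightarrow> y \<in> H \<Longrightarrow> A (x + y) = A x + A y"
    "\<And>c x. x \<in> H \<Longrightarrow> A (c *\<^sub>C x) = c *\<^sub>C A x" "\<And>x. x \<in> H \<Longrightarrow> norm (A x) \<le> M * norm x"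
  shows "bounded_operator H K A"
  using assms unfolding bounded_operator_def by blast

lemma bounded_operator_diff:
  assumes "bounded_operator H K A" "complex_vector.subspace H" "x \<in> H" "y \<in> H"
  shows "A (x - y) = A x - A y"
proof -
  have "A (x - y) = A (x + (-1) *\<^sub>C y)"
    by (simp add: scaleC_minus_one)
  also have "\<dots> = A x - A y"
    using bounded_operatorD(2)[OF assms(1,3) complex_vector.subspace_scale[OF assms(2,4), of "-1"]]
      bounded_operatorD(3)[OF assms(1,4), of "-1"]
    by (simp add: scaleC_minus_one)
  finally show ?thesis .
qed

lemma bounded_operator_0:
  assumes "bounded_operator H K A" "complex_vector.subspace H"
  shows "A 0 = 0"
  using bounded_operator_diff[OF assms, of 0 0] complex_vector.subspace_0[OF assms(2)] by simp

lemma bounded_operator_continuous_on: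
  assumes A: "bounded_operator H K A" and H: "complex_vector.subspace H"
  shows "continuous_on H A"
proof -
  obtain M where M: "0 < M" "\<And>x. x \<in> H \<Longrightarrow> norm (A x) \<le> M * norm x"
    using bounded_operator_bound[OF A] by blast
  have "M-lipschitz_on H A"
    using M complex_vector.subspace_diff[OF H]
    by (intro lipschitz_onI) (auto simp: dist_norm bounded_operator_diff[OF A H, symmetric])
  then show ?thesis
    by (rule lipschitz_on_continuous_on)
qed

lemma bounded_operator_compose:
  assumes "bounded_operator G H A" "bounded_operator H K B"
  shows "bounded_operator G K (\<lambda>x. B (A x))"
proof -
  obtain M where M: "0 < M" "\<And>x. x \<in> G \<Longrightarrow> norm (A x) \<le> M * norm x"
    using bounded_operator_bound[OF assms(1)] by blast
  obtain M' where M': "0 < M'" "\<And>x. x \<in> H \<Longrightarrow> norm (B x) \<le> M' * norm x"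
    using bounded_operator_bound[OF assms(2)] by blast
  show ?thesis
  proof (rule bounded_operatorI)
    fix x assume x: "x \<in> G"
    have "norm (B (A x)) \<le> M' * norm (A x)"
      using M' bounded_operatorD[OF assms(1)] x by blast
    also have "\<dots> \<le> M' * (M * norm x)"
      using M M' x by (intro mult_left_mono) auto
    finally show "norm (B (A x)) \<le> (M' * M) * norm x"
      by (simp add: mult.assoc)
  qed (simp_all add: bounded_operatorD[OF assms(1)] bounded_operatorD[OF assms(2)])
qed

lemma bounded_operator_subset:
  assumes "bounded_operator H K A" "H' \<subseteq> H" "K \<subseteq> K'"
  shows "bounded_operator H' K' A"
  using assms unfolding bounded_operator_def by blast

lemma bounded_operator_cong:
  assumes "\<And>x. x \<in> H \<Longrightarrow> A x = B x" "complex_vector.subspace H"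
  shows "bounded_operator H K A \<longleftrightarrow> bounded_operator H K B"
  using assms unfolding bounded_operator_def
  by (simp add: image_subset_iff complex_vector.subspace_add complex_vector.subspace_scale cong: ball_cong)

lemma bounded_operator_into:
  assumes "bounded_operator H K A" "\<And>x. x \<in> H \<Longrightarrow> A x \<in> K'"
  shows "bounded_operator H K' A"
  using assms unfolding bounded_operator_def by blast

lemma subspace_image_bounded_operator:
  assumes A: "bounded_operator H K A" and H: "complex_vector.subspace H"
  shows "complex_vector.subspace (A ` H)"
  unfolding complex_vector.subspace_def
proof (intro conjI ballI allI)
  show "0 \<in> A ` H"
    using bounded_operator_0[OF A H] complex_vector.subspace_0[OF H] by force
  fix x assume "x \<in> A ` H"
  then obtain u where u: "u \<in> H" "x = A u" by blast
  show "c *\<^sub>C x \<in> A ` H" for c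
    using u bounded_operatorD(3)[OF A u(1)] complex_vector.subspace_scale[OF H u(1)] by (metis imageI)
  fix y assume "y \<in> A ` H"
  then obtain v where v: "v \<in> H" "y = A v" by blast
  show "x + y \<in> A ` H"
    using u v bounded_operatorD(2)[OF A u(1) v(1)] complex_vector.subspace_add[OF H u(1) v(1)]
    by (metis imageI)
qed

text \<open>A lower bound for \<open>A\<close> lets Cauchy sequences of images be pulled back.\<close>

lemma hilbert_subspace_image:
  assumes A: "bounded_operator H K A" and H: "hilbert_subspace H"
    and m: "0 < m" "\<And>x. x \<in> H \<Longrightarrow> m * norm x \<le> norm (A x)"
  shows "hilbert_subspace (A ` H)"
proof -
  note sub = hilbert_subspaceD(1)[OF H]
  have "complete (A ` H)"
    unfolding complete_def
  proof (intro allI impI)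
    fix f :: "nat \<Rightarrow> _" assume f: "(\<forall>n. f n \<in> A ` H) \<and> Cauchy f"
    then have "\<forall>n. \<exists>x. x \<in> H \<and> f n = A x"
      by blast
    then obtain g where g: "\<And>n. g n \<in> H" "\<And>n. f n = A (g n)"
      by metis
    have le: "dist (g i) (g j) \<le> dist (f i) (f j) / m" for i j
      using m(2)[of "g i - g j"] g hilbert_subspaceD(6)[OF H] m(1)
      by (simp add: dist_norm bounded_operator_diff[OF A sub] field_simps)
    have "Cauchy g"
      unfolding Cauchy_def
    proof (intro allI impI)
      fix e :: real assume "0 < e"
      then obtain M where M: "\<And>i j. M \<le> i \<Longrightarrow> M \<le> j \<Longrightarrow> dist (f i) (f j) < e * m"
        using f m(1) unfolding Cauchy_def by (metis mult_pos_pos)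
      have "dist (g i) (g j) < e" if "M \<le> i" "M \<le> j" for i j
        using le[of i j] M[OF that] m(1) by (simp add: pos_divide_less_eq le_less_trans)
      then show "\<exists>M. \<forall>i\<ge>M. \<forall>j\<ge>M. dist (g i) (g j) < e"
        by blast
    qed
    then obtain l where l: "l \<in> H" "g \<longlonglongrightarrow> l"
      using hilbert_subspaceD(2)[OF H] g(1) unfolding complete_def by blast
    have "(\<lambda>n. A (g n)) \<longlonglongrightarrow> A l"
      by (rule continuous_on_tendsto_compose[OF bounded_operator_continuous_on[OF A sub] l(2,1)])
        (simp add: g)
    then show "\<exists>l\<in>A ` H. f \<longlonglongrightarrow> l"
      using l(1) by (simp add: g(2)[symmetric]) blast
  qed
  then show ?thesis
    using subspace_image_bounded_operator[OF A sub] by (simp add: hilbert_subspace_def)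
qed

text \<open>By the parallelogram law a sequence that minimizes the distance to \<open>x\<close> is Cauchy.  Its limit is a
  nearest point, and the error is orthogonal to \<open>N\<close>, since otherwise a small move inside \<open>N\<close> would
  shorten it.\<close>

lemma orth_proj_exists:
  fixes N :: "'a::complex_inner set"
  assumes N: "hilbert_subspace N"
  shows "\<exists>p\<in>N. \<forall>y\<in>N. cinner (x - p) y = 0"
proof -
  note NN = hilbert_subspaceD[OF N]
  define d where "d = (INF y\<in>N. (norm (x - y))\<^sup>2)"
  have bdd: "bdd_below ((\<lambda>y. (norm (x - y))\<^sup>2) ` N)"
    by (intro bdd_belowI[of _ 0]) auto
  have d: "d \<le> (norm (x - y))\<^sup>2" if "y \<in> N" for y
    unfolding d_def by (rule cINF_lower[OF bdd that])
  have "\<exists>y\<in>N. (norm (x - y))\<^sup>2 < d + 1 / real (Suc n)" for n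
    using cINF_less_iff[OF _ bdd, of "d + 1 / real (Suc n)"] NN(4) by (auto simp: d_def[symmetric])
  then obtain y where y: "\<And>n. y n \<in> N" "\<And>n. (norm (x - y n))\<^sup>2 < d + 1 / real (Suc n)"
    by metis
  have par: "(norm (a - b))\<^sup>2 \<le> 2 * ((norm (x - a))\<^sup>2 - d) + 2 * ((norm (x - b))\<^sup>2 - d)"
    if "a \<in> N" "b \<in> N" for a b
  proof -
    have "(1/2) *\<^sub>R (a + b) \<in> N"
      using NN(7)[OF NN(5)[OF that], of "complex_of_real (1/2)"] by (simp only: scaleC_of_real)
    from d[OF this] have "4 * d \<le> 4 * (norm (x - (1/2) *\<^sub>R (a + b)))\<^sup>2"
      by simp
    also have "\<dots> = 2 * (norm (x - a))\<^sup>2 + 2 * (norm (x - b))\<^sup>2 - (norm (a - b))\<^sup>2"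
      by (simp add: power2_norm_eq_inner inner_diff inner_add inner_commute algebra_simps)
    finally show ?thesis
      by simp
  qed
  have "Cauchy y"
  proof (rule metric_CauchyI)
    fix e :: real assume e: "0 < e"
    then obtain K where K: "1 / real (Suc K) < e\<^sup>2 / 4"
      using nat_approx_posE[of "e\<^sup>2 / 4"] by auto
    have "dist (y i) (y j) < e" if "K \<le> i" "K \<le> j" for i j
    proof -
      have "1 / real (Suc i) \<le> 1 / real (Suc K)" "1 / real (Suc j) \<le> 1 / real (Suc K)"
        using that by (auto simp: frac_le)
      then have "(norm (x - y i))\<^sup>2 < d + e\<^sup>2 / 4" "(norm (x - y j))\<^sup>2 < d + e\<^sup>2 / 4"
        using y(2)[of i] y(2)[of j] K by linarith+
      moreover have "u < t" if "u \<le> 2 * (v - d) + 2 * (v' - d)" "v < d + t / 4" "v' < d + t / 4"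
        for u v v' t :: real
        using that by argo
      ultimately have "(norm (y i - y j))\<^sup>2 < e\<^sup>2"
        using par[OF y(1) y(1), of i j] by blast
      then show ?thesis
        using e by (simp add: dist_norm power2_less_imp_less)
    qed
    then show "\<exists>M. \<forall>i\<ge>M. \<forall>j\<ge>M. dist (y i) (y j) < e"
      by blast
  qed
  then obtain p where p: "p \<in> N" "y \<longlonglongrightarrow> p"
    using NN(2) y(1) unfolding complete_def by blast
  have "(\<lambda>n. d + 1 / real (Suc n)) \<longlonglongrightarrow> d + 0"
    by (intro tendsto_intros LIMSEQ_Suc[OF lim_1_over_n])
  moreover have "(\<lambda>n. (norm (x - y n))\<^sup>2) \<longlonglongrightarrow> (norm (x - p))\<^sup>2"
    by (intro tendsto_intros p)
  ultimately have pd: "(norm (x - p))\<^sup>2 \<le> d"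
    using y(2) by (intro LIMSEQ_le[where X = "\<lambda>n. (norm (x - y n))\<^sup>2"]) (auto intro: less_imp_le)
  have re: "inner (x - p) u = 0" if u: "u \<in> N" for u
  proof (cases "u = 0")
    case False
    \<comment> \<open>The minimizer of \<open>\<parallel>x - p - t u\<parallel>\<close> over real \<open>t\<close>.\<close>
    define t where "t = inner (x - p) u / (norm u)\<^sup>2"
    have "p + t *\<^sub>R u \<in> N"
      using NN(5)[OF p(1) NN(7)[OF u, of "complex_of_real t"]] by (simp only: scaleC_of_real)
    from d[OF this] pd have "(norm (x - p))\<^sup>2 \<le> (norm (x - (p + t *\<^sub>R u)))\<^sup>2"
      by linarith
    also have "\<dots> = (norm (x - p))\<^sup>2 - 2 * t * inner (x - p) u + t\<^sup>2 * (norm u)\<^sup>2"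
      unfolding power2_norm_eq_inner
      by (simp add: inner_diff inner_add inner_commute algebra_simps power2_eq_square)
    also have "\<dots> = (norm (x - p))\<^sup>2 - (inner (x - p) u)\<^sup>2 / (norm u)\<^sup>2"
      using False by (simp add: t_def power2_eq_square field_simps)
    finally show ?thesis
      using False by (simp add: divide_le_0_iff)
  qed simp
  \<comment> \<open>\<open>re\<close> concerns the real part of the inner product; the imaginary part is the real part for \<open>\<i> u\<close>.\<close>
  have "cinner (x - p) u = 0" if u: "u \<in> N" for u
  proof -
    have "Im (cinner (x - p) u) = inner (x - p) (\<i> *\<^sub>C u)"
      by (simp add: cinner_scaleC_right flip: Re_cinner)
    then show ?thesis
      using re[OF u] re[OF NN(7)[OF u]] by (simp add: complex_eq_iff Re_cinner)
  qed
  with p(1) show ?thesis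
    by blast
qed

lemma orth_proj_eqI:
  assumes N: "hilbert_subspace N" and p: "p \<in> N" "\<And>y. y \<in> N \<Longrightarrow> cinner (x - p) y = 0"
  shows "orth_proj N x = p"
  unfolding orth_proj_def
proof (rule the_equality)
  fix q assume q: "q \<in> N \<and> (\<forall>y\<in>N. cinner (x - q) y = 0)"
  have "q - p \<in> N"
    using hilbert_subspaceD(6)[OF N] p q by blast
  then have "cinner (x - p) (q - p) - cinner (x - q) (q - p) = 0"
    using p q by simp
  then show "q = p"
    by (simp flip: cinner_diff_left)
qed (use p in blast)

lemma
  assumes N: "hilbert_subspace N"
  shows orth_proj_in: "orth_proj N x \<in> N"
    and cinner_orth_proj: "y \<in> N \<Longrightarrow> cinner (orth_proj N x) y = cinner x y"
proof -
  obtain p where p: "p \<in> N" "\<And>y. y \<in> N \<Longrightarrow> cinner (x - p) y = 0"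
    using orth_proj_exists[OF N, of x] by blast
  have eq: "orth_proj N x = p"
    by (rule orth_proj_eqI[OF N p])
  show "orth_proj N x \<in> N"
    using p eq by simp
  show "y \<in> N \<Longrightarrow> cinner (orth_proj N x) y = cinner x y"
    using p(2)[of y] by (simp add: eq cinner_diff_left)
qed

lemma orth_proj_eqI':
  assumes N: "hilbert_subspace N" and p: "p \<in> N" "\<And>y. y \<in> N \<Longrightarrow> cinner p y = cinner x y"
  shows "orth_proj N x = p"
  by (rule orth_proj_eqI[OF N p(1)]) (simp add: cinner_diff_left p(2))

lemma cinner_orth_proj_right:
  assumes N: "hilbert_subspace N" and y: "y \<in> N"
  shows "cinner y (orth_proj N x) = cinner y x"
  by (metis cinner_orth_proj[OF N y] cinner_commute)

lemma bounded_operator_orth_proj: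
  assumes N: "hilbert_subspace N"
  shows "bounded_operator H N (orth_proj N)"
proof (rule bounded_operatorI[where M = 1])
  note NN = hilbert_subspaceD[OF N] and P = orth_proj_in[OF N] cinner_orth_proj[OF N]
  show "orth_proj N (x + y) = orth_proj N x + orth_proj N y" for x y
    by (rule orth_proj_eqI'[OF N]) (simp_all add: NN P cinner_add_left)
  show "orth_proj N (c *\<^sub>C x) = c *\<^sub>C orth_proj N x" for c x
    by (rule orth_proj_eqI'[OF N]) (simp_all add: NN P cinner_scaleC_left)
  show "norm (orth_proj N x) \<le> 1 * norm x" for x
  proof -
    have "complex_of_real ((norm (orth_proj N x))\<^sup>2) = cinner x (orth_proj N x)"
      using P by (simp del: of_real_power flip: cinner_self)
    then have "(norm (orth_proj N x))\<^sup>2 \<le> norm x * norm (orth_proj N x)"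
      using norm_cinner_le[of x "orth_proj N x"] by (metis norm_of_real abs_power2)
    then show ?thesis
      by (cases "norm (orth_proj N x) = 0") (simp_all add: power2_eq_square)
  qed
qed (rule orth_proj_in[OF N])

lemma cinner_eqI:
  assumes "complex_vector.subspace H" "x \<in> H" "y \<in> H" "\<And>z. z \<in> H \<Longrightarrow> cinner x z = cinner y z"
  shows "x = y"
  using assms(4)[OF complex_vector.subspace_diff[OF assms(1-3)]]
  by (metis cinner_diff_left cinner_self_eq_0 eq_iff_diff_eq_0)

text \<open>Modulo its kernel \<open>N\<close> the functional is one-dimensional, so it is represented by a multiple of any
  nonzero vector \<open>u\<close> orthogonal to \<open>N\<close>.\<close>

lemma riesz_representation:
  fixes f :: "'a::complex_inner \<Rightarrow> complex"
  assumes H: "hilbert_subspace H" and f: "bounded_operator H UNIV f"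
  shows "\<exists>z\<in>H. \<forall>x\<in>H. f x = cinner x z"
proof -
  note HH = hilbert_subspaceD[OF H] and ff = bounded_operatorD[OF f] bounded_operator_diff[OF f]
  define N where "N = {x \<in> H. f x = 0}"
  have subN: "complex_vector.subspace N"
    unfolding complex_vector.subspace_def N_def
    by (auto simp: HH ff bounded_operator_0[OF f HH(1)])
  have "closed N"
    unfolding N_def
    by (rule continuous_closed_preimage_constant[OF bounded_operator_continuous_on[OF f HH(1)] HH(3)])
  then have N: "hilbert_subspace N"
    using hilbert_subspace_closed_subset[OF H subN] by (auto simp: N_def)
  show ?thesis
  proof (cases "\<forall>x\<in>H. f x = 0")
    case True
    then show ?thesis
      using HH(4) by force
  next
    case False
    then obtain x0 where x0: "x0 \<in> H" "f x0 \<noteq> 0"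
      by blast
    define u where "u = x0 - orth_proj N x0"
    have PN: "orth_proj N x0 \<in> H" "f (orth_proj N x0) = 0"
      using orth_proj_in[OF N] by (auto simp: N_def)
    then have u: "u \<in> H" "f u \<noteq> 0"
      using x0 by (simp_all add: u_def HH ff)
    have orth: "cinner v u = 0" if "v \<in> N" for v
      by (simp add: u_def cinner_diff_right cinner_orth_proj_right[OF N that])
    have u0: "cinner u u \<noteq> 0"
      using u(2) bounded_operator_0[OF f HH(1)] by auto
    show ?thesis
    proof (intro bexI ballI)
      show "(cnj (f u) / cnj (cinner u u)) *\<^sub>C u \<in> H"
        using u HH by blast
      fix x assume x: "x \<in> H"
      have "x - (f x / f u) *\<^sub>C u \<in> N"
        using u x by (simp add: N_def HH ff scaleC_complex_def)
      from orth[OF this] have "cinner x u = (f x / f u) * cinner u u"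
        by (simp add: cinner_diff_left cinner_scaleC_left)
      then show "f x = cinner x ((cnj (f u) / cnj (cinner u u)) *\<^sub>C u)"
        using u(2) u0 by (simp add: cinner_scaleC_right)
    qed
  qed
qed

lemma adjoint_exists:
  assumes H: "hilbert_subspace H" and A: "bounded_operator H K A"
  obtains B where "bounded_operator K H B"
    "\<And>x y. x \<in> H \<Longrightarrow> y \<in> K \<Longrightarrow> cinner (A x) y = cinner x (B y)"
proof -
  note HH = hilbert_subspaceD[OF H] and AA = bounded_operatorD[OF A]
  obtain M where M: "0 < M" "\<And>x. x \<in> H \<Longrightarrow> norm (A x) \<le> M * norm x"
    using bounded_operator_bound[OF A] by blast
  have "\<exists>z. z \<in> H \<and> (\<forall>x\<in>H. cinner (A x) y = cinner x z)" for y
  proof -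
    have "bounded_operator H UNIV (\<lambda>x. cinner (A x) y)"
    proof (rule bounded_operatorI)
      fix x assume x: "x \<in> H"
      have "norm (cinner (A x) y) \<le> norm (A x) * norm y"
        by (rule norm_cinner_le)
      also have "\<dots> \<le> M * norm x * norm y"
        by (intro mult_right_mono M x) simp
      finally show "norm (cinner (A x) y) \<le> (M * norm y) * norm x"
        by (simp add: mult_ac)
    qed (simp_all add: AA cinner_add_left cinner_scaleC_left scaleC_complex_def)
    from riesz_representation[OF H this] show ?thesis
      by blast
  qed
  then obtain B where B: "\<And>y. B y \<in> H" "\<And>x y. x \<in> H \<Longrightarrow> cinner (A x) y = cinner x (B y)"
    by metis
  have Bl: "cinner (B y) x = cinner y (A x)" if "x \<in> H" for x y
    using B(2)[OF that, of y] by (metis cinner_commute)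
  have "bounded_operator K H B"
  proof (rule bounded_operatorI)
    show "B (x + y) = B x + B y" for x y
      by (rule cinner_eqI[OF HH(1)]) (simp_all add: HH B Bl cinner_add_left)
    show "B (c *\<^sub>C x) = c *\<^sub>C B x" for c x
      by (rule cinner_eqI[OF HH(1)]) (simp_all add: HH B Bl cinner_scaleC_left)
    show "norm (B y) \<le> M * norm y" for y
    proof -
      have "complex_of_real ((norm (B y))\<^sup>2) = cinner y (A (B y))"
        using Bl B by (simp del: of_real_power flip: cinner_self)
      then have "(norm (B y))\<^sup>2 \<le> norm y * norm (A (B y))"
        using norm_cinner_le[of y "A (B y)"] by (metis norm_of_real abs_power2)
      also have "\<dots> \<le> norm y * (M * norm (B y))"
        by (intro mult_left_mono M B) simp
      finally show ?thesis
        by (cases "norm (B y) = 0") (use M in \<open>simp_all add: power2_eq_square mult_ac\<close>)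
    qed
  qed (rule B)
  then show ?thesis
    using B(2) by (rule that)
qed

text \<open>The description in \<open>adjoint_on\<close> picks out the adjoint once there is one, which completeness of \<open>H\<close>
  provides.\<close>

lemma cinner_adjoint_on:
  assumes H: "hilbert_subspace H" and A: "bounded_operator H H A" and x: "x \<in> H" and y: "y \<in> H"
  shows "cinner (A x) y = cinner x (adjoint_on H A y)"
proof -
  obtain B where B: "bounded_operator H H B"
    "\<And>x y. x \<in> H \<Longrightarrow> y \<in> H \<Longrightarrow> cinner (A x) y = cinner x (B y)"
    using adjoint_exists[OF H A] by blast
  have "adjoint_on H A y = B y"
    unfolding adjoint_on_def
  proof (rule the_equality)
    fix z assume "z \<in> H \<and> (\<forall>x\<in>H. cinner (A x) y = cinner x z)"
    then show "z = B y"
      using bounded_operatorD(1)[OF B(1) y] B(2)[OF _ y]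
      by (intro cinner_eqI[OF hilbert_subspaceD(1)[OF H]]) (auto, metis cinner_commute)
  qed (use bounded_operatorD(1)[OF B(1) y] B(2)[OF _ y] in auto)
  with B(2)[OF x y] show ?thesis
    by simp
qed

lemma adjoint_on_eqI:
  assumes H: "hilbert_subspace H" and z: "z \<in> H" "\<And>x. x \<in> H \<Longrightarrow> cinner (A x) y = cinner x z"
  shows "adjoint_on H A y = z"
  unfolding adjoint_on_def
proof (rule the_equality)
  fix z' assume "z' \<in> H \<and> (\<forall>x\<in>H. cinner (A x) y = cinner x z')"
  then show "z' = z"
    using z by (intro cinner_eqI[OF hilbert_subspaceD(1)[OF H]]) (auto, metis cinner_commute)
qed (use z in blast)

section \<open>Invertibility of bounded operators\<close>

text \<open>With \<open>B\<close> the adjoint of \<open>A\<close>, the operator \<open>B A\<close> satisfies \<open>\<langle>x, B A x\<rangle> = \<parallel>A x\<parallel>\<^sup>2\<close>.  If \<open>A\<close> is bounded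
  below, this form is coercive: the range of \<open>B A\<close> is complete, and only zero is orthogonal to it.
  Applied to the analysis operator of a frame, it inverts the frame operator.\<close>

lemma adjoint_compose_surj:
  assumes H: "hilbert_subspace H" and A: "bounded_operator H K A" and B: "bounded_operator K H B"
    and adj: "\<And>x y. x \<in> H \<Longrightarrow> y \<in> K \<Longrightarrow> cinner (A x) y = cinner x (B y)"
    and m: "0 < m" "\<And>x. x \<in> H \<Longrightarrow> m * norm x \<le> norm (A x)"
    and y: "y \<in> H"
  obtains x where "x \<in> H" "B (A x) = y" "m\<^sup>2 * norm x \<le> norm y"
proof -
  note HH = hilbert_subspaceD[OF H]
  have BA: "bounded_operator H H (\<lambda>x. B (A x))"
    by (rule bounded_operator_compose[OF A B])
  have form: "cinner x (B (A x)) = complex_of_real ((norm (A x))\<^sup>2)" if "x \<in> H" for x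
    using adj[OF that bounded_operatorD(1)[OF A that]] by (simp add: cinner_self)
  have below: "m\<^sup>2 * norm x \<le> norm (B (A x))" if x: "x \<in> H" for x
  proof -
    have "(m * norm x)\<^sup>2 \<le> (norm (A x))\<^sup>2"
      using m x by (intro power_mono) auto
    also have "\<dots> = cmod (cinner x (B (A x)))"
      by (simp add: form[OF x] del: of_real_power)
    also have "\<dots> \<le> norm x * norm (B (A x))"
      by (rule norm_cinner_le)
    finally show ?thesis
      by (cases "x = 0") (simp_all add: power2_eq_square mult_ac)
  qed
  define R where "R = (\<lambda>x. B (A x)) ` H"
  have R: "hilbert_subspace R"
    unfolding R_def by (rule hilbert_subspace_image[OF BA H, of "m\<^sup>2"]) (use m below in auto)
  have RH: "R \<subseteq> H"
    using bounded_operatorD(1)[OF BA] by (auto simp: R_def)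
  define z where "z = y - orth_proj R y"
  have z: "z \<in> H"
    unfolding z_def using orth_proj_in[OF R] RH by (intro HH(6) y) blast
  have "cinner z (B (A z)) = 0"
    using cinner_orth_proj[OF R, of "B (A z)" y] z by (simp add: R_def z_def cinner_diff_left)
  then have "norm (A z) = 0"
    by (simp add: form[OF z])
  then have "z = 0"
    using m(2)[OF z] m(1) by (simp add: mult_le_0_iff)
  then have "y \<in> R"
    using orth_proj_in[OF R, of y] by (simp add: z_def)
  then show ?thesis
    using that below by (auto simp: R_def)
qed

text \<open>The explicit tail bound is kept because the gliding hump argument compares it with the hump.\<close>

lemma Cauchy_geometric_steps:
  fixes x :: "nat \<Rightarrow> 'a::metric_space"
  assumes step: "\<And>n. dist (x (Suc n)) (x n) \<le> c * q ^ n" and q: "0 \<le> q" "q < 1"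
  shows "dist (x (n + k)) (x n) \<le> c * q ^ n / (1 - q)" and "Cauchy x"
proof -
  have c: "0 \<le> c"
    using order_trans[OF zero_le_dist step[of 0]] by simp
  have tail: "dist (x (n + k)) (x n) \<le> c * q ^ n * (1 - q ^ k) / (1 - q)" for n k
  proof (induction k)
    case (Suc k)
    have "dist (x (n + Suc k)) (x n) \<le> dist (x (Suc (n + k))) (x (n + k)) + dist (x (n + k)) (x n)"
      using dist_triangle by simp
    also have "\<dots> \<le> c * q ^ (n + k) + c * q ^ n * (1 - q ^ k) / (1 - q)"
      by (intro add_mono step Suc)
    also have "\<dots> = c * q ^ n * (1 - q ^ Suc k) / (1 - q)"
      using q by (simp add: power_add field_simps)
    finally show ?case .
  qed simp
  show tail': "dist (x (n + k)) (x n) \<le> c * q ^ n / (1 - q)" for n k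
    using q c by (intro order_trans[OF tail] divide_right_mono) (simp_all add: mult_left_le)
  show "Cauchy x"
  proof (rule metric_CauchyI)
    fix e :: real assume "0 < e"
    have "(\<lambda>n. c * q ^ n / (1 - q)) \<longlonglongrightarrow> c * 0 / (1 - q)"
      using q by (intro tendsto_intros LIMSEQ_power_zero) auto
    then have "\<forall>\<^sub>F n in sequentially. c * q ^ n / (1 - q) < e / 2"
      using \<open>0 < e\<close> by (intro order_tendstoD(2)) auto
    then obtain n where n: "c * q ^ n / (1 - q) < e / 2"
      unfolding eventually_sequentially by blast
    have le: "dist (x i) (x n) \<le> c * q ^ n / (1 - q)" if "n \<le> i" for i
      using tail'[of n "i - n"] that by simp
    have "dist (x i) (x j) < e" if "n \<le> i" "n \<le> j" for i j
      using n dist_triangle2[of "x i" "x j" "x n"] le[OF that(1)] le[OF that(2)] by linarith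
    then show "\<exists>M. \<forall>i\<ge>M. \<forall>j\<ge>M. dist (x i) (x j) < e"
      by blast
  qed
qed

text \<open>A gliding hump.  If the functionals \<open>g n\<close> grow faster than \<open>4\<^sup>n\<close>, a series with steps of length
  \<open>3\<^sup>-\<^sup>n\<close> in the direction of \<open>g n\<close> is built, with signs chosen such that the \<open>n\<close>-th step does not
  cancel against the partial sum before it.  The value of \<open>g n\<close> at the next partial sum is then at
  least \<open>3\<^sup>-\<^sup>n \<parallel>g n\<parallel>\<close>, the remaining steps take away at most half of it, and what is left is at least
  \<open>(4/3)\<^sup>n / 2\<close>.\<close>

lemma uniform_boundedness:
  fixes K G :: "'a::complex_inner set"
  assumes K: "hilbert_subspace K" and GK: "G \<subseteq> K"
    and bdd: "\<And>x. x \<in> K \<Longrightarrow> \<exists>M. \<forall>g\<in>G. \<bar>inner x g\<bar> \<le> M"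
  shows "\<exists>M. \<forall>g\<in>G. norm g \<le> M"
proof (rule ccontr)
  note KK = hilbert_subspaceD[OF K]
  assume "\<not> ?thesis"
  then have "\<exists>g\<in>G. 4 ^ n < norm g" for n :: nat
    by (meson not_le)
  then obtain g where g: "\<And>n. g n \<in> G" "\<And>n. 4 ^ n < norm (g n)"
    by metis
  have KR: "r *\<^sub>R u \<in> K" if "u \<in> K" for r u
    using KK(7)[OF that, of "complex_of_real r"] by (simp only: scaleC_of_real)
  define st where "st n x = x + ((if 0 \<le> inner x (g n) then 1 else -1) * (1/3) ^ n / norm (g n)) *\<^sub>R g n"
    for n :: nat and x
  define x where "x = rec_nat 0 st"
  have x0: "x 0 = 0" and xS: "x (Suc n) = st n (x n)" for n
    by (simp_all add: x_def)
  have xK: "x n \<in> K" for n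
    by (induction n) (use g(1) GK in \<open>auto simp: x0 xS st_def intro!: KK KR\<close>)
  have gpos: "0 < norm (g n)" for n
    using g(2)[of n] by (rule less_trans[rotated]) simp
  have step: "norm (x (Suc n) - x n) \<le> (1/3) ^ n" for n
    using gpos[of n] by (auto simp: xS st_def)
  have hump: "(1/3) ^ n * norm (g n) \<le> \<bar>inner (x (Suc n)) (g n)\<bar>" for n
  proof -
    have "inner (x (Suc n)) (g n) = inner (x n) (g n)
        + (if 0 \<le> inner (x n) (g n) then 1 else -1) * (1/3) ^ n * norm (g n)"
      using gpos[of n] by (simp add: xS st_def inner_add_left power2_norm_eq_inner[symmetric] power2_eq_square)
    moreover have "0 \<le> (1/3) ^ n * norm (g n)"
      by simp
    ultimately show ?thesis
      by (auto split: if_splits)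
  qed
  have step': "dist (x (Suc n)) (x n) \<le> 1 * (1/3) ^ n" for n
    using step[of n] by (simp add: dist_norm)
  have tail': "norm (x (n + k) - x n) \<le> (3/2) * (1/3) ^ n" for n k
    using Cauchy_geometric_steps(1)[OF step', of n k] by (simp add: dist_norm)
  have "Cauchy x"
    by (rule Cauchy_geometric_steps(2)[OF step']) simp_all
  then obtain l where l: "l \<in> K" "x \<longlonglongrightarrow> l"
    using KK(2) xK unfolding complete_def by blast
  obtain M where M: "\<And>h. h \<in> G \<Longrightarrow> \<bar>inner l h\<bar> \<le> M"
    using bdd[OF l(1)] by blast
  have lt: "norm (l - x n) \<le> (3/2) * (1/3) ^ n" for n
  proof (rule Lim_bounded)
    show "(\<lambda>k. norm (x k - x n)) \<longlonglongrightarrow> norm (l - x n)"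
      by (intro tendsto_intros l)
    show "\<forall>k\<ge>n. norm (x k - x n) \<le> (3/2) * (1/3) ^ n"
      using tail'[of n] by (metis le_add_diff_inverse)
  qed
  have "(1/2) * (4/3) ^ n \<le> M" for n
  proof -
    have "\<bar>inner (l - x (Suc n)) (g n)\<bar> \<le> norm (l - x (Suc n)) * norm (g n)"
      by (rule Cauchy_Schwarz_ineq2)
    also have "\<dots> \<le> ((3/2) * (1/3) ^ Suc n) * norm (g n)"
      by (intro mult_right_mono lt) simp
    finally have 1: "\<bar>inner (l - x (Suc n)) (g n)\<bar> \<le> (1/2) * ((1/3) ^ n * norm (g n))"
      by simp
    have "(4/3::real) ^ n = (1/3) ^ n * 4 ^ n"
      by (simp flip: power_mult_distrib)
    also have "\<dots> \<le> (1/3) ^ n * norm (g n)"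
      using g(2)[of n] by (intro mult_left_mono) auto
    finally show ?thesis
      using 1 hump[of n] M[OF g(1), of n] by (auto simp: inner_diff_left abs_if split: if_splits)
  qed
  note le = this
  obtain n where "2 * M < (4/3) ^ n"
    using real_arch_pow[of "4/3" "2 * M"] by auto
  then show False
    using le[of n] by linarith
qed

text \<open>With \<open>B\<close> the adjoint of \<open>C\<close>, surjectivity of \<open>C\<close> makes the set of all \<open>g\<close> with \<open>\<parallel>B g\<parallel> \<le> 1\<close> weakly
  bounded, hence bounded; in other words, \<open>B\<close> is bounded below.  So \<open>C B\<close> is onto with control of the
  preimage, and by injectivity of \<open>C\<close> the inverse is \<open>B\<close> after the inverse of \<open>C B\<close>.\<close>

lemma bounded_inverse:
  assumes H: "hilbert_subspace H" and K: "hilbert_subspace K"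
    and C: "bounded_operator H K C" and bij: "bij_betw C H K"
  shows "bounded_operator K H (inv_into H C)"
proof -
  note HH = hilbert_subspaceD[OF H] and KK = hilbert_subspaceD[OF K] and CC = bounded_operatorD[OF C]
  obtain B where B: "bounded_operator K H B"
    "\<And>x y. x \<in> H \<Longrightarrow> y \<in> K \<Longrightarrow> cinner (C x) y = cinner x (B y)"
    using adjoint_exists[OF H C] by blast
  define G where "G = {g \<in> K. norm (B g) \<le> 1}"
  have "\<exists>M. \<forall>g\<in>G. norm g \<le> M"
  proof (rule uniform_boundedness[OF K])
    fix y assume "y \<in> K"
    then obtain h where h: "h \<in> H" "y = C h"
      using bij by (auto simp: bij_betw_def)
    have "\<bar>inner y g\<bar> \<le> norm h" if "g \<in> G" for g
    proof -
      have "inner y g = Re (cinner h (B g))"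
        using B(2)[OF h(1), of g] that h(2) by (simp add: G_def flip: Re_cinner)
      also have "\<bar>\<dots>\<bar> \<le> norm h * norm (B g)"
        using abs_Re_le_cmod norm_cinner_le order_trans by blast
      also have "\<dots> \<le> norm h * 1"
        using that by (intro mult_left_mono) (auto simp: G_def)
      finally show ?thesis
        by simp
    qed
    then show "\<exists>M. \<forall>g\<in>G. \<bar>inner y g\<bar> \<le> M"
      by blast
  qed (simp add: G_def)
  then obtain M0 where M0: "\<And>g. g \<in> G \<Longrightarrow> norm g \<le> M0"
    by blast
  define M where "M = \<bar>M0\<bar> + 1"
  have M: "0 < M" "\<And>g. g \<in> G \<Longrightarrow> norm g \<le> M"
    using M0 by (force simp: M_def)+
  have below: "(1/M) * norm g \<le> norm (B g)" if g: "g \<in> K" for g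
  proof -
    have *: "t * norm g \<le> M" if t: "0 \<le> t" "t * norm (B g) \<le> 1" for t
    proof -
      have "B (complex_of_real t *\<^sub>C g) = complex_of_real t *\<^sub>C B g"
        by (rule bounded_operatorD(3)[OF B(1) g])
      then have "complex_of_real t *\<^sub>C g \<in> G"
        using t KK(7)[OF g] by (simp add: G_def norm_scaleC)
      from M(2)[OF this] show ?thesis
        using t by (simp add: norm_scaleC)
    qed
    show ?thesis
    proof (cases "norm (B g) = 0")
      case True
      \<comment> \<open>If \<open>B g = 0\<close>, every multiple of \<open>g\<close> lies in \<open>G\<close>.\<close>
      have "norm g = 0"
      proof (rule ccontr)
        assume "norm g \<noteq> 0"
        then show False
          using *[of "(M + 1) / norm g"] True M(1) by simp
      qed
      then show ?thesis
        by simp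
    next
      case False
      then show ?thesis
        using *[of "1 / norm (B g)"] M(1) by (simp add: field_simps)
    qed
  qed
  have adj: "cinner (B x) y = cinner x (C y)" if "x \<in> K" "y \<in> H" for x y
    using B(2)[OF that(2,1)] by (metis cinner_commute)
  obtain MB where MB: "0 < MB" "\<And>x. x \<in> K \<Longrightarrow> norm (B x) \<le> MB * norm x"
    using bounded_operator_bound[OF B(1)] by blast
  have inv: "inv_into H C y \<in> H" "C (inv_into H C y) = y" if "y \<in> K" for y
    using that bij by (auto simp: bij_betw_def inv_into_into f_inv_into_f)
  have eqI: "inv_into H C y = h" if "h \<in> H" "C h = y" for h y
    using that bij by (auto simp: bij_betw_def)
  show ?thesis
  proof (rule bounded_operatorI)
    show "inv_into H C (x + y) = inv_into H C x + inv_into H C y" if "x \<in> K" "y \<in> K" for x y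
      by (rule eqI) (simp_all add: that inv HH CC)
    show "inv_into H C (c *\<^sub>C x) = c *\<^sub>C inv_into H C x" if "x \<in> K" for c x
      by (rule eqI) (simp_all add: that inv HH CC)
    fix y assume y: "y \<in> K"
    obtain x where x: "x \<in> K" "C (B x) = y" "(1/M)\<^sup>2 * norm x \<le> norm y"
      by (rule adjoint_compose_surj[OF K B(1) C adj _ below y]) (use M(1) in auto)
    have "norm (inv_into H C y) = norm (B x)"
      using eqI[OF bounded_operatorD(1)[OF B(1) x(1)] x(2)] by simp
    also have "\<dots> \<le> MB * norm x"
      by (rule MB(2)[OF x(1)])
    also have "\<dots> \<le> MB * (M\<^sup>2 * norm y)"
      using MB(1) M(1) x(3) by (intro mult_left_mono) (auto simp: field_simps)
    finally show "norm (inv_into H C y) \<le> (MB * M\<^sup>2) * norm y"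
      by (simp add: mult.assoc)
  qed (rule inv)
qed

section \<open>Completeness of \<open>\<ell>\<^sup>2\<close> and of \<open>L\<^sup>2\<close>\<close>

lemma norm_ell2_sq: "(norm x)\<^sup>2 = (\<Sum>\<^sub>\<infinity>i. (cmod (Rep_ell2 x i))\<^sup>2)"
proof -
  have "complex_of_real ((norm x)\<^sup>2) = cinner x x"
    by (rule cinner_self[symmetric])
  also have "\<dots> = (\<Sum>\<^sub>\<infinity>i. complex_of_real ((cmod (Rep_ell2 x i))\<^sup>2))"
    unfolding cinner_ell2.rep_eq by (simp only: complex_norm_square)
  also have "\<dots> = complex_of_real (\<Sum>\<^sub>\<infinity>i. (cmod (Rep_ell2 x i))\<^sup>2)"
    using Rep_ell2[of x] by (intro infsumI has_sum_of_real has_sum_infsum) simp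
  finally show ?thesis
    by (simp only: of_real_eq_iff)
qed

lemma ell2_summable: "(\<lambda>i. (cmod (Rep_ell2 x i))\<^sup>2) summable_on UNIV"
  using Rep_ell2[of x] by simp

lemma sum_le_norm_ell2:
  assumes "finite F"
  shows "(\<Sum>i\<in>F. (cmod (Rep_ell2 x i))\<^sup>2) \<le> (norm x)\<^sup>2"
  unfolding norm_ell2_sq by (rule finite_sum_le_infsum[OF ell2_summable assms]) auto

lemma norm_ell2_le:
  assumes "\<And>F. finite F \<Longrightarrow> (\<Sum>i\<in>F. (cmod (Rep_ell2 x i))\<^sup>2) \<le> e\<^sup>2" "0 \<le> e"
  shows "norm x \<le> e"
proof -
  have "(norm x)\<^sup>2 \<le> e\<^sup>2"
    unfolding norm_ell2_sq by (rule infsum_le_finite_sums[OF ell2_summable]) (use assms in auto)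
  then show ?thesis
    using assms(2) by (rule power2_le_imp_le)
qed

lemma cmod_Rep_ell2_le: "cmod (Rep_ell2 x i) \<le> norm x"
proof (rule power2_le_imp_le)
  show "(cmod (Rep_ell2 x i))\<^sup>2 \<le> (norm x)\<^sup>2"
    using sum_le_norm_ell2[of "{i}" x] by simp
qed simp

text \<open>The limit is taken coordinatewise.  On a finite set of coordinates the Cauchy estimate passes to the
  limit, with a bound that does not depend on the set.\<close>

lemma Cauchy_convergent_ell2:
  fixes X :: "nat \<Rightarrow> ('a) ell2"
  assumes X: "Cauchy X"
  shows "convergent X"
proof -
  have diff: "Rep_ell2 (x - y) i = Rep_ell2 x i - Rep_ell2 y i" for x y :: "'a ell2" and i
    by (simp add: minus_ell2.rep_eq)
  have "Cauchy (\<lambda>n. Rep_ell2 (X n) i)" for i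
  proof (rule metric_CauchyI)
    fix e :: real assume "0 < e"
    then obtain M where M: "\<And>m n. M \<le> m \<Longrightarrow> M \<le> n \<Longrightarrow> norm (X m - X n) < e"
      using X unfolding Cauchy_def dist_norm by blast
    have "dist (Rep_ell2 (X m) i) (Rep_ell2 (X n) i) < e" if "M \<le> m" "M \<le> n" for m n
      using le_less_trans[OF cmod_Rep_ell2_le M[OF that]] by (simp add: diff dist_norm)
    then show "\<exists>M. \<forall>m\<ge>M. \<forall>n\<ge>M. dist (Rep_ell2 (X m) i) (Rep_ell2 (X n) i) < e"
      by blast
  qed
  then have "\<exists>l. (\<lambda>n. Rep_ell2 (X n) i) \<longlonglongrightarrow> l" for i
    unfolding convergent_def[symmetric] by (rule Cauchy_convergent)
  then obtain l where l: "\<And>i. (\<lambda>n. Rep_ell2 (X n) i) \<longlonglongrightarrow> l i"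
    by metis
  have le: "(\<Sum>i\<in>F. (cmod (Rep_ell2 (X n) i - l i))\<^sup>2) \<le> e\<^sup>2"
    if F: "finite F" and n: "N \<le> n" and N: "\<And>m n. N \<le> m \<Longrightarrow> N \<le> n \<Longrightarrow> norm (X n - X m) < e"
    for F n N e
  proof (rule Lim_bounded)
    show "(\<lambda>m. \<Sum>i\<in>F. (cmod (Rep_ell2 (X n) i - Rep_ell2 (X m) i))\<^sup>2)
        \<longlonglongrightarrow> (\<Sum>i\<in>F. (cmod (Rep_ell2 (X n) i - l i))\<^sup>2)"
      by (intro tendsto_intros l)
    show "\<forall>m\<ge>N. (\<Sum>i\<in>F. (cmod (Rep_ell2 (X n) i - Rep_ell2 (X m) i))\<^sup>2) \<le> e\<^sup>2"
    proof (intro allI impI)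
      fix m assume "N \<le> m"
      then have "(norm (X n - X m))\<^sup>2 \<le> e\<^sup>2"
        using N[OF _ n, of m] by (intro power_mono less_imp_le norm_ge_zero)
      then show "(\<Sum>i\<in>F. (cmod (Rep_ell2 (X n) i - Rep_ell2 (X m) i))\<^sup>2) \<le> e\<^sup>2"
        using order_trans[OF sum_le_norm_ell2[OF F, of "X n - X m"]] unfolding diff by blast
    qed
  qed
  have CauchyX: "\<exists>N. \<forall>m\<ge>N. \<forall>n\<ge>N. norm (X n - X m) < e" if "0 < e" for e
    using X that unfolding Cauchy_def dist_norm by blast
  obtain N1 where N1: "\<And>m n. N1 \<le> m \<Longrightarrow> N1 \<le> n \<Longrightarrow> norm (X n - X m) < 1"
    using CauchyX[OF zero_less_one] by blast
  have "(\<lambda>i. (cmod (Rep_ell2 (X N1) i - l i))\<^sup>2) summable_on UNIV"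
  proof (rule nonneg_bdd_above_summable_on)
    show "bdd_above (sum (\<lambda>i. (cmod (Rep_ell2 (X N1) i - l i))\<^sup>2) ` {F. F \<subseteq> UNIV \<and> finite F})"
      by (rule bdd_aboveI[of _ "1\<^sup>2"]) (use le[OF _ order_refl N1] in blast)
  qed simp
  from square_summable_add[OF square_summable_mult_left[OF this, of "-1"] ell2_summable[of "X N1"]]
  have "(\<lambda>i. (cmod (l i))\<^sup>2) summable_on UNIV"
    by simp
  then have Rep: "Rep_ell2 (Abs_ell2 l) = l"
    by (intro Abs_ell2_inverse) simp
  have "X \<longlonglongrightarrow> Abs_ell2 l"
  proof (rule metric_LIMSEQ_I)
    fix e :: real assume e: "0 < e"
    then obtain N where N: "\<And>m n. N \<le> m \<Longrightarrow> N \<le> n \<Longrightarrow> norm (X n - X m) < e / 2"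
      using CauchyX[OF half_gt_zero[OF e]] by blast
    have "dist (X n) (Abs_ell2 l) < e" if "N \<le> n" for n
    proof -
      have "norm (X n - Abs_ell2 l) \<le> e / 2"
      proof (rule norm_ell2_le)
        fix F :: "'a set" assume "finite F"
        from le[OF this that N] show "(\<Sum>i\<in>F. (cmod (Rep_ell2 (X n - Abs_ell2 l) i))\<^sup>2) \<le> (e / 2)\<^sup>2"
          unfolding diff Rep .
      qed (use e in simp)
      then show ?thesis
        using e by (simp add: dist_norm)
    qed
    then show "\<exists>N. \<forall>n\<ge>N. dist (X n) (Abs_ell2 l) < e"
      by blast
  qed
  then show ?thesis
    by (rule convergentI)
qed

instance ell2 :: (type) complete_space
  by standard (rule Cauchy_convergent_ell2)

lemma square_integrable_rep_L2: "square_integrable (rep_L2 x)"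
  using Quotient3_rep_reflp[OF Quotient3_L2, of x] by (simp add: L2_rel_def)

lemma rep_abs_L2:
  assumes "square_integrable f"
  shows "AE z in circle. rep_L2 (abs_L2 f) z = f z"
  using Quotient3_rep_abs[OF Quotient3_L2, of f] assms by (simp add: L2_rel_def)

lemma L2_eqI:
  assumes "AE z in circle. rep_L2 x z = rep_L2 y z"
  shows "x = y"
proof -
  have "L2_rel (rep_L2 x) (rep_L2 y)"
    unfolding L2_rel_def using assms square_integrable_rep_L2 by blast
  then show ?thesis
    using Quotient3_rel_rep[OF Quotient3_L2] by blast
qed

lemma rep_diff_L2: "AE z in circle. rep_L2 (x - y) z = rep_L2 x z - rep_L2 y z"
  unfolding minus_L2_def map_fun_def comp_def id_def
  by (intro rep_abs_L2 square_integrable_diff square_integrable_rep_L2)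

lemma rep_add_L2: "AE z in circle. rep_L2 (x + y) z = rep_L2 x z + rep_L2 y z"
  unfolding plus_L2_def map_fun_def comp_def id_def
  by (intro rep_abs_L2 square_integrable_add square_integrable_rep_L2)

lemma rep_scaleC_L2: "AE z in circle. rep_L2 (c *\<^sub>C x) z = c *\<^sub>C rep_L2 x z"
  unfolding scaleC_L2_def map_fun_def comp_def id_def
  by (intro rep_abs_L2 square_integrable_scaleC square_integrable_rep_L2)

lemma rep_zero_L2: "AE z in circle. rep_L2 (0 :: 'k::complex_inner L2) z = 0"
  unfolding zero_L2_def by (intro rep_abs_L2 square_integrable_const)

lemma circle_measurable_rep_L2: "circle_measurable (rep_L2 x)"
  using square_integrable_rep_L2[of x] by (simp add: square_integrable_def)

lemma borel_measurable_norm_diff: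
  assumes "circle_measurable f" "circle_measurable g"
  shows "(\<lambda>z. norm (f z - g z)) \<in> borel_measurable circle"
  by (intro circle_measurable_norm circle_measurable_diff assms)

text \<open>The form of the norm to which monotone convergence and Fatou's lemma apply.\<close>

lemma nn_norm_diff_L2:
  "ennreal ((norm (x - y))\<^sup>2) = (\<integral>\<^sup>+z. ennreal ((norm (rep_L2 x z - rep_L2 y z))\<^sup>2) \<partial>circle)"
proof -
  have "complex_of_real ((norm (x - y))\<^sup>2) = complex_of_real (LINT z|circle. (norm (rep_L2 (x - y) z))\<^sup>2)"
    unfolding cinner_self[symmetric] by (rule cinner_L2_self)
  then have "ennreal ((norm (x - y))\<^sup>2) = ennreal (LINT z|circle. (norm (rep_L2 (x - y) z))\<^sup>2)"
    by (simp only: of_real_eq_iff)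
  also have "\<dots> = (\<integral>\<^sup>+z. ennreal ((norm (rep_L2 (x - y) z))\<^sup>2) \<partial>circle)"
    using square_integrable_rep_L2[of "x - y"]
    by (intro nn_integral_eq_integral[symmetric]) (auto simp: square_integrable_def)
  also have "\<dots> = (\<integral>\<^sup>+z. ennreal ((norm (rep_L2 x z - rep_L2 y z))\<^sup>2) \<partial>circle)"
    using rep_diff_L2[of x y] by (intro nn_integral_cong_AE) (auto elim: eventually_mono)
  finally show ?thesis .
qed

text \<open>The argument of Riesz and Fischer.  A subsequence \<open>g\<close> with steps of norm less than \<open>4\<^sup>-\<^sup>n\<close> converges
  almost everywhere, and Fatou's lemma transfers the Cauchy estimate to the pointwise limit \<open>L\<close>.\<close>

lemma Cauchy_convergent_L2:
  fixes X :: "nat \<Rightarrow> ('a::{complex_inner, complete_space}) L2"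
  assumes X: "Cauchy X"
  shows "convergent X"
proof -
  have CauchyX: "\<exists>N. \<forall>m\<ge>N. \<forall>n\<ge>N. norm (X m - X n) < e" if "0 < e" for e
    using X that unfolding Cauchy_def dist_norm by blast
  have "\<exists>N. \<forall>i\<ge>N. \<forall>j\<ge>N. norm (X i - X j) < (1/4) ^ n" for n :: nat
    by (rule CauchyX) simp
  then obtain M where M: "\<And>n i j. M n \<le> i \<Longrightarrow> M n \<le> j \<Longrightarrow> norm (X i - X j) < (1/4) ^ n"
    by metis
  define r where "r n = (\<Sum>k\<le>n. Suc (M k))" for n
  have rM: "M n \<le> r n" for n
    using member_le_sum[of n "{..n}" "\<lambda>k. Suc (M k)"] by (simp add: r_def)
  have rSuc: "M n \<le> r (Suc n)" for n
    using rM[of n] by (simp add: r_def)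
  have rn: "n \<le> r n" for n
    by (induction n) (auto simp: r_def)
  define g where "g n = rep_L2 (X (r n))" for n
  have g: "circle_measurable (g n)" for n
    by (simp add: g_def circle_measurable_rep_L2)
  have meas: "(\<lambda>z. ennreal (c * (norm (g (Suc n) z - g n z))\<^sup>2)) \<in> borel_measurable circle" for n c
    by (intro measurable_compose[OF _ measurable_ennreal] borel_measurable_times
        borel_measurable_const borel_measurable_power borel_measurable_norm_diff g)
  \<comment> \<open>The weights \<open>4\<^sup>n\<close> turn finiteness of \<open>F z\<close> into steps bounded by a multiple of \<open>2\<^sup>-\<^sup>n\<close> at \<open>z\<close>.\<close>
  define F where "F z = (\<Sum>n. ennreal (4 ^ n * (norm (g (Suc n) z - g n z))\<^sup>2))" for z
  have [measurable]: "F \<in> borel_measurable circle"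
    unfolding F_def by (intro borel_measurable_suminf_order meas)
  have "(\<integral>\<^sup>+z. F z \<partial>circle) = (\<Sum>n. \<integral>\<^sup>+z. ennreal (4 ^ n * (norm (g (Suc n) z - g n z))\<^sup>2) \<partial>circle)"
    unfolding F_def by (intro nn_integral_suminf meas)
  also have "\<dots> \<le> (\<Sum>n. ennreal ((1/4) ^ n))"
  proof (intro suminf_le summableI)
    fix n
    have "(\<integral>\<^sup>+z. ennreal (4 ^ n * (norm (g (Suc n) z - g n z))\<^sup>2) \<partial>circle)
        = ennreal (4 ^ n) * (\<integral>\<^sup>+z. ennreal ((norm (g (Suc n) z - g n z))\<^sup>2) \<partial>circle)"
      using meas[of 1] by (simp add: ennreal_mult nn_integral_cmult)
    also have "\<dots> = ennreal (4 ^ n * (norm (X (r (Suc n)) - X (r n)))\<^sup>2)"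
      by (simp add: g_def nn_norm_diff_L2 ennreal_mult)
    also have "\<dots> \<le> ennreal ((1/4) ^ n)"
    proof (rule ennreal_leI)
      have "4 ^ n * (norm (X (r (Suc n)) - X (r n)))\<^sup>2 \<le> 4 ^ n * ((1/4) ^ n)\<^sup>2"
        using M[OF rSuc rM, of n] by (intro mult_left_mono power_mono) auto
      also have "\<dots> = (1/4) ^ n"
        by (simp add: power2_eq_square flip: power_mult_distrib)
      finally show "4 ^ n * (norm (X (r (Suc n)) - X (r n)))\<^sup>2 \<le> (1/4) ^ n" .
    qed
    finally show "(\<integral>\<^sup>+z. ennreal (4 ^ n * (norm (g (Suc n) z - g n z))\<^sup>2) \<partial>circle) \<le> ennreal ((1/4) ^ n)" .
  qed
  also have "\<dots> < \<infinity>"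
    by (subst suminf_ennreal_eq[OF _ geometric_sums]) auto
  finally have AE_F: "AE z in circle. F z \<noteq> \<infinity>"
    by (intro nn_integral_PInf_AE) auto
  define A where "A = {z \<in> space circle. F z \<noteq> \<infinity>}"
  have A[measurable]: "A \<in> sets circle"
    unfolding A_def by measurable
  have "Cauchy (\<lambda>n. g n z)" if zA: "z \<in> A" for z
  proof -
    obtain c where c: "F z = ennreal c" "0 \<le> c"
      using zA by (cases "F z") (auto simp: A_def)
    have "dist (g (Suc n) z) (g n z) \<le> sqrt c * (1/2) ^ n" for n
    proof -
      have "ennreal (4 ^ n * (norm (g (Suc n) z - g n z))\<^sup>2) \<le> F z"
        unfolding F_def using sum_le_suminf[OF summableI, of "{n}"] by simp
      then have "4 ^ n * (norm (g (Suc n) z - g n z))\<^sup>2 \<le> c"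
        using c by simp
      moreover have "(4::real) ^ n = (2 ^ n)\<^sup>2"
        by (simp add: power2_eq_square flip: power_mult_distrib)
      ultimately have "(2 ^ n * norm (g (Suc n) z - g n z))\<^sup>2 \<le> (sqrt c)\<^sup>2"
        using c by (simp add: power_mult_distrib)
      then have "2 ^ n * norm (g (Suc n) z - g n z) \<le> sqrt c"
        by (rule power2_le_imp_le) (use c in simp)
      then show ?thesis
        by (simp add: dist_norm field_simps)
    qed
    then show ?thesis
      by (rule Cauchy_geometric_steps(2)) simp_all
  qed
  then have conv: "\<exists>l. (\<lambda>n. g n z) \<longlonglongrightarrow> l" if "z \<in> A" for z
    using that unfolding convergent_def[symmetric] by (blast intro: Cauchy_convergent)
  define L where "L z = (if z \<in> A then lim (\<lambda>n. g n z) else 0)" for z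
  have gL: "(\<lambda>n. g n z) \<longlonglongrightarrow> L z" if "z \<in> A" for z
    using conv[OF that] that by (simp add: L_def convergent_LIMSEQ_iff[symmetric] convergent_def)
  have L: "circle_measurable L"
    unfolding circle_measurable_def
  proof (intro conjI allI)
    fix u
    show "(\<lambda>z. cinner (L z) u) \<in> borel_measurable circle"
    proof (rule borel_measurable_LIMSEQ_metric)
      have [measurable]: "(\<lambda>z. cinner (g i z) u) \<in> borel_measurable circle" for i
        using g[of i] by (auto simp: circle_measurable_def)
      show "(\<lambda>z. indicat_real A z *\<^sub>R cinner (g i z) u) \<in> borel_measurable circle" for i
        by measurable
      show "(\<lambda>i. indicat_real A z *\<^sub>R cinner (g i z) u) \<longlonglongrightarrow> cinner (L z) u" for z
      proof (cases "z \<in> A")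
        case True
        have "(\<lambda>i. cinner (g i z) u) \<longlonglongrightarrow> cinner (L z) u"
          by (rule continuous_on_tendsto_compose[OF continuous_on_cinner_left gL[OF True]]) auto
        with True show ?thesis
          by simp
      qed (simp add: L_def)
    qed
  next
    have "\<forall>n. \<exists>D. countable D \<and> range (g n) \<subseteq> closure D"
      using g by (auto simp: circle_measurable_def)
    then obtain D where D: "\<And>n. countable (D n)" "\<And>n. range (g n) \<subseteq> closure (D n)"
      by metis
    let ?D = "insert 0 (\<Union>n. D n)"
    have "L z \<in> closure ?D" for z
    proof (cases "z \<in> A")
      case True
      have "g n z \<in> closure ?D" for n
        using D(2)[of n] closure_mono[of "D n" ?D] by blast
      then show ?thesis
        using gL[OF True] by (rule closed_sequentially[OF closed_closure])
    next
      case False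
      then show ?thesis
        using closure_subset[of ?D] by (auto simp: L_def)
    qed
    then show "\<exists>D. countable D \<and> range L \<subseteq> closure D"
      using D(1) by (intro exI[of _ ?D]) auto
  qed
  have le: "(\<integral>\<^sup>+z. ennreal ((norm (L z - rep_L2 (X n) z))\<^sup>2) \<partial>circle) \<le> ennreal (e\<^sup>2)"
    if N: "\<And>m n. N \<le> m \<Longrightarrow> N \<le> n \<Longrightarrow> norm (X m - X n) < e" and n: "N \<le> n" for e N n
  proof -
    have meas': "(\<lambda>z. ennreal ((norm (g m z - rep_L2 (X n) z))\<^sup>2)) \<in> borel_measurable circle" for m
      by (intro measurable_compose[OF _ measurable_ennreal] borel_measurable_power
          borel_measurable_norm_diff g circle_measurable_rep_L2)
    have "(\<integral>\<^sup>+z. ennreal ((norm (L z - rep_L2 (X n) z))\<^sup>2) \<partial>circle)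
        = (\<integral>\<^sup>+z. liminf (\<lambda>m. ennreal ((norm (g m z - rep_L2 (X n) z))\<^sup>2)) \<partial>circle)"
    proof (rule nn_integral_cong_AE)
      show "AE z in circle. ennreal ((norm (L z - rep_L2 (X n) z))\<^sup>2)
          = liminf (\<lambda>m. ennreal ((norm (g m z - rep_L2 (X n) z))\<^sup>2))"
        using AE_F
      proof eventually_elim
        case (elim z)
        then have "z \<in> A"
          by (simp add: A_def)
        then have "(\<lambda>m. ennreal ((norm (g m z - rep_L2 (X n) z))\<^sup>2))
            \<longlonglongrightarrow> ennreal ((norm (L z - rep_L2 (X n) z))\<^sup>2)"
          by (intro tendsto_ennrealI tendsto_intros gL)
        then show ?case
          by (metis lim_imp_Liminf sequentially_bot)
      qed
    qed
    also have "\<dots> \<le> liminf (\<lambda>m. \<integral>\<^sup>+z. ennreal ((norm (g m z - rep_L2 (X n) z))\<^sup>2) \<partial>circle)"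
      by (intro nn_integral_liminf meas')
    also have "\<dots> = liminf (\<lambda>m. ennreal ((norm (X (r m) - X n))\<^sup>2))"
      by (simp add: g_def nn_norm_diff_L2)
    also have "\<dots> \<le> liminf (\<lambda>m. ennreal (e\<^sup>2))"
    proof (rule Liminf_mono)
      have "ennreal ((norm (X (r m) - X n))\<^sup>2) \<le> ennreal (e\<^sup>2)" if "N \<le> m" for m
        using N[of "r m" n] n rn[of m] that by (intro ennreal_leI power_mono) auto
      then show "\<forall>\<^sub>F m in sequentially. ennreal ((norm (X (r m) - X n))\<^sup>2) \<le> ennreal (e\<^sup>2)"
        by (auto simp: eventually_sequentially)
    qed
    also have "\<dots> = ennreal (e\<^sup>2)"
      by (simp add: Liminf_const)
    finally show ?thesis .
  qed
  obtain N1 where N1: "\<And>m n. N1 \<le> m \<Longrightarrow> N1 \<le> n \<Longrightarrow> norm (X m - X n) < 1"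
    using CauchyX[OF zero_less_one] by blast
  have "square_integrable (\<lambda>z. L z - rep_L2 (X N1) z)"
    unfolding square_integrable_def
  proof
    show *: "circle_measurable (\<lambda>z. L z - rep_L2 (X N1) z)"
      by (intro circle_measurable_diff L circle_measurable_rep_L2)
    show "integrable circle (\<lambda>z. (norm (L z - rep_L2 (X N1) z))\<^sup>2)"
    proof (rule integrableI_nonneg)
      show "(\<integral>\<^sup>+z. ennreal ((norm (L z - rep_L2 (X N1) z))\<^sup>2) \<partial>circle) < \<infinity>"
        by (rule le_less_trans[OF le[OF N1 order_refl]]) simp_all
    qed (use circle_measurable_norm[OF *] in auto)
  qed
  from square_integrable_add[OF this square_integrable_rep_L2[of "X N1"]]
  have sqL: "square_integrable L"
    by simp
  have "X \<longlonglongrightarrow> abs_L2 L"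
  proof (rule metric_LIMSEQ_I)
    fix e :: real assume e: "0 < e"
    then obtain N where N: "\<And>m n. N \<le> m \<Longrightarrow> N \<le> n \<Longrightarrow> norm (X m - X n) < e / 2"
      using CauchyX[OF half_gt_zero[OF e]] by blast
    have "dist (X n) (abs_L2 L) < e" if "N \<le> n" for n
    proof -
      have "ennreal ((norm (abs_L2 L - X n))\<^sup>2) = (\<integral>\<^sup>+z. ennreal ((norm (L z - rep_L2 (X n) z))\<^sup>2) \<partial>circle)"
        unfolding nn_norm_diff_L2
        using rep_abs_L2[OF sqL] by (intro nn_integral_cong_AE) (auto elim: eventually_mono)
      also have "\<dots> \<le> ennreal ((e / 2)\<^sup>2)"
        by (rule le[OF N that])
      finally have "(norm (abs_L2 L - X n))\<^sup>2 \<le> (e / 2)\<^sup>2"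
        by (subst (asm) ennreal_le_iff) auto
      then have "norm (abs_L2 L - X n) \<le> e / 2"
        by (rule power2_le_imp_le) (use e in simp)
      then show ?thesis
        using e by (simp add: dist_norm norm_minus_commute)
    qed
    then show "\<exists>N. \<forall>n\<ge>N. dist (X n) (abs_L2 L) < e"
      by blast
  qed
  then show ?thesis
    by (rule convergentI)
qed

instance L2 :: ("{complex_inner, complete_space}") complete_space
  by standard (rule Cauchy_convergent_L2)

lemma values_in_iff: "values_in f K \<longleftrightarrow> (AE z in circle. rep_L2 f z \<in> K)"
  by (simp add: values_in.rep_eq)

text \<open>The distance of \<open>f z\<close> to \<open>K\<close> is at most \<open>\<parallel>f z - X n z\<parallel>\<close> for almost all \<open>z\<close>; as
  \<open>X n\<close> tends to \<open>f\<close>, its \<open>L\<^sup>2\<close> norm vanishes.\<close>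

lemma closed_L2_on:
  assumes K: "closed K" "K \<noteq> {}"
  shows "closed (L2_on K)"
  unfolding closed_sequential_limits
proof (intro allI impI)
  fix X f assume "(\<forall>n. X n \<in> L2_on K) \<and> X \<longlonglongrightarrow> f"
  then have XK: "\<And>n. AE z in circle. rep_L2 (X n) z \<in> K" and X: "X \<longlonglongrightarrow> f"
    by (auto simp: L2_on_def values_in_iff)
  have [measurable]: "(\<lambda>z. infdist (rep_L2 f z) K) \<in> borel_measurable circle"
    by (rule measurable_compose[OF circle_measurable_borel[OF circle_measurable_rep_L2]])
      (intro borel_measurable_continuous_onI continuous_intros)
  have le: "(\<integral>\<^sup>+z. ennreal ((infdist (rep_L2 f z) K)\<^sup>2) \<partial>circle) \<le> ennreal ((norm (f - X n))\<^sup>2)" for n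
    unfolding nn_norm_diff_L2
  proof (rule nn_integral_mono_AE)
    show "AE z in circle. ennreal ((infdist (rep_L2 f z) K)\<^sup>2)
        \<le> ennreal ((norm (rep_L2 f z - rep_L2 (X n) z))\<^sup>2)"
      using XK[of n]
    proof eventually_elim
      case (elim z)
      then show ?case
        using infdist_le[OF elim, of "rep_L2 f z"]
        by (intro ennreal_leI power_mono) (simp_all add: dist_norm infdist_nonneg)
    qed
  qed
  have "(\<lambda>n. ennreal ((norm (f - X n))\<^sup>2)) \<longlonglongrightarrow> ennreal ((norm (f - f))\<^sup>2)"
    by (intro tendsto_ennrealI tendsto_intros X)
  then have "(\<integral>\<^sup>+z. ennreal ((infdist (rep_L2 f z) K)\<^sup>2) \<partial>circle) \<le> ennreal ((norm (f - f))\<^sup>2)"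
    using le by (intro LIMSEQ_le_const) auto
  then have "AE z in circle. ennreal ((infdist (rep_L2 f z) K)\<^sup>2) = 0"
    by (simp add: nn_integral_0_iff_AE)
  then have "AE z in circle. rep_L2 f z \<in> K"
    by eventually_elim (simp add: in_closed_iff_infdist_zero[OF K])
  then show "f \<in> L2_on K"
    by (simp add: L2_on_def values_in_iff)
qed

section \<open>Fourier coefficients on the circle\<close>

lemma circle_integral_power_int: "(LINT z|circle. z powi n) = (if n = 0 then 1 else 0)"
proof -
  have pw[measurable]: "(\<lambda>z::complex. z powi n) \<in> borel_measurable borel"
    by (cases "0 \<le> n") (simp_all add: power_int_def)
  have "(LINT z|circle. z powi n) = (LINT t|uniform_measure lborel {0..1}. cis (2 * pi * t) powi n)"
    unfolding circle_def by (rule integral_distr[OF measurable_circle_cis pw])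
  also have "\<dots> = (LINT t|uniform_measure lborel {0..1}. cis (of_int n * (2 * pi * t)))"
    by (simp add: cis_power_int)
  also have "uniform_measure lborel {0..1} = density lborel (\<lambda>t::real. ennreal (indicator {0..1} t))"
    unfolding uniform_measure_def by (intro density_cong) (auto simp: indicator_def)
  also have "(LINT t|density lborel (\<lambda>t::real. ennreal (indicator {0..1} t)). cis (of_int n * (2 * pi * t)))
      = (LINT t|lborel. indicator {0..1} t *\<^sub>R cis (of_int n * (2 * pi * t)))"
  proof (rule integral_density)
    show "(\<lambda>t. cis (of_int n * (2 * pi * t))) \<in> borel_measurable lborel"
      by (simp, intro borel_measurable_continuous_onI continuous_intros)
  qed auto
  also have "\<dots> = (if n = 0 then 1 else 0)"
  proof (cases "n = 0")
    case False
    define c where "c = 2 * pi * of_int n"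
    have c: "c \<noteq> 0"
      using False by (simp add: c_def)
    define G where "G t = cis (c * t) / (\<i> * complex_of_real c)" for t
    have "(LINT t|lborel. indicator {0..1} t *\<^sub>R cis (c * t)) = G 1 - G 0"
    proof (rule integral_FTC_atLeastAtMost)
      fix t :: real
      show "(G has_vector_derivative cis (c * t)) (at t within {0..1})"
        unfolding G_def has_vector_derivative_def using c
        by (auto intro!: derivative_eq_intros simp: scaleR_conv_of_real fun_eq_iff complex_eq_iff)
    qed (auto intro!: continuous_intros)
    also have "G 1 = G 0"
    proof -
      have "cis c = 1"
        using cis_multiple_2pi[of "of_int n"] by (simp add: c_def)
      then show ?thesis
        by (simp add: G_def)
    qed
    finally show ?thesis
      using False by (simp add: c_def mult_ac)
  qed simp
  finally show ?thesis .
qed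

lemma cnj_unit: "cmod z = 1 \<Longrightarrow> cnj z = inverse z"
  by (simp add: inverse_complex_def complex_eq_iff cmod_power2[symmetric])

lemma cnj_power_int_unit:
  assumes "cmod z = 1"
  shows "cnj (z powi n) = z powi (- n)"
  using assms cnj_unit[of "z powi n"] by (simp only: norm_power_int power_int_1_left power_int_minus)

lemma borel_measurable_power_int_circle [measurable]: "(\<lambda>z. z powi n) \<in> borel_measurable circle"
  by (cases "0 \<le> n") (simp_all add: power_int_def)

lemma integrable_circle_bounded_mult:
  fixes g h :: "complex \<Rightarrow> complex"
  assumes g: "integrable circle g" and h[measurable]: "h \<in> borel_measurable circle"
    and b: "AE z in circle. cmod (h z) \<le> b"
  shows "integrable circle (\<lambda>z. g z * h z)"
proof (rule Bochner_Integration.integrable_bound)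
  show "integrable circle (\<lambda>z. b * cmod (g z))"
    using g by simp
  show "(\<lambda>z. g z * h z) \<in> borel_measurable circle"
    using g by measurable
  show "AE z in circle. norm (g z * h z) \<le> norm (b * cmod (g z))"
    using b
  proof eventually_elim
    case (elim z)
    then have "cmod (h z) \<le> \<bar>b\<bar>"
      by simp
    then show ?case
      using mult_right_mono[of "cmod (h z)" "\<bar>b\<bar>" "cmod (g z)"] by (simp add: norm_mult abs_mult mult.commute)
  qed
qed

lemma AE_circle_power_int: "AE z in circle. cmod (z powi n) \<le> 1"
  using AE_circle by eventually_elim (simp add: norm_power_int)

lemma borel_measurable_continuous_circle:
  "continuous_on UNIV p \<Longrightarrow> p \<in> borel_measurable circle"
  using borel_measurable_continuous_onI[of p] by simp

text \<open>On the circle a real linear functional has the form \<open>a z + b z\<^sup>-\<^sup>1\<close>.  Multiplication by it mixes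
  neighbouring Fourier coefficients, so it keeps all of them zero; polynomials are built from such
  steps.  Hence the induction has to run over all \<open>g\<close>.\<close>

lemma fourier_zero_mult_polynomial:
  fixes g :: "complex \<Rightarrow> complex"
  assumes "real_polynomial_function p"
    and "integrable circle g" "\<And>n. (LINT z|circle. g z * z powi n) = 0"
  shows "integrable circle (\<lambda>z. g z * of_real (p z)) \<and>
    (\<forall>n. (LINT z|circle. g z * of_real (p z) * z powi n) = 0)"
  using assms
proof (induction arbitrary: g)
  case (linear l)
  have int: "integrable circle (\<lambda>z. g z * z powi n)" for n
    by (rule integrable_circle_bounded_mult[OF linear(2) _ AE_circle_power_int]) measurable
  interpret l: bounded_linear l by fact
  define a where "a = Complex (l 1 / 2) (- l \<i> / 2)"
  define b where "b = Complex (l 1 / 2) (l \<i> / 2)"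
  have lz: "complex_of_real (l z) = a * z + b * inverse z" if "cmod z = 1" for z
  proof -
    have "l z = l (Re z *\<^sub>R 1 + Im z *\<^sub>R \<i>)"
      by (rule arg_cong[where f = l]) (simp add: complex_eq_iff)
    also have "\<dots> = Re z * l 1 + Im z * l \<i>"
      by (simp only: l.add l.scaleR real_scaleR_def)
    finally have lz: "l z = Re z * l 1 + Im z * l \<i>" .
    have inv: "inverse z = cnj z"
      using cnj_unit[OF that] by simp
    show ?thesis
      unfolding inv lz by (simp add: a_def b_def complex_eq_iff algebra_simps)
  qed
  have [measurable]: "l \<in> borel_measurable circle"
    by (rule borel_measurable_continuous_circle) (rule l.continuous_on, rule continuous_on_id)
  have [measurable]: "g \<in> borel_measurable circle"
    using linear(2) by simp
  have ae: "AE z in circle. g z * of_real (l z) * z powi n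
      = a * (g z * z powi (n + 1)) + b * (g z * z powi (n - 1))" for n
    using AE_circle
  proof eventually_elim
    case (elim z)
    then have "z \<noteq> 0"
      by auto
    then show ?case
      by (simp add: lz[OF elim] power_int_add power_int_diff field_simps)
  qed
  have int': "integrable circle (\<lambda>z. a * (g z * z powi (n + 1)) + b * (g z * z powi (n - 1)))" for n
    by (intro Bochner_Integration.integrable_add integrable_mult_right int)
  have "integrable circle (\<lambda>z. g z * of_real (l z) * z powi 0)"
    by (subst integrable_cong_AE[OF _ _ ae]) (use int'[of 0] in measurable)
  moreover have "(LINT z|circle. g z * of_real (l z) * z powi n) = 0" for n
  proof -
    have "(LINT z|circle. g z * of_real (l z) * z powi n)
        = (LINT z|circle. a * (g z * z powi (n + 1)) + b * (g z * z powi (n - 1)))"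
      by (rule integral_cong_AE[OF _ _ ae]) measurable
    also have "\<dots> = 0"
      by (subst Bochner_Integration.integral_add) (simp_all add: int linear(3))
    finally show ?thesis .
  qed
  ultimately show ?case
    by simp
next
  case (const c)
  have "(LINT z|circle. g z * of_real c * z powi n) = (LINT z|circle. of_real c * (g z * z powi n))" for n
    by (simp add: mult_ac)
  with const show ?case
    by simp
next
  case (add p q)
  have int: "integrable circle (\<lambda>z. g z * of_real (p z) * z powi n)"
    "integrable circle (\<lambda>z. g z * of_real (q z) * z powi n)" for n
    using add.IH[OF add.prems]
    by (auto intro!: integrable_circle_bounded_mult[OF _ _ AE_circle_power_int])
  have "(LINT z|circle. g z * of_real (p z + q z) * z powi n)
      = (LINT z|circle. g z * of_real (p z) * z powi n + g z * of_real (q z) * z powi n)" for n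
    by (simp add: algebra_simps)
  also have "\<dots> n = 0" for n
    using add.IH[OF add.prems] int by (subst Bochner_Integration.integral_add) auto
  finally have "\<forall>n. (LINT z|circle. g z * of_real (p z + q z) * z powi n) = 0"
    by blast
  moreover have "integrable circle (\<lambda>z. g z * of_real (p z) + g z * of_real (q z))"
    using add.IH[OF add.prems] by (intro Bochner_Integration.integrable_add) auto
  ultimately show ?case
    by (simp add: distrib_left)
next
  case (mult p q)
  have "integrable circle (\<lambda>z. g z * of_real (p z) * of_real (q z)) \<and>
    (\<forall>n. (LINT z|circle. g z * of_real (p z) * of_real (q z) * z powi n) = 0)"
    using mult.IH(1)[OF mult.prems] by (intro mult.IH(2)) auto
  then show ?case
    by (simp add: mult.assoc)
qed

text \<open>Polynomials are uniformly dense in the continuous functions on the circle.\<close>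

lemma fourier_zero_imp_integral_continuous_zero:
  fixes f :: "complex \<Rightarrow> complex" and h :: "complex \<Rightarrow> real"
  assumes f: "integrable circle f" and z: "\<And>n. (LINT z|circle. f z * z powi n) = 0"
    and h: "continuous_on UNIV h"
  shows "(LINT z|circle. f z * of_real (h z)) = 0"
proof -
  define N where "N = (LINT z|circle. cmod (f z))"
  have N: "0 \<le> N"
    by (simp add: N_def)
  have [measurable]: "h \<in> borel_measurable circle"
    by (rule borel_measurable_continuous_circle[OF h])
  have le: "cmod (LINT z|circle. f z * of_real (h z)) \<le> e * N" if e: "0 < e" for e
  proof -
    obtain p where p: "real_polynomial_function p" "\<And>z. z \<in> sphere 0 1 \<Longrightarrow> \<bar>h z - p z\<bar> < e"
      using Stone_Weierstrass_real_polynomial_function[OF compact_sphere continuous_on_subset[OF h] e]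
      by blast
    have pc: "continuous_on UNIV p"
      using p(1) by (simp add: continuous_on_polymonial_function real_polynomial_function_eq)
    have [measurable]: "p \<in> borel_measurable circle"
      by (rule borel_measurable_continuous_circle[OF pc])
    have ae: "AE z in circle. cmod (of_real (h z - p z)) \<le> e"
      using AE_circle
    proof eventually_elim
      case (elim z)
      then have "\<bar>h z - p z\<bar> \<le> e"
        using p(2)[of z] by simp
      then show ?case
        by (simp only: norm_of_real)
    qed
    have int: "integrable circle (\<lambda>z. f z * of_real (p z))" "(LINT z|circle. f z * of_real (p z)) = 0"
      using fourier_zero_mult_polynomial[OF p(1) f z] by (auto dest: spec[of _ 0])
    have int2: "integrable circle (\<lambda>z. f z * of_real (h z - p z))"
      by (rule integrable_circle_bounded_mult[OF f _ ae]) measurable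
    have "(LINT z|circle. f z * of_real (h z)) = (LINT z|circle. f z * of_real (h z - p z) + f z * of_real (p z))"
      by (simp add: algebra_simps)
    also have "\<dots> = (LINT z|circle. f z * of_real (h z - p z))"
      using int int2 by simp
    also have "cmod \<dots> \<le> (LINT z|circle. cmod (f z * of_real (h z - p z)))"
      by (rule integral_norm_bound)
    also have "\<dots> \<le> (LINT z|circle. e * cmod (f z))"
    proof (rule integral_mono_AE)
      show "AE z in circle. cmod (f z * of_real (h z - p z)) \<le> e * cmod (f z)"
        using ae
      proof eventually_elim
        case (elim z)
        then show ?case
          using mult_left_mono[OF elim, of "cmod (f z)"] by (simp only: norm_mult norm_ge_zero mult.commute)
      qed
    qed (use int2 f in auto)
    also have "\<dots> = e * N"
      by (simp add: N_def)
    finally show ?thesis .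
  qed
  have "cmod (LINT z|circle. f z * of_real (h z)) \<le> 0"
  proof (rule field_le_epsilon)
    fix e :: real assume e: "0 < e"
    have "cmod (LINT z|circle. f z * of_real (h z)) \<le> (e / (N + 1)) * N"
      by (rule le) (use e N in simp)
    also have "\<dots> \<le> 0 + e"
      using e N by (simp add: field_simps)
    finally show "cmod (LINT z|circle. f z * of_real (h z)) \<le> 0 + e" .
  qed
  then show ?thesis
    by simp
qed

text \<open>The indicator of a closed set is a bounded pointwise limit of the continuous functions \<open>h n\<close>.\<close>

lemma fourier_zero_imp_integral_closed_zero:
  fixes f :: "complex \<Rightarrow> complex"
  assumes f: "integrable circle f" and z: "\<And>n. (LINT z|circle. f z * z powi n) = 0"
    and F: "closed F"
  shows "(LINT z|circle. indicat_real F z *\<^sub>R f z) = 0"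
proof (cases "F = {}")
  case False
  define h where "h n z = max 0 (1 - real n * infdist z F)" for n z
  have hc: "continuous_on UNIV (h n)" for n
    unfolding h_def by (intro continuous_intros)
  have [measurable]: "h n \<in> borel_measurable circle" for n
    by (rule borel_measurable_continuous_circle[OF hc])
  have Fs: "F \<in> sets circle"
    using F by simp
  have "(\<lambda>n. LINT z|circle. f z * of_real (h n z)) \<longlonglongrightarrow> (LINT z|circle. indicat_real F z *\<^sub>R f z)"
  proof (rule integral_dominated_convergence)
    show "integrable circle (\<lambda>z. cmod (f z))"
      using f by simp
    show "(\<lambda>z. indicat_real F z *\<^sub>R f z) \<in> borel_measurable circle"
      using integrable_mult_indicator[OF Fs f] by simp
    show "(\<lambda>z. f z * of_real (h n z)) \<in> borel_measurable circle" for n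
      using f by measurable
    have "norm (f z * of_real (h n z)) \<le> cmod (f z)" for n z
    proof -
      have "0 \<le> real n * infdist z F"
        by (simp add: infdist_nonneg)
      then have "\<bar>h n z\<bar> \<le> 1"
        by (auto simp: h_def)
      then show ?thesis
        by (simp add: norm_mult mult_left_le)
    qed
    then show "AE z in circle. norm (f z * of_real (h n z)) \<le> cmod (f z)" for n
      by simp
    have "(\<lambda>n. f z * of_real (h n z)) \<longlonglongrightarrow> indicat_real F z *\<^sub>R f z" for z
    proof (cases "z \<in> F")
      case True
      then show ?thesis
        by (simp add: h_def)
    next
      case False
      then have pos: "0 < infdist z F"
        using in_closed_iff_infdist_zero[OF F \<open>F \<noteq> {}\<close>, of z] infdist_nonneg[of z F] by linarith
      obtain N where N: "1 < real N * infdist z F"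
        using reals_Archimedean3[OF pos] by blast
      have "f z * of_real (h n z) = 0" if "N \<le> n" for n
      proof -
        have "real N * infdist z F \<le> real n * infdist z F"
          using that pos by (intro mult_right_mono) auto
        then show ?thesis
          using N by (simp add: h_def)
      qed
      then have "\<forall>\<^sub>F n in sequentially. f z * of_real (h n z) = 0"
        by (rule eventually_sequentiallyI)
      then show ?thesis
        using False by (simp add: tendsto_eventually)
    qed
    then show "AE z in circle. (\<lambda>n. f z * of_real (h n z)) \<longlonglongrightarrow> indicat_real F z *\<^sub>R f z"
      by simp
  qed
  moreover have "(LINT z|circle. f z * of_real (h n z)) = 0" for n
    by (rule fourier_zero_imp_integral_continuous_zero[OF f z hc])
  ultimately show ?thesis
    by (simp add: LIMSEQ_const_iff)
qed simp

text \<open>Closed sets are stable under intersection and generate the Borel sets, so \<open>f\<close> has integral zero over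
  every Borel set.\<close>

lemma fourier_uniqueness:
  fixes f :: "complex \<Rightarrow> complex"
  assumes f: "integrable circle f" and z: "\<And>n. (LINT z|circle. f z * z powi n) = 0"
  shows "AE z in circle. f z = 0"
proof (rule circle.density_zero[OF f])
  fix A assume "A \<in> sets circle"
  then have A: "A \<in> sigma_sets UNIV (Collect closed)"
    by (simp add: borel_eq_closed)
  have sub: "sigma_sets UNIV (Collect closed) \<subseteq> sets circle"
    by (simp add: borel_eq_closed)
  have "Int_stable (Collect closed :: complex set set)" "Collect closed \<subseteq> Pow (UNIV :: complex set)"
    by (auto simp: Int_stable_def)
  from this A show "set_lebesgue_integral circle A f = 0"
  proof (induction rule: sigma_sets_induct_disjoint)
    case (basic A)
    then show ?case
      using fourier_zero_imp_integral_closed_zero[OF f z, of A] by (simp add: set_lebesgue_integral_def)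
  next
    case (compl A)
    have "(LINT z|circle. indicat_real (UNIV - A) z *\<^sub>R f z)
        = (LINT z|circle. indicat_real UNIV z *\<^sub>R f z - indicat_real A z *\<^sub>R f z)"
      by (intro Bochner_Integration.integral_cong) (auto simp: indicator_def)
    also have "\<dots> = (LINT z|circle. indicat_real UNIV z *\<^sub>R f z) - (LINT z|circle. indicat_real A z *\<^sub>R f z)"
      using compl(1) sub by (intro Bochner_Integration.integral_diff integrable_mult_indicator f) auto
    finally show ?case
      using fourier_zero_imp_integral_closed_zero[OF f z, of UNIV] compl(2)
      by (simp add: set_lebesgue_integral_def)
  next
    case (union A)
    have A: "A i \<in> sets circle" for i
      using union(2) sub by blast
    have "set_integrable circle (\<Union>i. A i) f"
      unfolding set_integrable_def by (intro integrable_mult_indicator f sets.countable_UN) (use A in auto)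
    then have "set_lebesgue_integral circle (\<Union>i. A i) f = (\<Sum>i. set_lebesgue_integral circle (A i) f)"
      using union(1) A by (intro lebesgue_integral_countable_add) (auto simp: disjoint_family_on_def)
    then show ?case
      using union(3) by simp
  qed (simp_all add: set_lebesgue_integral_def)
qed

section \<open>Monomials in \<open>L\<^sup>2\<close>\<close>

lemma square_integrable_monomial: "square_integrable (\<lambda>z. (z powi n) *\<^sub>C v)"
  unfolding square_integrable_def
proof
  show *: "circle_measurable (\<lambda>z. (z powi n) *\<^sub>C v)"
    by (intro circle_measurable_scaleC circle_measurable_const) measurable
  have "integrable circle (\<lambda>z. (norm ((z powi n) *\<^sub>C v))\<^sup>2) \<longleftrightarrow> integrable circle (\<lambda>z. (norm v)\<^sup>2)"
  proof (rule Bochner_Integration.integrable_cong_AE)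
    show "AE z in circle. (norm ((z powi n) *\<^sub>C v))\<^sup>2 = (norm v)\<^sup>2"
      using AE_circle by eventually_elim (simp add: norm_scaleC norm_power_int)
  qed (use circle_measurable_norm[OF *] in auto)
  then show "integrable circle (\<lambda>z. (norm ((z powi n) *\<^sub>C v))\<^sup>2)"
    by simp
qed

lift_definition monomial :: "int \<Rightarrow> 'k::complex_inner \<Rightarrow> 'k L2" is "\<lambda>n v z. (z powi n) *\<^sub>C v"
  by (simp add: L2_rel_def square_integrable_monomial)

lemma rep_monomial: "AE z in circle. rep_L2 (monomial n v) z = (z powi n) *\<^sub>C v"
  unfolding monomial_def map_fun_def comp_def id_def
  by (intro rep_abs_L2 square_integrable_monomial)

lemma rep_const_L2: "AE z in circle. rep_L2 (const_L2 v) z = v"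
  unfolding const_L2_def map_fun_def comp_def id_def
  by (intro rep_abs_L2 square_integrable_const)

lemma rep_mult_id: "AE z in circle. rep_L2 (mult_id f) z = z *\<^sub>C rep_L2 f z"
  unfolding mult_id_def map_fun_def comp_def id_def
  by (intro rep_abs_L2 square_integrable_mult_id square_integrable_rep_L2)

lemma rep_pointwise_mult_id: "AE z in circle. rep_L2 (pointwise_mult_id f) z = mult_id (rep_L2 f z)"
  unfolding pointwise_mult_id_def map_fun_def comp_def id_def
  using square_integrable_rep_L2[of f]
  by (intro rep_abs_L2) (auto simp: square_integrable_def norm_mult_id
      intro: circle_measurable_continuous[OF _ continuous_on_mult_id])

lemma cinner_L2_cong:
  assumes "AE z in circle. cinner (rep_L2 f z) (rep_L2 g z) = cinner (rep_L2 f' z) (rep_L2 g' z)"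
  shows "cinner f g = cinner f' g'"
  unfolding cinner_L2.rep_eq
  by (intro integral_cong_AE circle_measurable_cinner circle_measurable_rep_L2 assms)

lemma cinner_mult_id: "cinner (mult_id f) (mult_id g) = cinner f g"
proof (rule cinner_L2_cong)
  show "AE z in circle. cinner (rep_L2 (mult_id f) z) (rep_L2 (mult_id g) z) = cinner (rep_L2 f z) (rep_L2 g z)"
    using rep_mult_id[of f] rep_mult_id[of g] AE_circle
  proof eventually_elim
    case (elim z)
    have "cnj z * z = 1"
      using elim(3) by (subst mult.commute) (simp add: complex_norm_square[symmetric])
    then show ?case
      unfolding elim(1,2) by (simp add: cinner_scaleC_left cinner_scaleC_right flip: mult.assoc)
  qed
qed

lemma mult_id_add: "mult_id (f + g) = mult_id f + mult_id g"
proof (rule L2_eqI)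
  show "AE z in circle. rep_L2 (mult_id (f + g)) z = rep_L2 (mult_id f + mult_id g) z"
    using rep_mult_id[of f] rep_mult_id[of g] rep_mult_id[of "f + g"] rep_add_L2[of f g]
      rep_add_L2[of "mult_id f" "mult_id g"]
    by eventually_elim (simp add: scaleC_add_right)
qed

lemma mult_id_scaleC: "mult_id (c *\<^sub>C f) = c *\<^sub>C mult_id f"
proof (rule L2_eqI)
  show "AE z in circle. rep_L2 (mult_id (c *\<^sub>C f)) z = rep_L2 (c *\<^sub>C mult_id f) z"
    using rep_mult_id[of f] rep_mult_id[of "c *\<^sub>C f"] rep_scaleC_L2[of c f] rep_scaleC_L2[of c "mult_id f"]
    by eventually_elim (simp add: scaleC_scaleC mult.commute)
qed

lemma bounded_operator_mult_id: "bounded_operator UNIV UNIV mult_id"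
  by (rule bounded_operatorI[where M = 1]) (simp_all add: mult_id_add mult_id_scaleC norm_mult_id)

lemma pointwise_mult_id_add: "pointwise_mult_id (f + g) = pointwise_mult_id f + pointwise_mult_id g"
proof (rule L2_eqI)
  show "AE z in circle. rep_L2 (pointwise_mult_id (f + g)) z = rep_L2 (pointwise_mult_id f + pointwise_mult_id g) z"
    using rep_pointwise_mult_id[of f] rep_pointwise_mult_id[of g] rep_pointwise_mult_id[of "f + g"]
      rep_add_L2[of f g] rep_add_L2[of "pointwise_mult_id f" "pointwise_mult_id g"]
    by eventually_elim (simp add: mult_id_add)
qed

lemma pointwise_mult_id_scaleC: "pointwise_mult_id (c *\<^sub>C f) = c *\<^sub>C pointwise_mult_id f"
proof (rule L2_eqI)
  show "AE z in circle. rep_L2 (pointwise_mult_id (c *\<^sub>C f)) z = rep_L2 (c *\<^sub>C pointwise_mult_id f) z"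
    using rep_pointwise_mult_id[of f] rep_pointwise_mult_id[of "c *\<^sub>C f"] rep_scaleC_L2[of c f]
      rep_scaleC_L2[of c "pointwise_mult_id f"]
    by eventually_elim (simp add: mult_id_scaleC)
qed

lemma norm_pointwise_mult_id: "norm (pointwise_mult_id f) = norm f"
proof -
  have "cinner (pointwise_mult_id f) (pointwise_mult_id f) = cinner f f"
  proof (rule cinner_L2_cong)
    show "AE z in circle. cinner (rep_L2 (pointwise_mult_id f) z) (rep_L2 (pointwise_mult_id f) z)
        = cinner (rep_L2 f z) (rep_L2 f z)"
      using rep_pointwise_mult_id[of f] by eventually_elim (simp add: cinner_mult_id)
  qed
  then show ?thesis
    by (simp add: norm_eq_sqrt_inner flip: Re_cinner)
qed

lemma bounded_operator_pointwise_mult_id: "bounded_operator UNIV UNIV pointwise_mult_id"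
  by (rule bounded_operatorI[where M = 1])
    (simp_all add: pointwise_mult_id_add pointwise_mult_id_scaleC norm_pointwise_mult_id)

lemma const_L2_eq_monomial: "const_L2 v = monomial 0 v"
proof (rule L2_eqI)
  show "AE z in circle. rep_L2 (const_L2 v) z = rep_L2 (monomial 0 v) z"
    using rep_const_L2[of v] rep_monomial[of 0 v] by eventually_elim (simp add: scaleC_one)
qed

lemma mult_id_monomial: "mult_id (monomial n v) = monomial (n + 1) v"
proof (rule L2_eqI)
  show "AE z in circle. rep_L2 (mult_id (monomial n v)) z = rep_L2 (monomial (n + 1) v) z"
    using rep_mult_id[of "monomial n v"] rep_monomial[of n v] rep_monomial[of "n + 1" v] AE_circle
  proof eventually_elim
    case (elim z)
    have "z \<noteq> 0"
      using elim(4) by auto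
    then show ?case
      unfolding elim(1-3) by (simp add: scaleC_scaleC power_int_add mult.commute)
  qed
qed

lemma pointwise_mult_id_monomial: "pointwise_mult_id (monomial n v) = monomial n (mult_id v)"
proof (rule L2_eqI)
  show "AE z in circle. rep_L2 (pointwise_mult_id (monomial n v)) z = rep_L2 (monomial n (mult_id v)) z"
    using rep_pointwise_mult_id[of "monomial n v"] rep_monomial[of n v] rep_monomial[of n "mult_id v"]
    by eventually_elim (simp add: mult_id_scaleC)
qed

lemma cinner_monomial: "cinner f (monomial n v) = (LINT z|circle. cinner (rep_L2 f z) v * cnj (z powi n))"
proof -
  have "cinner f (monomial n v) = (LINT z|circle. cinner (rep_L2 f z) ((z powi n) *\<^sub>C v))"
    unfolding cinner_L2.rep_eq
  proof (rule integral_cong_AE)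
    show "AE z in circle. cinner (rep_L2 f z) (rep_L2 (monomial n v) z) = cinner (rep_L2 f z) ((z powi n) *\<^sub>C v)"
      using rep_monomial[of n v] by eventually_elim simp
  qed (use square_integrable_monomial[of n v] in
      \<open>auto intro!: circle_measurable_cinner circle_measurable_rep_L2 simp: square_integrable_def\<close>)
  then show ?thesis
    by (simp add: cinner_scaleC_right mult.commute)
qed

lemma cinner_monomial_monomial: "cinner (monomial m u) (monomial n v) = (if m = n then cinner u v else 0)"
proof -
  have "cinner (monomial m u) (monomial n v) = (LINT z|circle. cinner u v * z powi (m - n))"
    unfolding cinner_monomial
  proof (rule integral_cong_AE)
    have "circle_measurable (rep_L2 (monomial m u))"
      by (rule circle_measurable_rep_L2)
    then have [measurable]: "(\<lambda>z. cinner (rep_L2 (monomial m u) z) v) \<in> borel_measurable circle"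
      by (auto simp: circle_measurable_def)
    have [measurable]: "(\<lambda>z. cnj (z powi n)) \<in> borel_measurable circle"
      by (rule measurable_compose[where g = cnj and N = borel])
        (measurable, intro borel_measurable_continuous_onI continuous_intros)
    show "(\<lambda>z. cinner (rep_L2 (monomial m u) z) v * cnj (z powi n)) \<in> borel_measurable circle"
      by measurable
    show "AE z in circle. cinner (rep_L2 (monomial m u) z) v * cnj (z powi n) = cinner u v * z powi (m - n)"
      using rep_monomial[of m u] AE_circle
    proof eventually_elim
      case (elim z)
      have z0: "z \<noteq> 0"
        using elim(2) by auto
      then show ?case
        unfolding elim(1) cnj_power_int_unit[OF elim(2)]
        by (simp add: cinner_scaleC_left power_int_diff power_int_minus field_simps)
    qed
  qed measurable
  then show ?thesis
    by (simp add: circle_integral_power_int)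
qed

text \<open>The inner products with the monomials are the Fourier coefficients of the scalar function
  \<open>z \<mapsto> \<langle>f z, v\<rangle>\<close>.\<close>

lemma AE_cinner_eq_0:
  assumes "\<And>n. cinner f (monomial n v) = 0"
  shows "AE z in circle. cinner (rep_L2 f z) v = 0"
proof (rule fourier_uniqueness)
  show int: "integrable circle (\<lambda>z. cinner (rep_L2 f z) v)"
    by (rule square_integrable_cinner[OF square_integrable_rep_L2 square_integrable_const])
  fix n
  have [measurable]: "(\<lambda>z. cnj (z powi (-n))) \<in> borel_measurable circle"
    by (rule measurable_compose[where g = cnj and N = borel])
      (measurable, intro borel_measurable_continuous_onI continuous_intros)
  have "(LINT z|circle. cinner (rep_L2 f z) v * z powi n) = (LINT z|circle. cinner (rep_L2 f z) v * cnj (z powi (-n)))"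
  proof (rule integral_cong_AE)
    show "AE z in circle. cinner (rep_L2 f z) v * z powi n = cinner (rep_L2 f z) v * cnj (z powi (-n))"
      using AE_circle
    proof eventually_elim
      case (elim z)
      show ?case
        unfolding cnj_power_int_unit[OF elim] by simp
    qed
  qed (use int in measurable)
  also have "\<dots> = 0"
    using assms[of "-n"] by (simp add: cinner_monomial)
  finally show "(LINT z|circle. cinner (rep_L2 f z) v * z powi n) = 0" .
qed

section \<open>Orthonormal bases\<close>

lemma cinner_sum_left: "cinner (\<Sum>i\<in>F. f i) (y :: 'a::complex_inner) = (\<Sum>i\<in>F. cinner (f i) y)"
  by (induction F rule: infinite_finite_induct) (simp_all add: cinner_add_left)

lemma cinner_sum_right: "cinner y (\<Sum>i\<in>F. f i) = (\<Sum>i\<in>F. cinner y (f i :: 'a::complex_inner))"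
  by (induction F rule: infinite_finite_induct) (simp_all add: cinner_add_right)

lemma ell2_eqI: "(\<And>i. Rep_ell2 x i = Rep_ell2 y i) \<Longrightarrow> x = y"
  by (metis Rep_ell2_inject ext)

lemma cinner_ell2_unit: "cinner x (ell2_unit i) = Rep_ell2 x i"
proof -
  have "cinner x (ell2_unit i) = (\<Sum>\<^sub>\<infinity>j. if j = i then Rep_ell2 x i else 0)"
    unfolding cinner_ell2.rep_eq ell2_unit.rep_eq by (intro infsum_cong) auto
  also have "\<dots> = (\<Sum>\<^sub>\<infinity>j\<in>{i}. if j = i then Rep_ell2 x i else 0)"
    by (rule infsum_cong_neutral) auto
  finally show ?thesis
    by simp
qed

definition orthonormal_basis_on :: "'a::complex_inner set \<Rightarrow> 'j set \<Rightarrow> ('j \<Rightarrow> 'a) \<Rightarrow> bool" where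
  "orthonormal_basis_on X J e \<longleftrightarrow>
     hilbert_subspace X \<and> (\<forall>j\<in>J. e j \<in> X) \<and>
     (\<forall>j\<in>J. \<forall>k\<in>J. cinner (e j) (e k) = (if j = k then 1 else 0)) \<and>
     (\<forall>x\<in>X. (\<forall>j\<in>J. cinner x (e j) = 0) \<longrightarrow> x = 0)"

lemma orthonormal_basis_onD:
  assumes "orthonormal_basis_on X J e"
  shows "hilbert_subspace X" "\<And>j. j \<in> J \<Longrightarrow> e j \<in> X"
    "\<And>j k. j \<in> J \<Longrightarrow> k \<in> J \<Longrightarrow> cinner (e j) (e k) = (if j = k then 1 else 0)"
    "\<And>x. x \<in> X \<Longrightarrow> (\<And>j. j \<in> J \<Longrightarrow> cinner x (e j) = 0) \<Longrightarrow> x = 0"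
  using assms unfolding orthonormal_basis_on_def by simp_all

lemma basis_eqI:
  assumes e: "orthonormal_basis_on X J e" and "x \<in> X" "y \<in> X"
    and "\<And>j. j \<in> J \<Longrightarrow> cinner x (e j) = cinner y (e j)"
  shows "x = y"
proof -
  have "x - y \<in> X"
    by (rule hilbert_subspaceD(6)[OF orthonormal_basis_onD(1)[OF e] assms(2,3)])
  then have "x - y = 0"
    by (rule orthonormal_basis_onD(4)[OF e]) (simp add: cinner_diff_left assms(4))
  then show ?thesis
    by simp
qed

lemma bessel_finite:
  assumes F: "finite F"
    and e: "\<And>j k. j \<in> F \<Longrightarrow> k \<in> F \<Longrightarrow> cinner (e j) (e k) = (if j = k then 1 else 0)"
  shows "(\<Sum>j\<in>F. (cmod (cinner x (e j)))\<^sup>2) \<le> (norm x)\<^sup>2"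
proof -
  define c where "c j = cinner x (e j)" for j
  define y where "y = (\<Sum>j\<in>F. c j *\<^sub>C e j)"
  have ye: "cinner y (e k) = c k" if "k \<in> F" for k
  proof -
    have "cinner y (e k) = (\<Sum>j\<in>F. if j = k then c k else 0)"
      unfolding y_def cinner_sum_left using that e by (intro sum.cong) (auto simp: cinner_scaleC_left)
    then show ?thesis
      using F that by simp
  qed
  have "cinner x y = (\<Sum>j\<in>F. cnj (c j) * cinner x (e j))"
    by (simp add: y_def cinner_sum_right cinner_scaleC_right)
  also have "\<dots> = (\<Sum>j\<in>F. complex_of_real ((cmod (c j))\<^sup>2))"
    by (intro sum.cong refl) (simp only: complex_norm_square c_def mult.commute)
  finally have xy: "cinner x y = complex_of_real (\<Sum>j\<in>F. (cmod (c j))\<^sup>2)"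
    by (simp only: of_real_sum)
  have "cinner y y = (\<Sum>j\<in>F. cnj (c j) * cinner y (e j))"
    by (subst (2) y_def) (simp add: cinner_sum_right cinner_scaleC_right)
  also have "\<dots> = (\<Sum>j\<in>F. complex_of_real ((cmod (c j))\<^sup>2))"
    by (intro sum.cong refl) (simp only: complex_norm_square ye mult.commute)
  finally have "complex_of_real ((norm y)\<^sup>2) = complex_of_real (\<Sum>j\<in>F. (cmod (c j))\<^sup>2)"
    by (simp only: cinner_self of_real_sum)
  then have ny: "(norm y)\<^sup>2 = (\<Sum>j\<in>F. (cmod (c j))\<^sup>2)"
    by (simp only: of_real_eq_iff)
  have "(norm y)\<^sup>2 = cmod (cinner x y)"
    unfolding xy ny[symmetric] by (simp only: norm_of_real abs_power2)
  also have "\<dots> \<le> norm x * norm y"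
    by (rule norm_cinner_le)
  finally have "norm y \<le> norm x"
    by (cases "norm y = 0") (simp_all add: power2_eq_square)
  then have "(norm y)\<^sup>2 \<le> (norm x)\<^sup>2"
    by (intro power_mono) auto
  then show ?thesis
    by (simp only: ny c_def)
qed

text \<open>By Bessel's inequality the coefficient map \<open>G\<close> into \<open>\<ell>\<^sup>2\<close> is bounded.  Its adjoint \<open>G'\<close> exists because
  \<open>X\<close> is complete, and plays the role of the series \<open>\<Sum>j. c j e j\<close>.\<close>

lemma basis_coefficients:
  fixes e :: "'j \<Rightarrow> 'a::complex_inner"
  assumes e: "orthonormal_basis_on X J e"
  obtains G G' where "\<And>x j. Rep_ell2 (G x) j = (if j \<in> J then cinner x (e j) else 0)"
    "\<And>c. G' c \<in> X" "\<And>x c. x \<in> X \<Longrightarrow> cinner (G x) c = cinner x (G' c)"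
    "\<And>c j. j \<in> J \<Longrightarrow> cinner (G' c) (e j) = Rep_ell2 c j"
proof -
  note on = orthonormal_basis_onD(3)[OF e]
  define g where "g x j = (if j \<in> J then cinner x (e j) else 0)" for x j
  have bes: "(\<Sum>j\<in>F. (cmod (g x j))\<^sup>2) \<le> (norm x)\<^sup>2" if "finite F" for F x
  proof -
    have "(\<Sum>j\<in>F. (cmod (g x j))\<^sup>2) = (\<Sum>j\<in>F \<inter> J. (cmod (cinner x (e j)))\<^sup>2)"
      using that by (intro sum.mono_neutral_cong_right) (auto simp: g_def)
    also have "\<dots> \<le> (norm x)\<^sup>2"
      by (rule bessel_finite) (use that on in auto)
    finally show ?thesis .
  qed
  have "(\<lambda>j. (cmod (g x j))\<^sup>2) summable_on UNIV" for x
    by (rule nonneg_bdd_above_summable_on) (use bes in \<open>auto intro!: bdd_aboveI\<close>)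
  then have Rep: "Rep_ell2 (Abs_ell2 (g x)) = g x" for x
    by (intro Abs_ell2_inverse) simp
  have "bounded_operator X UNIV (\<lambda>x. Abs_ell2 (g x))"
  proof (rule bounded_operatorI[where M = 1])
    show "Abs_ell2 (g (x + y)) = Abs_ell2 (g x) + Abs_ell2 (g y)" for x y
      by (rule ell2_eqI) (simp add: plus_ell2.rep_eq Rep, simp add: g_def cinner_add_left)
    show "Abs_ell2 (g (c *\<^sub>C x)) = c *\<^sub>C Abs_ell2 (g x)" for c x
      by (rule ell2_eqI) (simp add: scaleC_ell2.rep_eq Rep, simp add: g_def cinner_scaleC_left)
    have "norm (Abs_ell2 (g x)) \<le> norm x" for x
      by (rule norm_ell2_le) (use bes in \<open>simp_all add: Rep\<close>)
    then show "norm (Abs_ell2 (g x)) \<le> 1 * norm x" for x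
      by simp
  qed simp
  then obtain G' where G': "bounded_operator UNIV X G'"
    "\<And>x c. x \<in> X \<Longrightarrow> c \<in> UNIV \<Longrightarrow> cinner (Abs_ell2 (g x)) c = cinner x (G' c)"
    by (rule adjoint_exists[OF orthonormal_basis_onD(1)[OF e]]) (rule that)
  have coeff: "cinner (G' c) (e j) = Rep_ell2 c j" if j: "j \<in> J" for c j
  proof -
    have "Abs_ell2 (g (e j)) = ell2_unit j"
      by (rule ell2_eqI) (use j on[OF j] in \<open>auto simp: Rep ell2_unit.rep_eq g_def\<close>)
    then have "cinner (e j) (G' c) = cinner (ell2_unit j) c"
      using G'(2)[OF orthonormal_basis_onD(2)[OF e j], of c] by simp
    then have "cinner (G' c) (e j) = cinner c (ell2_unit j)"
      by (metis cinner_commute)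
    then show ?thesis
      by (simp add: cinner_ell2_unit)
  qed
  show ?thesis
  proof (rule that)
    show "Rep_ell2 (Abs_ell2 (g x)) j = (if j \<in> J then cinner x (e j) else 0)" for x j
      by (simp add: Rep g_def)
    show "G' c \<in> X" for c
      by (rule bounded_operatorD(1)[OF G'(1) UNIV_I])
    show "cinner (Abs_ell2 (g x)) c = cinner x (G' c)" if "x \<in> X" for x c
      by (rule G'(2)[OF that UNIV_I])
  qed (rule coeff)
qed

lemma riesz_fischer:
  fixes e :: "'j \<Rightarrow> 'a::complex_inner"
  assumes e: "orthonormal_basis_on X J e" and c: "(\<lambda>j. (cmod (c j))\<^sup>2) summable_on J"
  shows "\<exists>x\<in>X. \<forall>j\<in>J. cinner x (e j) = c j"
proof -
  obtain G :: "'a \<Rightarrow> 'j ell2" and G' where "\<And>x j. Rep_ell2 (G x) j = (if j \<in> J then cinner x (e j) else 0)"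
    and G': "\<And>c. G' c \<in> X" "\<And>x c. x \<in> X \<Longrightarrow> cinner (G x) c = cinner x (G' c)"
      "\<And>c j. j \<in> J \<Longrightarrow> cinner (G' c) (e j) = Rep_ell2 c j"
    by (rule basis_coefficients[OF e]) (rule that)
  define d where "d j = (if j \<in> J then c j else 0)" for j
  have "(\<lambda>j. (cmod (d j))\<^sup>2) summable_on UNIV"
    by (rule summable_on_cong_neutral[THEN iffD1, OF _ _ _ c]) (auto simp: d_def)
  then have "Rep_ell2 (Abs_ell2 d) = d"
    by (intro Abs_ell2_inverse) simp
  then have "\<forall>j\<in>J. cinner (G' (Abs_ell2 d)) (e j) = c j"
    by (simp add: G'(3) d_def)
  then show ?thesis
    using G'(1) by blast
qed

text \<open>\<open>G' (G x)\<close> has the same coefficients as \<open>x\<close>, so \<open>G' G\<close> is the identity and \<open>G\<close> is isometric.\<close>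

lemma parseval:
  fixes e :: "'j \<Rightarrow> 'a::complex_inner"
  assumes e: "orthonormal_basis_on X J e" and x: "x \<in> X"
  shows "((\<lambda>j. (cmod (cinner x (e j)))\<^sup>2) has_sum (norm x)\<^sup>2) J"
proof -
  obtain G :: "'a \<Rightarrow> 'j ell2" and G' where
    G: "\<And>x j. Rep_ell2 (G x) j = (if j \<in> J then cinner x (e j) else 0)"
    and G': "\<And>c. G' c \<in> X" "\<And>x c. x \<in> X \<Longrightarrow> cinner (G x) c = cinner x (G' c)"
      "\<And>c j. j \<in> J \<Longrightarrow> cinner (G' c) (e j) = Rep_ell2 c j"
    by (rule basis_coefficients[OF e]) (rule that)
  have "G' (G x) = x"
    by (rule basis_eqI[OF e G'(1) x]) (simp add: G G'(3))
  then have "cinner (G x) (G x) = cinner x x"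
    using G'(2)[OF x, of "G x"] by simp
  then have "norm (G x) = norm x"
    by (simp add: norm_eq_sqrt_inner flip: Re_cinner)
  then have "((\<lambda>j. (cmod (Rep_ell2 (G x) j))\<^sup>2) has_sum (norm x)\<^sup>2) UNIV"
    using has_sum_infsum[OF ell2_summable[of "G x"]] norm_ell2_sq[of "G x"] by simp
  then show ?thesis
    by (rule has_sum_cong_neutral[THEN iffD1, rotated 3]) (auto simp: G)
qed

text \<open>The projection of \<open>x \<in> X\<close> onto \<open>M \<inter> X\<close> has the same coefficients as \<open>x\<close>.\<close>

lemma basis_dense:
  assumes e: "orthonormal_basis_on X J e"
    and M: "complex_vector.subspace M" "closed M" "\<And>j. j \<in> J \<Longrightarrow> e j \<in> M"
  shows "X \<subseteq> M"
proof
  note X = orthonormal_basis_onD(1)[OF e]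
  fix x assume x: "x \<in> X"
  have N: "hilbert_subspace (M \<inter> X)"
    by (rule hilbert_subspace_closed_subset[OF X])
      (use hilbert_subspaceD[OF X] M in \<open>auto intro!: complex_vector.subspace_inter\<close>)
  have "orth_proj (M \<inter> X) x = x"
  proof (rule basis_eqI[OF e _ x])
    show "orth_proj (M \<inter> X) x \<in> X"
      using orth_proj_in[OF N] by blast
    fix j assume "j \<in> J"
    then show "cinner (orth_proj (M \<inter> X) x) (e j) = cinner x (e j)"
      using cinner_orth_proj[OF N] M(3) orthonormal_basis_onD(2)[OF e] by blast
  qed
  then show "x \<in> M"
    using orth_proj_in[OF N, of x] by simp
qed

text \<open>The form in which density is used: the set where the two operators agree is a closed subspace.\<close>

lemma bounded_operators_eq_on_basis:
  assumes e: "orthonormal_basis_on X J e"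
    and A: "bounded_operator X K A" and B: "bounded_operator X K B"
    and eq: "\<And>j. j \<in> J \<Longrightarrow> A (e j) = B (e j)" and x: "x \<in> X"
  shows "A x = B x"
proof -
  note X = orthonormal_basis_onD(1)[OF e]
  note XX = hilbert_subspaceD[OF X]
  define M where "M = {x \<in> X. A x - B x = 0}"
  have "continuous_on X (\<lambda>x. A x - B x)"
    by (intro continuous_on_diff bounded_operator_continuous_on[OF A XX(1)]
        bounded_operator_continuous_on[OF B XX(1)])
  then have "closed M"
    unfolding M_def by (rule continuous_closed_preimage_constant[OF _ XX(3)])
  moreover have "complex_vector.subspace M"
    unfolding complex_vector.subspace_def M_def
    by (auto simp: XX bounded_operatorD[OF A] bounded_operatorD[OF B]
        bounded_operator_0[OF A XX(1)] bounded_operator_0[OF B XX(1)])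
  ultimately have "X \<subseteq> M"
    using basis_dense[OF e, of M] eq orthonormal_basis_onD(2)[OF e] by (simp add: M_def)
  with x show ?thesis
    by (auto simp: M_def)
qed

section \<open>The trigonometric basis of \<open>L\<^sup>2(T, H\<^sup>2)\<close>\<close>

lemma hilbert_subspace_L2_on:
  fixes K :: "'k::{complex_inner, complete_space} set"
  assumes K: "hilbert_subspace K"
  shows "hilbert_subspace (L2_on K)"
proof -
  note KK = hilbert_subspaceD[OF K]
  have "complete (L2_on K)"
    unfolding complete_eq_closed using closed_L2_on[OF KK(3)] KK(4) by blast
  moreover have "complex_vector.subspace (L2_on K)"
    unfolding complex_vector.subspace_def L2_on_def mem_Collect_eq values_in_iff
  proof (intro conjI ballI allI)
    show "AE z in circle. rep_L2 (0 :: 'k L2) z \<in> K"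
      using rep_zero_L2[where 'k = 'k] by eventually_elim (simp add: KK)
    fix x :: "'k L2" assume x: "x \<in> {f. AE z in circle. rep_L2 f z \<in> K}"
    then show "AE z in circle. rep_L2 (c *\<^sub>C x) z \<in> K" for c
      unfolding mem_Collect_eq using rep_scaleC_L2[of c x] by eventually_elim (simp add: KK)
    fix y :: "'k L2" assume "y \<in> {f. AE z in circle. rep_L2 f z \<in> K}"
    with x show "AE z in circle. rep_L2 (x + y) z \<in> K"
      unfolding mem_Collect_eq using rep_add_L2[of x y] by eventually_elim (simp add: KK)
  qed
  ultimately show ?thesis
    by (simp add: hilbert_subspace_def)
qed

lemma fourier_coeff_cinner_fun: "fourier_coeff (cinner_fun f u) n = cinner f (monomial n u)"
  by transfer (simp add: cinner_scaleC_right mult.commute)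

text \<open>Membership in the Hardy space is orthogonality to the monomials of negative degree, which makes it
  a closed condition and shows how it behaves under multiplication by \<open>z\<close>.\<close>

lemma hardy_iff: "f \<in> hardy K \<longleftrightarrow> f \<in> L2_on K \<and> (\<forall>u\<in>K. \<forall>n<0. cinner f (monomial n u) = 0)"
  by (simp add: hardy_def scalar_hardy_def fourier_coeff_cinner_fun)

lemma closed_cinner_eq_0: "closed {x. cinner x (u :: 'a::complex_inner) = 0}"
  using continuous_closed_preimage_constant[OF continuous_on_cinner_left closed_UNIV] by simp

lemma hilbert_subspace_hardy:
  fixes K :: "'k::{complex_inner, complete_space} set"
  assumes K: "hilbert_subspace K"
  shows "hilbert_subspace (hardy K)"
proof -
  note LL = hilbert_subspaceD[OF hilbert_subspace_L2_on[OF K]]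
  have "complex_vector.subspace (hardy K)"
    unfolding complex_vector.subspace_def by (auto simp: hardy_iff LL cinner_add_left cinner_scaleC_left)
  moreover have "hardy K = L2_on K \<inter> (\<Inter>u\<in>K. \<Inter>n\<in>{..<0}. {f. cinner f (monomial n u) = 0})"
    by (auto simp: hardy_iff)
  then have "closed (hardy K)"
    using LL(3) by (auto intro!: closed_INT closed_cinner_eq_0)
  ultimately show ?thesis
    by (simp add: hilbert_subspace_def complete_eq_closed)
qed

lemma hilbert_subspace_ell2_on: "hilbert_subspace (ell2_on I)"
proof -
  have eq: "ell2_on I = (\<Inter>i\<in>-I. {x. cinner x (ell2_unit i) = 0})"
    by (auto simp: ell2_on_def cinner_ell2_unit)
  have "closed (ell2_on I)"
    unfolding eq by (intro closed_INT ballI closed_cinner_eq_0)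
  moreover have "complex_vector.subspace (ell2_on I)"
    unfolding eq complex_vector.subspace_def by (simp add: cinner_add_left cinner_scaleC_left)
  ultimately show ?thesis
    by (simp add: hilbert_subspace_def complete_eq_closed)
qed

lemma hilbert_subspace_L2_hardy: "hilbert_subspace (L2_hardy I)"
  unfolding L2_hardy_def by (intro hilbert_subspace_L2_on hilbert_subspace_hardy hilbert_subspace_ell2_on)

lemma mult_id_L2_on:
  assumes "complex_vector.subspace K" "f \<in> L2_on K"
  shows "mult_id f \<in> L2_on K"
  using assms(2) unfolding L2_on_def mem_Collect_eq values_in_iff
  using rep_mult_id[of f] by eventually_elim (simp add: complex_vector.subspace_scale[OF assms(1)])

lemma mult_id_hardy:
  assumes K: "complex_vector.subspace K" and f: "f \<in> hardy K"
  shows "mult_id f \<in> hardy K"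
  unfolding hardy_iff
proof (intro conjI ballI allI impI)
  show "mult_id f \<in> L2_on K"
    using mult_id_L2_on[OF K] f by (simp add: hardy_iff)
  fix u and n :: int assume "u \<in> K" "n < 0"
  then show "cinner (mult_id f) (monomial n u) = 0"
    using f cinner_mult_id[of f "monomial (n - 1) u"] by (simp add: hardy_iff mult_id_monomial)
qed

lemma monomial_L2_on:
  assumes "complex_vector.subspace K" "v \<in> K"
  shows "monomial n v \<in> L2_on K"
  unfolding L2_on_def mem_Collect_eq values_in_iff
  using rep_monomial[of n v] by eventually_elim (simp add: complex_vector.subspace_scale[OF assms])

lemma monomial_hardy:
  assumes "complex_vector.subspace K" "v \<in> K" "0 \<le> n"
  shows "monomial n v \<in> hardy K"
  using assms by (auto simp: hardy_iff monomial_L2_on cinner_monomial_monomial)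

lemma bounded_operator_opU: "bounded_operator (L2_hardy I) (L2_hardy I) opU"
proof (rule bounded_operator_into[OF bounded_operator_subset[OF bounded_operator_mult_id]])
  show "opU f \<in> L2_hardy I" if "f \<in> L2_hardy I" for f
    using that unfolding L2_hardy_def
    by (intro mult_id_L2_on hilbert_subspaceD(1) hilbert_subspace_hardy hilbert_subspace_ell2_on)
qed auto

lemma bounded_operator_opS: "bounded_operator (L2_hardy I) (L2_hardy I) opS"
proof (rule bounded_operator_into[OF bounded_operator_subset[OF bounded_operator_pointwise_mult_id]])
  fix f assume "f \<in> L2_hardy I"
  then have "AE z in circle. rep_L2 f z \<in> hardy (ell2_on I)"
    by (simp add: L2_hardy_def L2_on_def values_in_iff)
  then show "opS f \<in> L2_hardy I"
    unfolding L2_hardy_def L2_on_def mem_Collect_eq values_in_iff using rep_pointwise_mult_id[of f]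
    by eventually_elim (simp add: mult_id_hardy hilbert_subspaceD(1)[OF hilbert_subspace_ell2_on])
qed auto

definition trig_vector :: "int \<times> nat \<times> 'i \<Rightarrow> 'i ell2 L2 L2" where
  "trig_vector = (\<lambda>(k, j, i). monomial k (monomial (int j) (ell2_unit i)))"

lemma opU_trig_vector: "opU (trig_vector (k, j, i)) = trig_vector (k + 1, j, i)"
  by (simp add: trig_vector_def mult_id_monomial)

lemma opS_trig_vector: "opS (trig_vector (k, j, i)) = trig_vector (k, Suc j, i)"
  by (simp add: trig_vector_def mult_id_monomial pointwise_mult_id_monomial add.commute)

lemma const_eq_trig_vector: "const_L2 (const_L2 (ell2_unit i)) = trig_vector (0, 0, i)"
  by (simp add: trig_vector_def const_L2_eq_monomial)

lemma ell2_unit_in: "i \<in> I \<Longrightarrow> ell2_unit i \<in> ell2_on I"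
  by (auto simp: ell2_on_def ell2_unit.rep_eq)

text \<open>The coefficients of negative degree vanish for every element of the Hardy space.  So all coordinates
  of \<open>g z\<close> are zero for almost every \<open>z\<close>; the exceptional set is null because \<open>I\<close> is countable.\<close>

lemma hardy_eq_0I:
  fixes I :: "'i set"
  assumes I: "countable I" and g: "g \<in> hardy (ell2_on I)"
    and z: "\<And>j i. i \<in> I \<Longrightarrow> cinner g (monomial (int j) (ell2_unit i)) = 0"
  shows "g = 0"
proof (rule L2_eqI)
  have "cinner g (monomial n (ell2_unit i)) = 0" if "i \<in> I" for n i
    using g z[OF that, of "nat n"] that by (cases "n < 0") (auto simp: hardy_iff ell2_unit_in)
  then have "AE z in circle. \<forall>i\<in>I. cinner (rep_L2 g z) (ell2_unit i) = 0"
    using I by (auto simp: AE_ball_countable intro: AE_cinner_eq_0)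
  moreover have "AE z in circle. rep_L2 g z \<in> ell2_on I"
    using g by (simp add: hardy_iff L2_on_def values_in_iff)
  ultimately show "AE z in circle. rep_L2 g z = rep_L2 0 z"
    using rep_zero_L2[where 'k = "'i ell2"]
  proof eventually_elim
    case (elim z)
    then have "rep_L2 g z = 0"
      by (intro ell2_eqI) (auto simp: cinner_ell2_unit ell2_on_def zero_ell2.rep_eq)
    then show ?case
      using elim by simp
  qed
qed

text \<open>Totality is reduced to one variable at a time: for fixed \<open>j\<close> and \<open>i\<close> all Fourier coefficients of the
  function \<open>l \<mapsto> \<langle>f l, z\<^sup>j \<epsilon>\<^sub>i\<rangle>\<close> vanish, so almost every value \<open>f l\<close> is orthogonal to all \<open>z\<^sup>j \<epsilon>\<^sub>i\<close>, and
  then it is zero.\<close>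

lemma orthonormal_basis_trig_vector:
  fixes I :: "'i set"
  assumes I: "countable I"
  shows "orthonormal_basis_on (L2_hardy I) (UNIV \<times> UNIV \<times> I) trig_vector"
  unfolding orthonormal_basis_on_def
proof (intro conjI ballI impI)
  show "hilbert_subspace (L2_hardy I)"
    by (rule hilbert_subspace_L2_hardy)
  show "trig_vector p \<in> L2_hardy I" if "p \<in> UNIV \<times> UNIV \<times> I" for p
    using that unfolding trig_vector_def L2_hardy_def
    by (auto intro!: monomial_L2_on monomial_hardy hilbert_subspaceD(1) hilbert_subspace_hardy
        hilbert_subspace_ell2_on ell2_unit_in)
  show "cinner (trig_vector p) (trig_vector q) = (if p = q then 1 else 0)" for p q :: "int \<times> nat \<times> 'i"
    by (cases p; cases q) (simp add: trig_vector_def cinner_monomial_monomial cinner_ell2_unit ell2_unit.rep_eq)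
  fix f :: "'i ell2 L2 L2"
  assume f: "f \<in> L2_hardy I" and z: "\<forall>p\<in>UNIV \<times> UNIV \<times> I. cinner f (trig_vector p) = 0"
  show "f = 0"
  proof (rule L2_eqI)
    have "AE l in circle. cinner (rep_L2 f l) (monomial (int j) (ell2_unit i)) = 0" if "i \<in> I" for i j
      using z that by (intro AE_cinner_eq_0) (force simp: trig_vector_def)
    then have "AE l in circle. \<forall>i\<in>I. \<forall>j. cinner (rep_L2 f l) (monomial (int j) (ell2_unit i)) = 0"
      using I by (simp add: AE_ball_countable AE_all_countable)
    moreover have "AE l in circle. rep_L2 f l \<in> hardy (ell2_on I)"
      using f by (simp add: L2_hardy_def L2_on_def values_in_iff)
    ultimately show "AE l in circle. rep_L2 f l = rep_L2 0 l"
      using rep_zero_L2[where 'k = "'i ell2 L2"]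
    proof eventually_elim
      case (elim l)
      then have "rep_L2 f l = 0"
        by (intro hardy_eq_0I[OF I]) auto
      then show ?case
        using elim by simp
    qed
  qed
qed

section \<open>Orbits of frame tuples\<close>

text \<open>A two-sided orbit of an injective map is determined by one of its points.  This avoids computing with
  inverse powers.\<close>

lemma int_orbit_unique:
  fixes u v :: "int \<Rightarrow> 'a"
  assumes inj: "inj_on T H" and H: "\<And>k. u k \<in> H" "\<And>k. v k \<in> H"
    and step: "\<And>k. T (u k) = u (k + 1)" "\<And>k. T (v k) = v (k + 1)" and 0: "u 0 = v 0"
  shows "u k = v k"
proof (induction k rule: int_induct[where k = 0])
  case (step1 i)
  then show ?case
    using step[of i] by simp
next
  case (step2 i)
  have "T (u (i - 1)) = T (v (i - 1))"
    using step[of "i - 1"] step2 by simp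
  then show ?case
    using inj_onD[OF inj] H by blast
qed (rule 0)

definition orbit_vector ::
  "'a set \<Rightarrow> ('a \<Rightarrow> 'a) \<Rightarrow> ('a \<Rightarrow> 'a) \<Rightarrow> ('i \<Rightarrow> 'a) \<Rightarrow> int \<times> nat \<times> 'i \<Rightarrow> 'a" where
  "orbit_vector H T L w = (\<lambda>(k, j, i). op_power_int H T k ((L ^^ j) (w i)))"

lemma op_power_int_step:
  assumes bij: "bij_betw T H H" and x: "x \<in> H"
  shows "op_power_int H T k x \<in> H" "T (op_power_int H T k x) = op_power_int H T (k + 1) x"
proof -
  have T: "T y \<in> H" and inv: "inv_into H T y \<in> H" "T (inv_into H T y) = y" if "y \<in> H" for y
    using bij that by (auto simp: bij_betw_def inv_into_into f_inv_into_f)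
  have pos: "(T ^^ n) x \<in> H" for n
    by (induction n) (simp_all add: x T)
  have neg: "(inv_into H T ^^ n) x \<in> H" for n
    by (induction n) (simp_all add: x inv)
  show "op_power_int H T k x \<in> H"
    by (simp add: op_power_int_def pos neg)
  show "T (op_power_int H T k x) = op_power_int H T (k + 1) x"
  proof (cases "0 \<le> k")
    case True
    then have "nat (k + 1) = Suc (nat k)"
      by simp
    with True show ?thesis
      by (simp add: op_power_int_def)
  next
    case False
    define n where "n = nat (- (k + 1))"
    have n: "nat (- k) = Suc n" "k = - 1 - int n"
      using False by (auto simp: n_def)
    have "T (op_power_int H T k x) = (inv_into H T ^^ n) x"
      using False by (simp add: op_power_int_def n(1) inv(2)[OF neg])
    also have "\<dots> = op_power_int H T (k + 1) x"
      by (cases n) (simp_all add: op_power_int_def n(2) nat_add_distrib)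
    finally show ?thesis .
  qed
qed

lemma invertible_operator_bij:
  assumes "invertible_operator H T"
  shows "bij_betw T H H"
proof -
  obtain B where B: "bounded_operator H H B" "\<And>x. x \<in> H \<Longrightarrow> B (T x) = x \<and> T (B x) = x"
    and T: "bounded_operator H H T"
    using assms unfolding invertible_operator_def by blast
  show ?thesis
    by (rule bij_betw_byWitness[where f' = B])
      (use B bounded_operatorD(1)[OF T] bounded_operatorD(1)[OF B(1)] in auto)
qed

lemma is_op_tupleD:
  assumes "is_op_tuple I (H, T, L, w)"
  shows "countable I" "hilbert_subspace H" "bounded_operator H H T" "bounded_operator H H L"
    "bij_betw T H H" "\<And>x. x \<in> H \<Longrightarrow> T (L x) = L (T x)" "\<And>i. i \<in> I \<Longrightarrow> w i \<in> H"
  using assms invertible_operator_bij[of H T]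
  by (auto simp: separable_hilbert_space_def hilbert_subspace_def invertible_operator_def)

lemma orbit_vector_shift:
  assumes t: "is_op_tuple I (H, T, L, w)" and i: "i \<in> I"
  shows "orbit_vector H T L w (k, j, i) \<in> H"
    and "orbit_vector H T L w (0, 0, i) = w i"
    and "T (orbit_vector H T L w (k, j, i)) = orbit_vector H T L w (k + 1, j, i)"
    and "L (orbit_vector H T L w (k, j, i)) = orbit_vector H T L w (k, Suc j, i)"
proof -
  note D = is_op_tupleD[OF t]
  note L = bounded_operatorD(1)[OF D(4)]
  have Lw: "(L ^^ j) (w i) \<in> H" for j
    by (induction j) (simp_all add: D(7)[OF i] L)
  show in_H: "orbit_vector H T L w (k, j, i) \<in> H" for k j
    unfolding orbit_vector_def prod.case by (rule op_power_int_step(1)[OF D(5) Lw])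
  show "orbit_vector H T L w (0, 0, i) = w i"
    by (simp add: orbit_vector_def op_power_int_def)
  show step: "T (orbit_vector H T L w (k, j, i)) = orbit_vector H T L w (k + 1, j, i)" for k j
    unfolding orbit_vector_def prod.case by (rule op_power_int_step(2)[OF D(5) Lw])
  show "L (orbit_vector H T L w (k, j, i)) = orbit_vector H T L w (k, Suc j, i)"
  \<comment> \<open>Both sides are orbits of \<open>T\<close>, since \<open>L\<close> commutes with \<open>T\<close>, and they agree at \<open>0\<close>.\<close>
  proof (rule int_orbit_unique[where T = T and H = H and k = k])
    show "inj_on T H"
      using D(5) by (simp add: bij_betw_def)
    show "T (L (orbit_vector H T L w (k, j, i))) = L (orbit_vector H T L w (k + 1, j, i))" for k
      by (simp add: D(6)[OF in_H] step)
  qed (simp_all add: in_H L step, simp add: orbit_vector_def op_power_int_def)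
qed

section \<open>Basic tuples\<close>

text \<open>The last three facts are what matters about a basic tuple.  That \<open>N\<close> is invariant under the adjoints
  of \<open>U\<close> and \<open>S\<close> means that its orthogonal complement is invariant under \<open>U\<close> and \<open>S\<close>; therefore
  projecting onto \<open>N\<close> intertwines \<open>U\<close> and \<open>S\<close> with the operators of the tuple.\<close>

lemma basic_tupleD:
  assumes B: "unilateral_basic_tuple I (N, U, A, \<phi>)"
  shows "hilbert_subspace N" "N \<subseteq> L2_hardy I" "is_op_tuple I (N, U, A, \<phi>)"
    "\<And>x. x \<in> L2_hardy I \<Longrightarrow> orth_proj N (opU x) = U (orth_proj N x)"
    "\<And>x. x \<in> L2_hardy I \<Longrightarrow> orth_proj N (opS x) = A (orth_proj N x)"
    "\<And>i. i \<in> I \<Longrightarrow> \<phi> i = orth_proj N (trig_vector (0, 0, i))"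
proof -
  let ?X = "L2_hardy I"
  note X = hilbert_subspace_L2_hardy[of I]
  have t: "is_op_tuple I (N, U, A, \<phi>)"
    and NX: "N \<subseteq> ?X" and red: "opU ` N \<subseteq> N" "adjoint_on ?X opU ` N \<subseteq> N"
    and inv: "adjoint_on ?X opS ` N \<subseteq> N"
    and U: "U = restrict opU N" and A: "A = restrict (\<lambda>f. orth_proj N (opS f)) N"
    and \<phi>: "\<phi> = restrict (\<lambda>i. orth_proj N (const_L2 (const_L2 (ell2_unit i)))) I"
    using B unfolding unilateral_basic_tuple.simps reducing_on_def invariant_under_def by blast+
  show "N \<subseteq> ?X" "is_op_tuple I (N, U, A, \<phi>)"
    by fact+
  show N: "hilbert_subspace N"
    by (rule is_op_tupleD(2)[OF t])
  have PX: "orth_proj N x \<in> ?X" "orth_proj N x \<in> N" for x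
    using orth_proj_in[OF N] NX by blast+
  show "orth_proj N (opU x) = U (orth_proj N x)" if x: "x \<in> ?X" for x
  proof (rule orth_proj_eqI'[OF N])
    show "U (orth_proj N x) \<in> N"
      using red(1) PX(2)[of x] by (auto simp: U)
    fix y assume y: "y \<in> N"
    then have yX: "y \<in> ?X" and Uy: "adjoint_on ?X opU y \<in> N"
      using NX red by auto
    have "cinner (U (orth_proj N x)) y = cinner (opU (orth_proj N x)) y"
      by (simp add: U PX)
    also have "\<dots> = cinner x (adjoint_on ?X opU y)"
      by (simp add: cinner_adjoint_on[OF X bounded_operator_opU PX(1) yX] cinner_orth_proj[OF N Uy])
    also have "\<dots> = cinner (opU x) y"
      by (rule cinner_adjoint_on[OF X bounded_operator_opU x yX, symmetric])
    finally show "cinner (U (orth_proj N x)) y = cinner (opU x) y" .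
  qed
  show "orth_proj N (opS x) = A (orth_proj N x)" if x: "x \<in> ?X" for x
  proof (rule orth_proj_eqI'[OF N])
    show "A (orth_proj N x) \<in> N"
      by (simp add: A PX orth_proj_in[OF N])
    fix y assume y: "y \<in> N"
    then have yX: "y \<in> ?X" and Sy: "adjoint_on ?X opS y \<in> N"
      using NX inv by auto
    have "cinner (A (orth_proj N x)) y = cinner (opS (orth_proj N x)) y"
      by (simp add: A PX cinner_orth_proj[OF N y])
    also have "\<dots> = cinner x (adjoint_on ?X opS y)"
      by (simp add: cinner_adjoint_on[OF X bounded_operator_opS PX(1) yX] cinner_orth_proj[OF N Sy])
    also have "\<dots> = cinner (opS x) y"
      by (rule cinner_adjoint_on[OF X bounded_operator_opS x yX, symmetric])
    finally show "cinner (A (orth_proj N x)) y = cinner (opS x) y" .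
  qed
  show "\<phi> i = orth_proj N (trig_vector (0, 0, i))" if "i \<in> I" for i
    using that by (simp add: \<phi> const_eq_trig_vector)
qed

lemma trig_vector_in:
  assumes "countable I" "i \<in> I"
  shows "trig_vector (k, j, i) \<in> L2_hardy I"
  using orthonormal_basis_onD(2)[OF orthonormal_basis_trig_vector[OF assms(1)]] assms(2) by blast

text \<open>Both families are shifted in the same way by the operators of the basic tuple, in \<open>j\<close> by \<open>A\<close> and in
  \<open>k\<close> by \<open>U\<close>, and they agree at \<open>(0, 0, i)\<close>.\<close>

lemma similar_basic_orbit:
  assumes t: "is_op_tuple I (H, T, L, w)" and B: "unilateral_basic_tuple I (N, U, A, \<phi>)"
    and C: "bounded_operator H N C" and Cw: "\<And>i. i \<in> I \<Longrightarrow> C (w i) = \<phi> i"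
    and CT: "\<And>x. x \<in> H \<Longrightarrow> U (C x) = C (T x)" and CL: "\<And>x. x \<in> H \<Longrightarrow> A (C x) = C (L x)"
    and i: "i \<in> I"
  shows "C (orbit_vector H T L w (k, j, i)) = orth_proj N (trig_vector (k, j, i))"
proof -
  note D = is_op_tupleD[OF t] and BD = basic_tupleD[OF B]
  note orb = orbit_vector_shift[OF t i]
  note trig = trig_vector_in[OF D(1) i]
  have j0: "C (orbit_vector H T L w (0, j, i)) = orth_proj N (trig_vector (0, j, i))" for j
  proof (induction j)
    case 0
    show ?case
      by (simp add: orb Cw[OF i] BD(6)[OF i])
  next
    case (Suc j)
    have "C (orbit_vector H T L w (0, Suc j, i)) = A (C (orbit_vector H T L w (0, j, i)))"
      by (simp add: orb CL)
    also have "\<dots> = orth_proj N (trig_vector (0, Suc j, i))"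
      by (simp add: Suc BD(5)[OF trig, symmetric] opS_trig_vector)
    finally show ?case .
  qed
  show ?thesis
  proof (rule int_orbit_unique[where T = U and H = N and k = k])
    show "inj_on U N"
      using is_op_tupleD(5)[OF BD(3)] by (simp add: bij_betw_def)
    show "C (orbit_vector H T L w (k, j, i)) \<in> N" for k
      by (rule bounded_operatorD(1)[OF C orb(1)])
    show "U (C (orbit_vector H T L w (k, j, i))) = C (orbit_vector H T L w (k + 1, j, i))" for k
      by (simp add: CT orb)
    show "U (orth_proj N (trig_vector (k, j, i))) = orth_proj N (trig_vector (k + 1, j, i))" for k
      by (simp add: BD(4)[OF trig, symmetric] opU_trig_vector)
  qed (simp_all add: j0 orth_proj_in[OF BD(1)])
qed

lemma similar_tuplesE:
  assumes "similar_tuples I (H, T, L, w) (N, U, A, \<phi>)"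
  obtains C where "bounded_operator H N C" "bij_betw C H N" "\<And>i. i \<in> I \<Longrightarrow> C (w i) = \<phi> i"
    "\<And>x. x \<in> H \<Longrightarrow> U (C x) = C (T x)" "\<And>x. x \<in> H \<Longrightarrow> A (C x) = C (L x)"
  using assms by auto

lemma similar_basic_synthesis:
  assumes t: "is_op_tuple I (H, T, L, w)" and B: "unilateral_basic_tuple I (N, U, A, \<phi>)"
    and s: "similar_tuples I (H, T, L, w) (N, U, A, \<phi>)"
  obtains C D where "bounded_operator H N C" "bounded_operator N H D"
    "\<And>x. x \<in> H \<Longrightarrow> D (C x) = x" "\<And>y. y \<in> N \<Longrightarrow> C (D y) = y"
    "\<And>k j i. i \<in> I \<Longrightarrow> D (orth_proj N (trig_vector (k, j, i))) = orbit_vector H T L w (k, j, i)"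
proof -
  obtain C where C: "bounded_operator H N C" "bij_betw C H N" "\<And>i. i \<in> I \<Longrightarrow> C (w i) = \<phi> i"
    "\<And>x. x \<in> H \<Longrightarrow> U (C x) = C (T x)" "\<And>x. x \<in> H \<Longrightarrow> A (C x) = C (L x)"
    using similar_tuplesE[OF s] by blast
  have D: "bounded_operator N H (inv_into H C)"
    by (rule bounded_inverse[OF is_op_tupleD(2)[OF t] basic_tupleD(1)[OF B] C(1,2)])
  have DC: "inv_into H C (C x) = x" if "x \<in> H" for x
    using C(2) that by (simp add: bij_betw_def)
  have CD: "C (inv_into H C y) = y" if "y \<in> N" for y
    using C(2) that by (simp add: bij_betw_def f_inv_into_f)
  show ?thesis
    by (rule that[OF C(1) D DC CD])
      (simp_all add: similar_basic_orbit[OF t B C(1,3,4,5), symmetric] DC orbit_vector_shift(1)[OF t])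
qed

text \<open>With \<open>D'\<close> the adjoint of \<open>D\<close>, the frame coefficients of \<open>f\<close> are the Fourier coefficients of \<open>D' f\<close>, so
  the frame sum is \<open>\<parallel>D' f\<parallel>\<^sup>2\<close>.  It is bounded below because \<open>\<parallel>f\<parallel>\<^sup>2 = \<langle>D C f, f\<rangle> = \<langle>C f, D' f\<rangle>\<close>.\<close>

lemma similar_basic_imp_frame:
  assumes t: "is_op_tuple I (H, T, L, w)" and B: "unilateral_basic_tuple I (N, U, A, \<phi>)"
    and s: "similar_tuples I (H, T, L, w) (N, U, A, \<phi>)"
  shows "is_frame H (UNIV \<times> UNIV \<times> I) (orbit_vector H T L w)"
proof -
  note TD = is_op_tupleD[OF t] and BD = basic_tupleD[OF B]
  note onb = orthonormal_basis_trig_vector[OF TD(1)]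
  obtain C D where C: "bounded_operator H N C" and D: "bounded_operator N H D"
    and DC: "\<And>x. x \<in> H \<Longrightarrow> D (C x) = x"
    and Dtrig: "\<And>k j i. i \<in> I \<Longrightarrow> D (orth_proj N (trig_vector (k, j, i))) = orbit_vector H T L w (k, j, i)"
    using similar_basic_synthesis[OF t B s] by metis
  obtain D' where D': "bounded_operator H N D'"
    "\<And>x y. x \<in> N \<Longrightarrow> y \<in> H \<Longrightarrow> cinner (D x) y = cinner x (D' y)"
    using adjoint_exists[OF BD(1) D] by blast
  obtain M where M: "0 < M" "\<And>x. x \<in> H \<Longrightarrow> norm (C x) \<le> M * norm x"
    using bounded_operator_bound[OF C] by blast
  obtain M' where M': "0 < M'" "\<And>x. x \<in> H \<Longrightarrow> norm (D' x) \<le> M' * norm x"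
    using bounded_operator_bound[OF D'(1)] by blast
  have coeff: "cmod (cinner f (orbit_vector H T L w p)) = cmod (cinner (D' f) (trig_vector p))"
    if f: "f \<in> H" and p: "p \<in> UNIV \<times> UNIV \<times> I" for f p
  proof -
    let ?e = "orth_proj N (trig_vector p)"
    have "D ?e = orbit_vector H T L w p"
      using p Dtrig by auto
    then have "cinner (orbit_vector H T L w p) f = cinner ?e (D' f)"
      using D'(2)[OF orth_proj_in[OF BD(1)] f] by metis
    also have "\<dots> = cinner (trig_vector p) (D' f)"
      by (rule cinner_orth_proj[OF BD(1) bounded_operatorD(1)[OF D'(1) f]])
    finally show ?thesis
      by (metis cinner_commute complex_mod_cnj)
  qed
  have sum: "((\<lambda>p. (cmod (cinner f (orbit_vector H T L w p)))\<^sup>2) has_sum (norm (D' f))\<^sup>2) (UNIV \<times> UNIV \<times> I)"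
    if f: "f \<in> H" for f
  proof -
    have "D' f \<in> L2_hardy I"
      using bounded_operatorD(1)[OF D'(1) f] BD(2) by blast
    from parseval[OF onb this] show ?thesis
      by (rule has_sum_cong[THEN iffD2, rotated]) (simp add: coeff[OF f])
  qed
  have lower: "(1 / M)\<^sup>2 * (norm f)\<^sup>2 \<le> (norm (D' f))\<^sup>2" if f: "f \<in> H" for f
  proof -
    have "complex_of_real ((norm f)\<^sup>2) = cinner (C f) (D' f)"
      using D'(2)[OF bounded_operatorD(1)[OF C f] f] by (simp only: DC[OF f] cinner_self)
    then have "(norm f)\<^sup>2 = cmod (cinner (C f) (D' f))"
      by (metis norm_of_real abs_power2)
    also have "\<dots> \<le> norm (C f) * norm (D' f)"
      by (rule norm_cinner_le)
    also have "\<dots> \<le> (M * norm f) * norm (D' f)"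
      by (intro mult_right_mono M f) simp
    finally have "norm f \<le> M * norm (D' f)"
      by (cases "f = 0") (use M(1) in \<open>simp_all add: power2_eq_square mult_ac\<close>)
    then have "(1 / M) * norm f \<le> norm (D' f)"
      using M(1) by (simp add: field_simps)
    then have "((1 / M) * norm f)\<^sup>2 \<le> (norm (D' f))\<^sup>2"
      using M(1) by (intro power_mono) auto
    then show ?thesis
      by (simp only: power_mult_distrib)
  qed
  have upper: "(norm (D' f))\<^sup>2 \<le> M'\<^sup>2 * (norm f)\<^sup>2" if f: "f \<in> H" for f
    using power_mono[OF M'(2)[OF f], of 2] by (simp add: power_mult_distrib)
  show ?thesis
    unfolding is_frame_def
  proof (intro conjI ballI exI)
    show "orbit_vector H T L w p \<in> H" if "p \<in> UNIV \<times> UNIV \<times> I" for p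
      using that orbit_vector_shift(1)[OF t] by auto
    show "0 < (1 / M)\<^sup>2" "0 < M'\<^sup>2"
      using M(1) M'(1) by simp_all
    fix f assume f: "f \<in> H"
    show "(\<lambda>p. (cmod (cinner f (orbit_vector H T L w p)))\<^sup>2) summable_on UNIV \<times> UNIV \<times> I"
      by (rule has_sum_imp_summable[OF sum[OF f]])
    show "(1 / M)\<^sup>2 * (norm f)\<^sup>2
        \<le> (\<Sum>\<^sub>\<infinity>p\<in>UNIV \<times> UNIV \<times> I. (cmod (cinner f (orbit_vector H T L w p)))\<^sup>2)"
      unfolding infsumI[OF sum[OF f]] by (rule lower[OF f])
    show "(\<Sum>\<^sub>\<infinity>p\<in>UNIV \<times> UNIV \<times> I. (cmod (cinner f (orbit_vector H T L w p)))\<^sup>2)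
        \<le> M'\<^sup>2 * (norm f)\<^sup>2"
      unfolding infsumI[OF sum[OF f]] by (rule upper[OF f])
  qed
qed

text \<open>The operators \<open>D P\<close> and \<open>D' P'\<close> of the two tuples agree on the basis, so the projections \<open>P\<close> and \<open>P'\<close> have
  the same kernel.  For \<open>x \<in> N\<close> the vector \<open>y = x - P' x\<close> is killed by \<open>P'\<close>, hence by \<open>P\<close>; so it is
  orthogonal to \<open>x\<close> and to \<open>P' x\<close>, and thus to itself.\<close>

lemma similar_basic_subset:
  assumes t: "is_op_tuple I (H, T, L, w)"
    and B: "unilateral_basic_tuple I (N, U, A, \<phi>)" and s: "similar_tuples I (H, T, L, w) (N, U, A, \<phi>)"
    and B': "unilateral_basic_tuple I (N', U', A', \<phi>')" and s': "similar_tuples I (H, T, L, w) (N', U', A', \<phi>')"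
  shows "N \<subseteq> N'"
proof
  let ?X = "L2_hardy I"
  note onb = orthonormal_basis_trig_vector[OF is_op_tupleD(1)[OF t]]
  note BD = basic_tupleD[OF B] and BD' = basic_tupleD[OF B']
  obtain C D where D: "bounded_operator N H D" and CD: "\<And>y. y \<in> N \<Longrightarrow> C (D y) = y"
    and Dtrig: "\<And>k j i. i \<in> I \<Longrightarrow> D (orth_proj N (trig_vector (k, j, i))) = orbit_vector H T L w (k, j, i)"
    and C: "bounded_operator H N C"
    using similar_basic_synthesis[OF t B s] by metis
  obtain D' where D': "bounded_operator N' H D'"
    and Dtrig': "\<And>k j i. i \<in> I \<Longrightarrow> D' (orth_proj N' (trig_vector (k, j, i))) = orbit_vector H T L w (k, j, i)"
    using similar_basic_synthesis[OF t B' s'] by metis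
  have eq: "D (orth_proj N x) = D' (orth_proj N' x)" if "x \<in> ?X" for x
  proof (rule bounded_operators_eq_on_basis[OF onb _ _ _ that])
    show "bounded_operator ?X H (\<lambda>x. D (orth_proj N x))" "bounded_operator ?X H (\<lambda>x. D' (orth_proj N' x))"
      by (intro bounded_operator_compose[OF bounded_operator_orth_proj] BD BD' D D')+
  qed (auto simp: Dtrig Dtrig')
  fix x assume x: "x \<in> N"
  define y where "y = x - orth_proj N' x"
  have xX: "x \<in> ?X" and PX: "orth_proj N' x \<in> ?X" "orth_proj N' x \<in> N'"
    using x BD(2) BD'(2) orth_proj_in[OF BD'(1)] by blast+
  have y: "y \<in> ?X"
    unfolding y_def by (rule hilbert_subspaceD(6)[OF hilbert_subspace_L2_hardy xX PX(1)])
  have orth: "cinner y z = 0" if "z \<in> N'" for z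
    by (simp add: y_def cinner_diff_left cinner_orth_proj[OF BD'(1) that])
  have "orth_proj N' y = 0"
    by (rule orth_proj_eqI'[OF BD'(1)]) (simp_all add: orth hilbert_subspaceD(4)[OF BD'(1)])
  then have "D (orth_proj N y) = 0"
    using eq[OF y] bounded_operator_0[OF D' hilbert_subspaceD(1)[OF BD'(1)]] by simp
  then have "orth_proj N y = 0"
    using CD[OF orth_proj_in[OF BD(1)], of y] bounded_operator_0[OF C hilbert_subspaceD(1)[OF is_op_tupleD(2)[OF t]]]
    by simp
  then have "cinner y x = 0"
    using cinner_orth_proj[OF BD(1) x, of y] by simp
  then have "cinner y y = 0"
    using orth[OF PX(2)] by (subst (2) y_def) (simp add: cinner_diff_right)
  then have "x = orth_proj N' x"
    by (simp add: y_def)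
  then show "x \<in> N'"
    using PX(2) by simp
qed

lemma similar_basic_unique:
  assumes t: "is_op_tuple I (H, T, L, w)"
    and B: "unilateral_basic_tuple I B" "similar_tuples I (H, T, L, w) B"
    and B': "unilateral_basic_tuple I B'" "similar_tuples I (H, T, L, w) B'"
  shows "B = B'"
proof -
  obtain N U A \<phi> where 1: "B = (N, U, A, \<phi>)"
    by (cases B)
  obtain N' U' A' \<phi>' where 2: "B' = (N', U', A', \<phi>')"
    by (cases B')
  have "N = N'"
    using similar_basic_subset[OF t] B B' unfolding 1 2 by blast
  with B(1) B'(1) show ?thesis
    unfolding 1 2 by simp
qed

section \<open>From a frame to a basic tuple\<close>

text \<open>The upper frame bound makes the coefficients of \<open>x\<close> square summable, so that they are the
  coefficients of an element of \<open>X\<close>; by Parseval's identity its norm is governed by the frame bounds.\<close>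

lemma analysis_operator:
  assumes e: "orthonormal_basis_on X J e" and fr: "is_frame H J v" and H: "complex_vector.subspace H"
  obtains \<Theta> m where "bounded_operator H X \<Theta>" "0 < m" "\<And>x. x \<in> H \<Longrightarrow> m * norm x \<le> norm (\<Theta> x)"
    "\<And>x j. x \<in> H \<Longrightarrow> j \<in> J \<Longrightarrow> cinner (\<Theta> x) (e j) = cinner x (v j)"
proof -
  note XX = hilbert_subspaceD[OF orthonormal_basis_onD(1)[OF e]]
  obtain a b where ab: "0 < a" "0 < b"
    and sm: "\<And>f. f \<in> H \<Longrightarrow> (\<lambda>j. (cmod (cinner f (v j)))\<^sup>2) summable_on J"
    and lo: "\<And>f. f \<in> H \<Longrightarrow> a * (norm f)\<^sup>2 \<le> (\<Sum>\<^sub>\<infinity>j\<in>J. (cmod (cinner f (v j)))\<^sup>2)"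
    and up: "\<And>f. f \<in> H \<Longrightarrow> (\<Sum>\<^sub>\<infinity>j\<in>J. (cmod (cinner f (v j)))\<^sup>2) \<le> b * (norm f)\<^sup>2"
    using fr unfolding is_frame_def by metis
  have "\<exists>x. x \<in> X \<and> (\<forall>j\<in>J. cinner x (e j) = cinner f (v j))" if "f \<in> H" for f
    using riesz_fischer[OF e sm[OF that]] by blast
  then obtain \<Theta> where \<Theta>: "\<And>f. f \<in> H \<Longrightarrow> \<Theta> f \<in> X"
    "\<And>f j. f \<in> H \<Longrightarrow> j \<in> J \<Longrightarrow> cinner (\<Theta> f) (e j) = cinner f (v j)"
    by metis
  have norm: "(norm (\<Theta> f))\<^sup>2 = (\<Sum>\<^sub>\<infinity>j\<in>J. (cmod (cinner f (v j)))\<^sup>2)" if f: "f \<in> H" for f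
  proof -
    have "(\<Sum>\<^sub>\<infinity>j\<in>J. (cmod (cinner f (v j)))\<^sup>2) = (\<Sum>\<^sub>\<infinity>j\<in>J. (cmod (cinner (\<Theta> f) (e j)))\<^sup>2)"
      by (intro infsum_cong) (simp add: \<Theta>(2)[OF f])
    then show ?thesis
      using infsumI[OF parseval[OF e \<Theta>(1)[OF f]]] by simp
  qed
  have "bounded_operator H X \<Theta>"
  proof (rule bounded_operatorI[OF \<Theta>(1)])
    show "\<Theta> (x + y) = \<Theta> x + \<Theta> y" if "x \<in> H" "y \<in> H" for x y
      using that complex_vector.subspace_add[OF H that]
      by (intro basis_eqI[OF e]) (simp_all add: \<Theta> XX cinner_add_left)
    show "\<Theta> (c *\<^sub>C x) = c *\<^sub>C \<Theta> x" if "x \<in> H" for c x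
      using that complex_vector.subspace_scale[OF H that]
      by (intro basis_eqI[OF e]) (simp_all add: \<Theta> XX cinner_scaleC_left)
    fix x assume x: "x \<in> H"
    have "(norm (\<Theta> x))\<^sup>2 \<le> (sqrt b * norm x)\<^sup>2"
      using up[OF x] ab by (simp add: norm[OF x] power_mult_distrib)
    then show "norm (\<Theta> x) \<le> sqrt b * norm x"
      by (rule power2_le_imp_le) (use ab in simp)
  qed
  moreover have "sqrt a * norm x \<le> norm (\<Theta> x)" if x: "x \<in> H" for x
  proof (rule power2_le_imp_le)
    show "(sqrt a * norm x)\<^sup>2 \<le> (norm (\<Theta> x))\<^sup>2"
      using lo[OF x] ab by (simp add: norm[OF x] power_mult_distrib)
  qed simp
  ultimately show ?thesis
    using \<Theta>(2) ab(1) by (intro that[of \<Theta> "sqrt a"]) auto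
qed

text \<open>The subspace is the range \<open>N\<close> of the analysis operator \<open>\<Theta>\<close>, and the similarity \<open>C\<close> is the inverse of the
  synthesis operator \<open>V\<close> on \<open>N\<close>.  That \<open>V\<close> maps \<open>N\<close> onto \<open>H\<close> is invertibility of the frame operator
  \<open>V \<Theta>\<close>.  The invariance properties of \<open>N\<close> come from the formulas \<open>U\<^sup>* \<Theta> = \<Theta> T\<^sup>*\<close>, \<open>S\<^sup>* \<Theta> = \<Theta> L\<^sup>*\<close> and, with
  \<open>T'\<close> the inverse of \<open>T\<close>, \<open>U \<Theta> = \<Theta> T'\<^sup>*\<close>.\<close>

lemma frame_imp_similar_basic:
  fixes I :: "'i set" and H :: "'a::complex_inner set"
  assumes t: "is_op_tuple I (H, T, L, w)" and fr: "is_frame H (UNIV \<times> UNIV \<times> I) (orbit_vector H T L w)"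
  shows "\<exists>B. unilateral_basic_tuple I B \<and> similar_tuples I (H, T, L, w) B"
proof -
  let ?X = "L2_hardy I" and ?v = "orbit_vector H T L w"
  note TD = is_op_tupleD[OF t]
  note HH = hilbert_subspaceD[OF TD(2)]
  note onb = orthonormal_basis_trig_vector[OF TD(1)]
  note X = hilbert_subspace_L2_hardy[of I]
  note XX = hilbert_subspaceD[OF X]
  note UX = bounded_operatorD(1)[OF bounded_operator_opU[of I]]
    and SX = bounded_operatorD(1)[OF bounded_operator_opS[of I]]
  note TH = bounded_operatorD(1)[OF TD(3)] and LH = bounded_operatorD(1)[OF TD(4)]
  note trig = trig_vector_in[OF TD(1)]
  obtain \<Theta> m where \<Theta>: "bounded_operator H ?X \<Theta>" and m: "0 < m" "\<And>x. x \<in> H \<Longrightarrow> m * norm x \<le> norm (\<Theta> x)"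
    and \<Theta>e: "\<And>x p. x \<in> H \<Longrightarrow> p \<in> UNIV \<times> UNIV \<times> I \<Longrightarrow> cinner (\<Theta> x) (trig_vector p) = cinner x (?v p)"
    using analysis_operator[OF onb fr HH(1)] by blast
  note \<Theta>X = bounded_operatorD(1)[OF \<Theta>]
  obtain V where V: "bounded_operator ?X H V"
    and adj: "\<And>x y. x \<in> H \<Longrightarrow> y \<in> ?X \<Longrightarrow> cinner (\<Theta> x) y = cinner x (V y)"
    using adjoint_exists[OF TD(2) \<Theta>] by blast
  note VH = bounded_operatorD(1)[OF V]
  have adj': "cinner (V y) x = cinner y (\<Theta> x)" if "x \<in> H" "y \<in> ?X" for x y
    using adj[OF that] by (metis cinner_commute)
  have Ve: "V (trig_vector (k, j, i)) = ?v (k, j, i)" if i: "i \<in> I" for k j i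
  proof (rule cinner_eqI[OF HH(1) VH[OF trig[OF i]] orbit_vector_shift(1)[OF t i]])
    fix z assume z: "z \<in> H"
    have "cinner z (V (trig_vector (k, j, i))) = cinner z (?v (k, j, i))"
      using adj[OF z trig[OF i]] \<Theta>e[OF z, of "(k, j, i)"] i by simp
    then show "cinner (V (trig_vector (k, j, i))) z = cinner (?v (k, j, i)) z"
      by (metis cinner_commute)
  qed
  \<comment> \<open>The synthesis operator intertwines, because it does so on the basis.\<close>
  have VU: "V (opU x) = T (V x)" if x: "x \<in> ?X" for x
  proof (rule bounded_operators_eq_on_basis[OF onb _ _ _ x])
    show "bounded_operator ?X H (\<lambda>x. V (opU x))"
      by (rule bounded_operator_compose[OF bounded_operator_opU V])
    show "bounded_operator ?X H (\<lambda>x. T (V x))"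
      by (rule bounded_operator_compose[OF V TD(3)])
  qed (auto simp: opU_trig_vector Ve orbit_vector_shift[OF t])
  have VS: "V (opS x) = L (V x)" if x: "x \<in> ?X" for x
  proof (rule bounded_operators_eq_on_basis[OF onb _ _ _ x])
    show "bounded_operator ?X H (\<lambda>x. V (opS x))"
      by (rule bounded_operator_compose[OF bounded_operator_opS V])
    show "bounded_operator ?X H (\<lambda>x. L (V x))"
      by (rule bounded_operator_compose[OF V TD(4)])
  qed (auto simp: opS_trig_vector Ve orbit_vector_shift[OF t])
  obtain T' where T': "bounded_operator H H T'" "\<And>x. x \<in> H \<Longrightarrow> T' (T x) = x" "\<And>x. x \<in> H \<Longrightarrow> T (T' x) = x"
    using t by (auto simp: invertible_operator_def)
  obtain Ta where Ta: "bounded_operator H H Ta" "\<And>x y. x \<in> H \<Longrightarrow> y \<in> H \<Longrightarrow> cinner (T x) y = cinner x (Ta y)"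
    using adjoint_exists[OF TD(2,3)] by blast
  obtain La where La: "bounded_operator H H La" "\<And>x y. x \<in> H \<Longrightarrow> y \<in> H \<Longrightarrow> cinner (L x) y = cinner x (La y)"
    using adjoint_exists[OF TD(2,4)] by blast
  obtain T'a where T'a: "bounded_operator H H T'a" "\<And>x y. x \<in> H \<Longrightarrow> y \<in> H \<Longrightarrow> cinner (T' x) y = cinner x (T'a y)"
    using adjoint_exists[OF TD(2) T'(1)] by blast
  define N where "N = \<Theta> ` H"
  have N: "hilbert_subspace N"
    unfolding N_def by (rule hilbert_subspace_image[OF \<Theta> TD(2) m])
  note NN = hilbert_subspaceD[OF N]
  have NX: "N \<subseteq> ?X"
    using \<Theta>X by (auto simp: N_def)
  have PN: "orth_proj N x \<in> N" for x
    by (rule orth_proj_in[OF N])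
  have Uadj: "adjoint_on ?X opU (\<Theta> h) = \<Theta> (Ta h)" if h: "h \<in> H" for h
  proof (rule adjoint_on_eqI[OF X])
    note Tah = bounded_operatorD(1)[OF Ta(1) h]
    show "\<Theta> (Ta h) \<in> ?X"
      by (rule \<Theta>X[OF Tah])
    show "cinner (opU x) (\<Theta> h) = cinner x (\<Theta> (Ta h))" if x: "x \<in> ?X" for x
      by (simp add: adj'[OF h UX[OF x], symmetric] VU[OF x] Ta(2)[OF VH[OF x] h] adj'[OF Tah x])
  qed
  have Sadj: "adjoint_on ?X opS (\<Theta> h) = \<Theta> (La h)" if h: "h \<in> H" for h
  proof (rule adjoint_on_eqI[OF X])
    note Lah = bounded_operatorD(1)[OF La(1) h]
    show "\<Theta> (La h) \<in> ?X"
      by (rule \<Theta>X[OF Lah])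
    show "cinner (opS x) (\<Theta> h) = cinner x (\<Theta> (La h))" if x: "x \<in> ?X" for x
      by (simp add: adj'[OF h SX[OF x], symmetric] VS[OF x] La(2)[OF VH[OF x] h] adj'[OF Lah x])
  qed
  have UN: "opU x \<in> N" if xN: "x \<in> N" for x
  proof -
    obtain h where h: "h \<in> H" "x = \<Theta> h"
      using xN by (auto simp: N_def)
    note T'ah = bounded_operatorD(1)[OF T'a(1) h(1)]
    \<comment> \<open>Compare coefficients: \<open>U\<close> is isometric and shifts \<open>k\<close> up, \<open>T'\<close> shifts \<open>k\<close> down.\<close>
    have "opU (\<Theta> h) = \<Theta> (T'a h)"
    proof (rule basis_eqI[OF onb UX[OF \<Theta>X[OF h(1)]] \<Theta>X[OF T'ah]])
      fix p :: "int \<times> nat \<times> 'i" assume p: "p \<in> UNIV \<times> UNIV \<times> I"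
      obtain k j i where kji: "p = (k, j, i)" "i \<in> I"
        using p by auto
      note vH = orbit_vector_shift(1)[OF t kji(2)]
      have "cinner (opU (\<Theta> h)) (trig_vector p) = cinner (opU (\<Theta> h)) (opU (trig_vector (k - 1, j, i)))"
        by (simp add: opU_trig_vector kji(1))
      also have "\<dots> = cinner h (?v (k - 1, j, i))"
        using \<Theta>e[OF h(1), of "(k - 1, j, i)"] kji(2) by (simp add: cinner_mult_id)
      also have "?v (k - 1, j, i) = T' (?v (k, j, i))"
        using orbit_vector_shift(3)[OF t kji(2), of "k - 1" j] T'(2)[OF vH, of "k - 1" j] by simp
      also have "cinner h \<dots> = cinner (T'a h) (?v (k, j, i))"
        using T'a(2)[OF vH h(1), of k j] by (metis cinner_commute)
      also have "\<dots> = cinner (\<Theta> (T'a h)) (trig_vector p)"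
        using \<Theta>e[OF T'ah p] by (simp add: kji(1))
      finally show "cinner (opU (\<Theta> h)) (trig_vector p) = cinner (\<Theta> (T'a h)) (trig_vector p)" .
    qed
    then show ?thesis
      using T'ah by (simp add: N_def h(2))
  qed
  \<comment> \<open>The kernel of \<open>V\<close> contains the orthogonal complement of \<open>N\<close>.\<close>
  have VP: "V (orth_proj N x) = V x" if x: "x \<in> ?X" for x
  proof (rule cinner_eqI[OF HH(1)])
    have Px: "orth_proj N x \<in> ?X"
      using PN NX by blast
    show "V (orth_proj N x) \<in> H" "V x \<in> H"
      by (rule VH[OF Px], rule VH[OF x])
    fix z assume z: "z \<in> H"
    then have "\<Theta> z \<in> N"
      by (simp add: N_def)
    then show "cinner (V (orth_proj N x)) z = cinner (V x) z"
      by (simp add: adj'[OF z Px] adj'[OF z x] cinner_orth_proj[OF N])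
  qed
  have VN: "bounded_operator N H V"
    using bounded_operator_subset[OF V NX] by simp
  have bij: "bij_betw V N H"
    unfolding bij_betw_def
  proof
    have ker: "x = 0" if xN: "x \<in> N" and Vx: "V x = 0" for x
    proof -
      obtain h where h: "h \<in> H" "x = \<Theta> h"
        using xN by (auto simp: N_def)
      have "cinner x x = 0"
        using adj[OF h(1), of x] xN Vx NX h(2) by auto
      then show ?thesis
        by simp
    qed
    show "inj_on V N"
    proof (rule inj_onI)
      fix x y assume xy: "x \<in> N" "y \<in> N" "V x = V y"
      then have "V (x - y) = 0"
        by (simp add: bounded_operator_diff[OF VN NN(1)])
      then show "x = y"
        using ker[OF NN(6)[OF xy(1,2)]] by simp
    qed
    have "y \<in> V ` N" if y: "y \<in> H" for y
    proof -
      obtain x where "x \<in> H" "V (\<Theta> x) = y"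
        using adjoint_compose_surj[OF TD(2) \<Theta> V adj m y] by blast
      then show ?thesis
        by (auto simp: N_def)
    qed
    then show "V ` N = H"
      using bounded_operatorD(1)[OF VN] by blast
  qed
  define C where "C = inv_into N V"
  have C: "bounded_operator H N C"
    unfolding C_def by (rule bounded_inverse[OF N TD(2) VN bij])
  note CN = bounded_operatorD(1)[OF C]
  have Cbij: "bij_betw C H N"
    unfolding C_def by (rule bij_betw_inv_into[OF bij])
  have CV: "C (V x) = x" if "x \<in> N" for x
    using bij that by (simp add: C_def bij_betw_def)
  have VC: "V (C y) = y" if "y \<in> H" for y
    using bij that by (simp add: C_def bij_betw_def f_inv_into_f)
  have CX: "C y \<in> ?X" if "y \<in> H" for y
    using CN[OF that] NX by blast
  define A where "A = (\<lambda>f. orth_proj N (opS f))"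
  define \<phi> where "\<phi> = (\<lambda>i. orth_proj N (const_L2 (const_L2 (ell2_unit i :: 'i ell2))))"
  have CT: "opU (C x) = C (T x)" if x: "x \<in> H" for x
    using CV[OF UN[OF CN[OF x]]] by (simp add: VU[OF CX[OF x]] VC[OF x])
  have CL: "A (C x) = C (L x)" if x: "x \<in> H" for x
    using CV[OF PN, of "opS (C x)"] by (simp add: A_def VP[OF SX[OF CX[OF x]]] VS[OF CX[OF x]] VC[OF x])
  have Cw: "C (w i) = \<phi> i" if i: "i \<in> I" for i
    using CV[OF PN, of "trig_vector (0, 0, i)"]
    by (simp add: \<phi>_def const_eq_trig_vector VP[OF trig[OF i]] Ve[OF i] orbit_vector_shift(2)[OF t i])
  \<comment> \<open>All properties of the operators on \<open>N\<close> are transported from \<open>H\<close> by conjugation with \<open>C\<close>.\<close>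
  have res: "restrict opU N x = C (T (V x))" "restrict A N x = C (L (V x))" if x: "x \<in> N" for x
    using x CT[OF bounded_operatorD(1)[OF VN x]] CL[OF bounded_operatorD(1)[OF VN x]] by (simp_all add: CV)
  have sep: "separable_space (top_of_set N)"
  proof (rule separable_space_continuous_map_image)
    show "separable_space (top_of_set H)"
      using t by (simp add: separable_hilbert_space_def)
    show "continuous_map (top_of_set H) (top_of_set N) C"
      using bounded_operator_continuous_on[OF C HH(1)] CN by auto
    show "C ` topspace (top_of_set H) = topspace (top_of_set N)"
      using Cbij by (simp add: bij_betw_def)
  qed
  note VNH = bounded_operatorD(1)[OF VN]
  have tuple: "is_op_tuple I (N, restrict opU N, restrict A N, restrict \<phi> I)"
    unfolding is_op_tuple.simps
  proof (intro conjI ballI)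
    show "countable I"
      by (rule TD(1))
    show "separable_hilbert_space N"
      using NN(1,2) sep by (simp add: separable_hilbert_space_def)
    show "bounded_operator N N (restrict A N)"
      by (rule bounded_operator_cong[where B = "\<lambda>x. C (L (V x))", THEN iffD2, OF res(2) NN(1)])
        (assumption, rule bounded_operator_compose[OF bounded_operator_compose[OF VN TD(4)] C])
    have "bounded_operator N N (restrict opU N)"
      by (rule bounded_operator_cong[where B = "\<lambda>x. C (T (V x))", THEN iffD2, OF res(1) NN(1)])
        (assumption, rule bounded_operator_compose[OF bounded_operator_compose[OF VN TD(3)] C])
    moreover have "bounded_operator N N (\<lambda>x. C (T' (V x)))"
      by (rule bounded_operator_compose[OF bounded_operator_compose[OF VN T'(1)] C])
    moreover have "C (T' (V (restrict opU N x))) = x \<and> restrict opU N (C (T' (V x))) = x" if x: "x \<in> N" for x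
      using CN[OF bounded_operatorD(1)[OF T'(1) VNH[OF x]]]
      by (simp add: res x VC CV TH VNH bounded_operatorD(1)[OF T'(1)] T' CN del: restrict_apply restrict_apply')
    ultimately show "invertible_operator N (restrict opU N)"
      unfolding invertible_operator_def by blast
    show "restrict opU N (restrict A N x) = restrict A N (restrict opU N x)" if x: "x \<in> N" for x
      by (simp add: res x VC CN TH LH VNH TD(6) del: restrict_apply restrict_apply')
    show "restrict \<phi> I i \<in> N" if "i \<in> I" for i
      using that by (simp add: \<phi>_def PN)
  qed
  have inv1: "adjoint_on ?X opU x \<in> N" "adjoint_on ?X opS x \<in> N" if x: "x \<in> N" for x
    using x bounded_operatorD(1)[OF Ta(1)] bounded_operatorD(1)[OF La(1)]
    by (auto simp: N_def Uadj Sadj)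
  have "unilateral_basic_tuple I (N, restrict opU N, restrict A N, restrict \<phi> I)"
    unfolding unilateral_basic_tuple.simps reducing_on_def invariant_under_def
    using tuple NN NX UN inv1 by (auto simp: A_def \<phi>_def)
  moreover have "similar_tuples I (H, T, L, w) (N, restrict opU N, restrict A N, restrict \<phi> I)"
    unfolding similar_tuples.simps
    using C Cbij Cw CT CL CN by (intro exI[of _ C]) auto
  ultimately show ?thesis
    by blast
qed

theorem theorem3p9:
  fixes I :: "'i set"
    and H :: "'a::complex_inner set"
    and T L :: "'a \<Rightarrow> 'a"
    and w :: "'i \<Rightarrow> 'a"
  assumes "is_op_tuple I (H, T, L, w)"
  shows "(unilateral_frame_tuple I (H, T, L, w) \<longleftrightarrow>
           (\<exists>B. unilateral_basic_tuple I B \<and> similar_tuples I (H, T, L, w) B)) \<and>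
         (\<forall>B B'. unilateral_basic_tuple I B \<and> similar_tuples I (H, T, L, w) B \<and>
                 unilateral_basic_tuple I B' \<and> similar_tuples I (H, T, L, w) B' \<longrightarrow> B = B')"
proof (intro conjI allI impI)
  have frame: "unilateral_frame_tuple I (H, T, L, w) \<longleftrightarrow>
      is_frame H (UNIV \<times> UNIV \<times> I) (orbit_vector H T L w)"
    using assms by (simp only: unilateral_frame_tuple.simps orbit_vector_def simp_thms)
  show "unilateral_frame_tuple I (H, T, L, w) \<longleftrightarrow>
      (\<exists>B. unilateral_basic_tuple I B \<and> similar_tuples I (H, T, L, w) B)"
    unfolding frame
  proof
    assume "\<exists>B. unilateral_basic_tuple I B \<and> similar_tuples I (H, T, L, w) B"
    then show "is_frame H (UNIV \<times> UNIV \<times> I) (orbit_vector H T L w)"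
      using similar_basic_imp_frame[OF assms] by (metis prod_cases4)
  qed (rule frame_imp_similar_basic[OF assms])
  show "B = B'" if "unilateral_basic_tuple I B \<and> similar_tuples I (H, T, L, w) B \<and>
      unilateral_basic_tuple I B' \<and> similar_tuples I (H, T, L, w) B'" for B B'
    using that similar_basic_unique[OF assms] by blast
qed

end
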